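(* Let $c\in\mathbb R$ and let $f\in\mathbb L^2(\mathbb R_+,x^{2c-1})$. Assume that $\mathbb E_{f_Y}(Y_1^{5(c-1)})<\infty$, that $\|g\|_{\infty,x^{2c-1}}<\infty$, and that there exist $c_g,C_g,\gamma>0$ such that $c_g(1+t^2)^{-\gamma/2}\le|\mathcal M_c[g](t)|\le C_g(1+t^2)^{-\gamma/2}$ for all $t\in\mathbb R$. Let $r>\max(0,\gamma^{-1}-1)$ and $\chi_2\ge\chi_1\ge72$. Then for every $n\in\mathbb N$ with $\mathcal K_n\neq\emptyset$, $$\mathbb E_{f_Y}^n\big(\|\widehat f_{\widehat k}-f\|_{x^{2c-1}}^2\big)\le C_1\inf_{k\in\mathcal K_n}\big(\|\mathbf 1_{G_k}\mathcal M_c[f]\|_{\mathbb R}^2+V(k)\big)+\frac{C_2}{n},$$ where $C_1$ is a positive constant depending on $\chi_1,\chi_2$, and $C_2$ is a positive constant depending on $\mathbb E_{f_Y}(Y_1^{5(c-1)})$, $\|g\|_{\infty,x^{2c-1}}$, $g$ and $r$; neither depends on $n$.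
   Context: Model: $X$ and $U$ are independent positive random variables with Lebesgue densities $f$ (unknown) and $g$ (known) on $\mathbb R_+=(0,\infty)$; $Y=XU$ has density $f_Y(y)=\int_0^\infty f(x)g(y/x)x^{-1}dx$. $Y_1,\dots,Y_n$ are i.i.d. copies of $Y$; $\mathbb E_{f_Y}^n$ is expectation under their joint law and $\mathbb E_{f_Y}=\mathbb E_{f_Y}^1$. Norms: $\|h\|_{x^{2c-1}}^2=\int_0^\infty|h(x)|^2x^{2c-1}dx$, $\mathbb L^2(\mathbb R_+,x^{2c-1})$ is the space of measurable complex-valued functions for which this is finite, $\|H\|_{\mathbb R}^2=\int_{\mathbb R}|H(t)|^2dt$, and $\|h\|_{\infty,x^{2c-1}}$ is the essential supremum of $x\mapsto x^{2c-1}|h(x)|$ on $\mathbb R_+$. Mellin transform: $\mathcal M_c[h](t)=\int_0^\infty x^{c-1+it}h(x)dx$, $t\in\mathbb R$, whenever $\int_0^\infty x^{c-1}|h(x)|dx<\infty$. Ridge estimator (with $\xi=0$): for $k>0$ set $$\mathrm R_k(t)=\frac{\mathcal M_c[g](-t)\,|\mathcal M_c[g](t)|^r}{\max(|\mathcal M_c[g](t)|,k^{-1})^{r+2}},\qquad \widehat{\mathcal M}_c(t)=\frac1n\sum_{j=1}^nY_j^{c-1+it},\qquad \widehat f_k(x)=\frac1{2\pi}\int_{-\infty}^\infty x^{-c-it}\,\widehat{\mathcal M}_c(t)\,\mathrm R_k(t)\,dt,\quad x>0,$$ and $G_k=\{t\in\mathbb R:k^{-1}>|\mathcal M_c[g](t)|\}$.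 Data-driven choice of $k$: $\mathcal K_n=\{k\in\mathbb N:\|\mathrm R_k\|_{\mathbb R}^2\le n\}$, $\sigma_c=\mathbb E_{f_Y}(Y_1^{2(c-1)})$, $\widehat\sigma_c=n^{-1}\sum_{j=1}^nY_j^{2(c-1)}$, $V(k)=\sigma_c\|\mathrm R_k\|_{\mathbb R}^2n^{-1}$, $\widehat V(k)=2\widehat\sigma_c\|\mathrm R_k\|_{\mathbb R}^2n^{-1}$, $$\widehat A(k)=\sup_{k'\in\mathcal K_n}\big(\|\widehat f_{k'}-\widehat f_{\min(k',k)}\|_{x^{2c-1}}^2-\chi_1\widehat V(k')\big)_+,\qquad \widehat k\in\operatorname*{arg\,min}_{k\in\mathcal K_n}\big(\widehat A(k)+\chi_2\widehat V(k)\big),$$ where $a_+=\max(a,0)$.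
   Formalization: The constant C_2 may also depend on c and on σ_c = E(Y_1^{2(c-1)}): with the listed quantities alone the bound fails uniformly in f, e.g. for c=2, χ_1=χ_2=72, large γ and mixtures f with E(Y_1^5) fixed but σ_c tending to 0. *)

theory Defs
  imports "HOL-Probability.Probability"
begin

definition Rplus :: "real measure" where
  "Rplus = restrict_space lborel {0<..}"

definition pos_density :: "(real \<Rightarrow> real) \<Rightarrow> bool" where
  "pos_density h \<longleftrightarrow> h \<in> borel_measurable Rplus \<and> (\<forall>x>0. 0 \<le> h x) \<and>
     (\<integral>\<^sup>+x. ennreal (h x) \<partial>Rplus) = 1"


section \<open>Norms and the Mellin transform\<close>

text \<open>Squared norms are extended nonnegative reals, so that \<open>\<infinity>\<close> stands for a function that is not
  square integrable (a Bochner integral would give 0).\<close>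

definition wnorm2 :: "real \<Rightarrow> (real \<Rightarrow> complex) \<Rightarrow> ennreal" where
  "wnorm2 c h = (\<integral>\<^sup>+x. ennreal ((cmod (h x))\<^sup>2 * x powr (2 * c - 1)) \<partial>Rplus)"

definition norm2 :: "(real \<Rightarrow> complex) \<Rightarrow> ennreal" where
  "norm2 H = (\<integral>\<^sup>+t. ennreal ((cmod (H t))\<^sup>2) \<partial>lborel)"

definition wL2 :: "real \<Rightarrow> (real \<Rightarrow> complex) set" where
  "wL2 c = {h \<in> borel_measurable Rplus. wnorm2 c h < \<infinity>}"

definition wsup_norm :: "real \<Rightarrow> (real \<Rightarrow> real) \<Rightarrow> ennreal" where
  "wsup_norm c h = esssup Rplus (\<lambda>x. ennreal (x powr (2 * c - 1) * \<bar>h x\<bar>))"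

definition mellin :: "real \<Rightarrow> (real \<Rightarrow> real) \<Rightarrow> real \<Rightarrow> complex" where
  "mellin c h t = (LINT x|Rplus. of_real x powr Complex (c - 1) t * of_real (h x))"


section \<open>The law of the observations\<close>

definition conv_density :: "(real \<Rightarrow> real) \<Rightarrow> (real \<Rightarrow> real) \<Rightarrow> real \<Rightarrow> ennreal" where
  "conv_density f g y = (\<integral>\<^sup>+x. ennreal (f x * g (y / x) / x) \<partial>Rplus)"

definition law_Y :: "(real \<Rightarrow> real) \<Rightarrow> (real \<Rightarrow> real) \<Rightarrow> real measure" where
  "law_Y f g = density Rplus (conv_density f g)"

text \<open>\<open>law_Y f g\<close> is the law of \<open>X U\<close> for independent \<open>X\<close>, \<open>U\<close> with densities \<open>f\<close>, \<open>g\<close>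
  (lemma \<open>law_Y_eq_distr\<close>).\<close>

lemma space_Rplus [simp]: "space Rplus = {0<..}" by (simp add: Rplus_def space_restrict_space)

lemma sets_Rplus: "sets Rplus = sets (restrict_space borel {0<..})"
  by (simp add: Rplus_def sets_restrict_space)

lemma nn_integral_Rplus: "(\<integral>\<^sup>+x. h x \<partial>Rplus) = (\<integral>\<^sup>+x. h x * indicator {0<..} x \<partial>lborel)"
  by (simp add: Rplus_def nn_integral_restrict_space)

lemma sigma_finite_Rplus: "sigma_finite_measure Rplus"
  unfolding Rplus_def by (rule sigma_finite_measure_restrict_space) (auto simp: lborel.sigma_finite_measure_axioms)

lemma nn_integral_Rplus_scale:
  assumes h: "h \<in> borel_measurable Rplus" and x: "0 < x"
  shows "(\<integral>\<^sup>+u. h u \<partial>Rplus) = (\<integral>\<^sup>+y. h (y / x) * ennreal (1 / x) \<partial>Rplus)"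
proof -
  have m: "(\<lambda>u. h u * indicator {0<..} u) \<in> borel_measurable borel"
    using h by (subst (asm) Rplus_def) (simp add: borel_measurable_restrict_space_iff_ennreal)
  have "(\<integral>\<^sup>+u. h u \<partial>Rplus) = ennreal \<bar>1/x\<bar> * (\<integral>\<^sup>+y. h (0 + (1/x) * y) * indicator {0<..} (0 + (1/x) * y) \<partial>lborel)"
    unfolding nn_integral_Rplus using x by (intro nn_integral_real_affine m) auto
  also have "(\<integral>\<^sup>+y. h (0 + (1/x) * y) * indicator {0<..} (0 + (1/x) * y) \<partial>lborel) = (\<integral>\<^sup>+y. h (y/x) * indicator {0<..} y \<partial>lborel)"
    using x by (intro nn_integral_cong) (auto simp: indicator_def zero_less_divide_iff)
  also have "ennreal \<bar>1/x\<bar> * \<dots> = (\<integral>\<^sup>+y. ennreal (1/x) * (h (y/x) * indicator {0<..} y) \<partial>lborel)"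
  proof -
    have "(\<lambda>y. (\<lambda>u. h u * indicator {0<..} u) (y/x)) \<in> borel_measurable borel"
      by (rule measurable_compose[OF _ m]) simp
    also have "(\<lambda>y. (\<lambda>u. h u * indicator {0<..} u) (y/x)) = (\<lambda>y. h (y/x) * indicator {0<..} y)"
      using x by (auto simp: indicator_def zero_less_divide_iff fun_eq_iff)
    finally show ?thesis using x by (subst nn_integral_cmult) auto
  qed
  finally show ?thesis unfolding nn_integral_Rplus by (simp add: mult_ac)
qed

lemma law_Y_eq_distr:
  assumes f: "pos_density f" and g: "pos_density g"
  shows "law_Y f g = distr (density Rplus (\<lambda>x. ennreal (f x)) \<Otimes>\<^sub>M density Rplus (\<lambda>x. ennreal (g x)))
    Rplus (\<lambda>(x, u). x * u)"
proof -
  interpret sigma_finite_measure Rplus by (rule sigma_finite_Rplus)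
  interpret pair_sigma_finite Rplus Rplus ..
  note [measurable] = f[unfolded pos_density_def, THEN conjunct1] g[unfolded pos_density_def, THEN conjunct1]
  have pf: "prob_space (density Rplus (\<lambda>x. ennreal (f x)))"
   and pg: "prob_space (density Rplus (\<lambda>x. ennreal (g x)))"
  proof -
    have "prob_space (density Rplus (\<lambda>x. ennreal (h x)))" if "pos_density h" for h
    proof (rule prob_spaceI)
      have "emeasure (density Rplus (\<lambda>x. ennreal (h x))) (space Rplus) = (\<integral>\<^sup>+x. ennreal (h x) * indicator (space Rplus) x \<partial>Rplus)"
        using that unfolding pos_density_def by (intro emeasure_density sets.top) auto
      also have "\<dots> = (\<integral>\<^sup>+x. ennreal (h x) \<partial>Rplus)" by (intro nn_integral_cong) auto
      also have "\<dots> = 1" using that by (simp add: pos_density_def)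
      finally show "emeasure (density Rplus (\<lambda>x. ennreal (h x))) (space (density Rplus (\<lambda>x. ennreal (h x)))) = 1" by simp
    qed
    thus "prob_space (density Rplus (\<lambda>x. ennreal (f x)))" "prob_space (density Rplus (\<lambda>x. ennreal (g x)))" using f g by auto
  qed
  have sb: "sets Rplus = sets (restrict_space borel {0<..})" by (rule sets_Rplus)
  have idm: "(\<lambda>x. x) \<in> Rplus \<rightarrow>\<^sub>M borel" by (simp add: Rplus_def measurable_restrict_space1)
  have mul: "(\<lambda>(x, u). x * u) \<in> Rplus \<Otimes>\<^sub>M Rplus \<rightarrow>\<^sub>M Rplus"
    and dv: "(\<lambda>(x, u). u / x) \<in> Rplus \<Otimes>\<^sub>M Rplus \<rightarrow>\<^sub>M Rplus"
  proof -
    have 1: "(\<lambda>p. fst p * snd p) \<in> borel_measurable (Rplus \<Otimes>\<^sub>M Rplus)"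
      "(\<lambda>p. snd p / fst p) \<in> borel_measurable (Rplus \<Otimes>\<^sub>M Rplus)"
      by (intro borel_measurable_times borel_measurable_divide
        measurable_compose[OF measurable_fst idm] measurable_compose[OF measurable_snd idm])+
    show "(\<lambda>(x, u). x * u) \<in> Rplus \<Otimes>\<^sub>M Rplus \<rightarrow>\<^sub>M Rplus"
      "(\<lambda>(x, u). u / x) \<in> Rplus \<Otimes>\<^sub>M Rplus \<rightarrow>\<^sub>M Rplus"
      unfolding measurable_cong_sets[OF refl sb] split_beta
      by (intro measurable_restrict_space2 1; auto simp: space_pair_measure)+
  qed
  have gd: "(\<lambda>p. ennreal (f (fst p) * g (snd p / fst p) / fst p)) \<in> borel_measurable (Rplus \<Otimes>\<^sub>M Rplus)"
  proof -
    have a: "(\<lambda>p. f (fst p)) \<in> borel_measurable (Rplus \<Otimes>\<^sub>M Rplus)" by measurable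
    have b: "(\<lambda>p. g (snd p / fst p)) \<in> borel_measurable (Rplus \<Otimes>\<^sub>M Rplus)"
      using measurable_compose[OF dv, of g borel] by (simp add: split_beta)
    show ?thesis
      by (intro measurable_compose[OF _ measurable_ennreal] borel_measurable_divide borel_measurable_times
        a b measurable_compose[OF measurable_fst idm])
  qed
  have cm: "conv_density f g \<in> borel_measurable Rplus"
    unfolding conv_density_def
    by (rule sigma_finite_measure.borel_measurable_nn_integral[OF sigma_finite_Rplus])
      (use measurable_pair_swap[OF gd] in \<open>simp add: split_beta\<close>)
  show ?thesis
  proof (rule measure_eqI)
    show "sets (law_Y f g) = sets (distr (density Rplus (\<lambda>x. ennreal (f x)) \<Otimes>\<^sub>M density Rplus (\<lambda>x. ennreal (g x)))
    Rplus (\<lambda>(x, u). x * u))" by (simp add: law_Y_def)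
  next
    fix A assume "A \<in> sets (law_Y f g)"
    hence A[measurable]: "A \<in> sets Rplus" by (simp add: law_Y_def)
    have mul': "(\<lambda>(x, u). x * u) \<in> density Rplus (\<lambda>x. ennreal (f x)) \<Otimes>\<^sub>M density Rplus (\<lambda>x. ennreal (g x)) \<rightarrow>\<^sub>M Rplus"
      using mul by (simp cong: measurable_cong_sets sets_pair_measure_cong)
    have ie: "(\<lambda>p. indicator A (fst p * snd p) :: ennreal) \<in> borel_measurable (Rplus \<Otimes>\<^sub>M Rplus)"
      using measurable_compose[OF mul, of "indicator A" borel] by (auto simp: split_beta)
    have "emeasure (distr (density Rplus (\<lambda>x. ennreal (f x)) \<Otimes>\<^sub>M density Rplus (\<lambda>x. ennreal (g x))) Rplus (\<lambda>(x, u). x * u)) A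
       = (\<integral>\<^sup>+p. indicator A (fst p * snd p) \<partial>(density Rplus (\<lambda>x. ennreal (f x)) \<Otimes>\<^sub>M density Rplus (\<lambda>x. ennreal (g x))))"
      using mul' by (subst nn_integral_indicator[symmetric], simp, subst nn_integral_distr) (auto simp: split_beta)
    also have "\<dots> = (\<integral>\<^sup>+x. \<integral>\<^sup>+u. indicator A (x * u) \<partial>density Rplus (\<lambda>x. ennreal (g x)) \<partial>density Rplus (\<lambda>x. ennreal (f x)))"
      using ie pg by (subst sigma_finite_measure.nn_integral_fst[symmetric])
        (auto simp: prob_space_imp_sigma_finite cong: measurable_cong_sets sets_pair_measure_cong)
    also have "\<dots> = (\<integral>\<^sup>+x. ennreal (f x) * (\<integral>\<^sup>+u. ennreal (g u) * indicator A (x * u) \<partial>Rplus) \<partial>Rplus)"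
    proof -
      have i: "(\<lambda>u. indicator A (x * u) :: ennreal) \<in> borel_measurable Rplus" if "x \<in> space Rplus" for x
        using measurable_compose[OF measurable_Pair1' ie, OF that] by simp
      have "(\<integral>\<^sup>+x. \<integral>\<^sup>+u. indicator A (x * u) \<partial>density Rplus (\<lambda>x. ennreal (g x)) \<partial>density Rplus (\<lambda>x. ennreal (f x)))
        = (\<integral>\<^sup>+x. (\<integral>\<^sup>+u. ennreal (g u) * indicator A (x * u) \<partial>Rplus) \<partial>density Rplus (\<lambda>x. ennreal (f x)))"
        using i by (intro nn_integral_cong nn_integral_density) auto
      also have "\<dots> = (\<integral>\<^sup>+x. ennreal (f x) * (\<integral>\<^sup>+u. ennreal (g u) * indicator A (x * u) \<partial>Rplus) \<partial>Rplus)"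
        using ie by (intro nn_integral_density borel_measurable_nn_integral) (auto simp: split_beta)
      finally show ?thesis .
    qed
    also have "\<dots> = (\<integral>\<^sup>+x. \<integral>\<^sup>+y. ennreal (f x * g (y / x) / x) * indicator A y \<partial>Rplus \<partial>Rplus)"
    proof (rule nn_integral_cong)
      fix x assume "x \<in> space Rplus"
      hence x: "0 < x" by simp
      have i: "(\<lambda>u. indicator A (x * u) :: ennreal) \<in> borel_measurable Rplus"
        using measurable_compose[OF measurable_Pair1' ie, of x] x by simp
      have d: "(\<lambda>y. g (y / x)) \<in> borel_measurable Rplus"
        using measurable_compose[OF measurable_Pair1' measurable_compose[OF dv, of g borel], of x] x by simp
      have "(\<integral>\<^sup>+u. ennreal (g u) * indicator A (x * u) \<partial>Rplus)
         = (\<integral>\<^sup>+y. ennreal (g (y/x)) * indicator A (x * (y/x)) * ennreal (1/x) \<partial>Rplus)"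
        using i by (subst nn_integral_Rplus_scale[OF _ x]) auto
      hence "ennreal (f x) * (\<integral>\<^sup>+u. ennreal (g u) * indicator A (x * u) \<partial>Rplus)
         = ennreal (f x) * (\<integral>\<^sup>+y. ennreal (g (y/x)) * indicator A y * ennreal (1/x) \<partial>Rplus)"
        using x by simp
      also have "\<dots> = (\<integral>\<^sup>+y. ennreal (f x) * (ennreal (g (y/x)) * indicator A y * ennreal (1/x)) \<partial>Rplus)"
        using d by (subst nn_integral_cmult) auto
      also have "\<dots> = (\<integral>\<^sup>+y. ennreal (f x * g (y / x) / x) * indicator A y \<partial>Rplus)"
        using x f g unfolding pos_density_def
        by (intro nn_integral_cong) (auto simp: ennreal_mult' indicator_def divide_inverse mult.assoc ennreal_mult)
      finally show "ennreal (f x) * (\<integral>\<^sup>+u. ennreal (g u) * indicator A (x * u) \<partial>Rplus)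
        = (\<integral>\<^sup>+y. ennreal (f x * g (y / x) / x) * indicator A y \<partial>Rplus)" .
    qed
    also have "\<dots> = (\<integral>\<^sup>+y. \<integral>\<^sup>+x. ennreal (f x * g (y / x) / x) * indicator A y \<partial>Rplus \<partial>Rplus)"
      using gd by (intro Fubini'[symmetric]) (auto simp: split_beta)
    also have "\<dots> = (\<integral>\<^sup>+y. conv_density f g y * indicator A y \<partial>Rplus)"
      unfolding conv_density_def
    proof (intro nn_integral_cong)
      fix y assume "y \<in> space Rplus"
      hence "(\<lambda>x. ennreal (f x * g (y / x) / x)) \<in> borel_measurable Rplus"
        using measurable_compose[OF measurable_Pair2' gd] by simp
      thus "(\<integral>\<^sup>+x. ennreal (f x * g (y / x) / x) * indicator A y \<partial>Rplus) = (\<integral>\<^sup>+x. ennreal (f x * g (y / x) / x) \<partial>Rplus) * indicator A y"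
        by (rule nn_integral_multc)
    qed
    also have "\<dots> = emeasure (law_Y f g) A"
      unfolding law_Y_def using cm by (simp add: emeasure_density)
    finally show "emeasure (law_Y f g) A = emeasure (distr (density Rplus (\<lambda>x. ennreal (f x)) \<Otimes>\<^sub>M density Rplus (\<lambda>x. ennreal (g x))) Rplus (\<lambda>(x, u). x * u)) A" ..
  qed
qed

text \<open>A sample of size \<open>n\<close> is a function \<open>Y\<close> on \<open>{..<n}\<close> with values in \<open>{0<..}\<close>.\<close>

definition sample_law :: "(real \<Rightarrow> real) \<Rightarrow> (real \<Rightarrow> real) \<Rightarrow> nat \<Rightarrow> (nat \<Rightarrow> real) measure" where
  "sample_law f g n = PiM {..<n} (\<lambda>_. law_Y f g)"

definition moment_Y :: "(real \<Rightarrow> real) \<Rightarrow> (real \<Rightarrow> real) \<Rightarrow> real \<Rightarrow> ennreal" where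
  "moment_Y f g p = (\<integral>\<^sup>+y. ennreal (y powr p) \<partial>law_Y f g)"


section \<open>The ridge estimator\<close>

definition ridge :: "real \<Rightarrow> (real \<Rightarrow> real) \<Rightarrow> real \<Rightarrow> real \<Rightarrow> real \<Rightarrow> complex" where
  "ridge c g r k t = mellin c g (- t) * of_real (cmod (mellin c g t) powr r)
     / of_real (max (cmod (mellin c g t)) (1 / k) powr (r + 2))"

definition emp_mellin :: "real \<Rightarrow> nat \<Rightarrow> (nat \<Rightarrow> real) \<Rightarrow> real \<Rightarrow> complex" where
  "emp_mellin c n Y t = (\<Sum>j<n. of_real (Y j) powr Complex (c - 1) t) / of_nat n"

definition fhat ::
    "real \<Rightarrow> (real \<Rightarrow> real) \<Rightarrow> real \<Rightarrow> nat \<Rightarrow> (nat \<Rightarrow> real) \<Rightarrow> real \<Rightarrow> real \<Rightarrow> complex" where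
  "fhat c g r n Y k x = (LINT t|lborel.
     of_real x powr Complex (- c) (- t) * emp_mellin c n Y t * ridge c g r k t) / of_real (2 * pi)"

definition Gset :: "real \<Rightarrow> (real \<Rightarrow> real) \<Rightarrow> real \<Rightarrow> real set" where
  "Gset c g k = {t. 1 / k > cmod (mellin c g t)}"


section \<open>The data-driven choice of \<open>k\<close>\<close>

definition Kset :: "real \<Rightarrow> (real \<Rightarrow> real) \<Rightarrow> real \<Rightarrow> nat \<Rightarrow> nat set" where
  "Kset c g r n = {k. 1 \<le> k \<and> norm2 (ridge c g r (real k)) \<le> of_nat n}"

definition sigma_c :: "real \<Rightarrow> (real \<Rightarrow> real) \<Rightarrow> (real \<Rightarrow> real) \<Rightarrow> ennreal" where
  "sigma_c c f g = moment_Y f g (2 * (c - 1))"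

definition sigma_hat :: "real \<Rightarrow> nat \<Rightarrow> (nat \<Rightarrow> real) \<Rightarrow> real" where
  "sigma_hat c n Y = (\<Sum>j<n. Y j powr (2 * (c - 1))) / real n"

definition V :: "real \<Rightarrow> (real \<Rightarrow> real) \<Rightarrow> (real \<Rightarrow> real) \<Rightarrow> real \<Rightarrow> nat \<Rightarrow> nat \<Rightarrow> ennreal" where
  "V c f g r n k = sigma_c c f g * norm2 (ridge c g r (real k)) / of_nat n"

definition Vhat :: "real \<Rightarrow> (real \<Rightarrow> real) \<Rightarrow> real \<Rightarrow> nat \<Rightarrow> (nat \<Rightarrow> real) \<Rightarrow> nat \<Rightarrow> ennreal" where
  "Vhat c g r n Y k = 2 * ennreal (sigma_hat c n Y) * norm2 (ridge c g r (real k)) / of_nat n"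

text \<open>Subtraction on \<^typ>\<open>ennreal\<close> is truncated at 0, so it is the positive part of the difference.\<close>

definition Ahat ::
    "real \<Rightarrow> (real \<Rightarrow> real) \<Rightarrow> real \<Rightarrow> real \<Rightarrow> nat \<Rightarrow> (nat \<Rightarrow> real) \<Rightarrow> nat \<Rightarrow> ennreal" where
  "Ahat c g r chi1 n Y k = (SUP k' \<in> Kset c g r n.
     wnorm2 c (\<lambda>x. fhat c g r n Y (real k') x - fhat c g r n Y (real (min k' k)) x)
       - ennreal chi1 * Vhat c g r n Y k')"

text \<open>A data-driven parameter is a measurable function of the sample that selects a minimiser; where
  there are several, any of them may be taken.\<close>

definition khat_choice ::
    "real \<Rightarrow> (real \<Rightarrow> real) \<Rightarrow> real \<Rightarrow> real \<Rightarrow> real \<Rightarrow> nat \<Rightarrow> ((nat \<Rightarrow> real) \<Rightarrow> nat) \<Rightarrow> bool" where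
  "khat_choice c g r chi1 chi2 n khat \<longleftrightarrow>
     khat \<in> PiM {..<n} (\<lambda>_. Rplus) \<rightarrow>\<^sub>M count_space UNIV \<and>
     (\<forall>Y \<in> space (PiM {..<n} (\<lambda>_. Rplus)).
        is_arg_min (\<lambda>k. Ahat c g r chi1 n Y k + ennreal chi2 * Vhat c g r n Y k)
          (\<lambda>k. k \<in> Kset c g r n) (khat Y))"

end

theory Submission
  imports Defs "HOL-Real_Asymp.Real_Asymp"
begin

text \<open>By Plancherel's theorem for the Mellin transform the loss of \<open>fhat\<close> splits into a bias carried by
  \<open>Gset\<close> and the norm of \<open>(emp_mellin - E emp_mellin) * ridge\<close>, which is a normalised sum of i.i.d.
  centered random elements of \<open>L\<^sup>2\<close>. After truncating \<open>Y powr (c - 1)\<close> at the order \<open>n powr (1/3)\<close> (the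
  fifth moment controls the remainder), a Bernstein inequality in Hilbert space replaces Talagrand's
  inequality: with \<open>q S = sqrt (L\<^sup>2 + norm S\<^sup>2)\<close> one has
  \<open>q (S + X) \<le> q S + (2 * inner S X + norm X\<^sup>2) / (2 * q S)\<close>, an increment bounded uniformly in \<open>S\<close> and
  with variance at most the weak variance \<open>v = sup {E (inner h X)\<^sup>2 | norm h \<le> 1}\<close>; so
  \<open>E exp (mu * q S)\<close> can be bounded by induction on the number of summands. Here \<open>v\<close> is of order \<open>k\<^sup>2\<close>, because
  \<open>\<bar>ridge\<bar> \<le> k\<close> and the weighted density of \<open>Y\<close> is bounded, whereas \<open>norm2 ridge\<close> is at least of order
  \<open>k powr (2 + 1/\<gamma>)\<close>; hence the deviations beyond the level of \<open>V\<close> are summable over \<open>k\<close>. The rest is the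
  Goldenshluger--Lepski argument.\<close>

text \<open>The exponent 1/3 of the truncation is a compromise. Beyond the level \<open>d\<close> a
  square is at most a fifth power divided by \<open>d ^ 3\<close>, which is of order
  \<open>n\<close>; as \<open>ridge_sq k \<le> n\<close> on \<open>Kset\<close>, the remainder costs
  O(1/n). It is monotone in \<open>k\<close>, so it is charged once and not for every
  \<open>k\<close>. Below the level a summand has norm at most \<open>n powr (1/3)\<close> times
  \<open>sqrt a\<close>, against \<open>n powr (1/2)\<close> for the whole sum; the gap
  \<open>n powr (1/6)\<close> makes the large-jump regime of the Bernstein bound
  stretched-exponentially small. The penalty contains \<open>sigma_hat\<close> in place of its mean
  \<open>s\<close>. No event has to be split off for this: \<open>s - 2 * sigma_hat\<close> is at
  most \<open>(sigma_hat - s)\<^sup>2 / s\<close>, and the variance of \<open>sigma_hat\<close> is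
  O(1/n). \<open>mellin c f\<close> need not be integrable, so \<open>f\<close> cannot be written as
  an inversion integral. The loss is instead compared by expanding squares, which takes Plancherel's
  theorem only as two inequalities, the second one for nonnegative functions. The second constant
  may depend on \<open>f\<close> only through a few numbers; hence the moment of \<open>f\<close> in
  the weak variance is rewritten as \<open>s\<close> divided by a moment of
  \<open>g\<close>.\<close>

lemma borel_measurable_cis [measurable (raw)]:
  "f \<in> borel_measurable M \<Longrightarrow> (\<lambda>x. cis (f x)) \<in> borel_measurable M"
  by (rule measurable_compose[where g = cis and N = borel])
     (auto intro!: borel_measurable_continuous_onI continuous_intros)

lemma borel_measurable_cnj [measurable (raw)]:
  "f \<in> borel_measurable M \<Longrightarrow> (\<lambda>x. cnj (f x)) \<in> borel_measurable M"
  by (rule measurable_compose[where g = cnj and N = borel])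
     (auto intro!: borel_measurable_continuous_onI continuous_intros)

section \<open>Norm bounds for integrals and Fubini with a bounded kernel\<close>

lemma ennreal_norm_integral_le:
  fixes h :: "'a \<Rightarrow> 'b::{banach, second_countable_topology}"
  shows "ennreal (norm (integral\<^sup>L M h)) \<le> (\<integral>\<^sup>+x. ennreal (norm (h x)) \<partial>M)"
  by (cases "integrable M h") (auto simp: integral_norm_bound_ennreal not_integrable_integral_eq)

lemma norm_integral_square_le:
  fixes h k :: "'a \<Rightarrow> complex"
  assumes [measurable]: "h \<in> borel_measurable M" "k \<in> borel_measurable M"
  shows "ennreal ((cmod (LINT x|M. h x * k x))\<^sup>2)
    \<le> (\<integral>\<^sup>+x. ennreal ((cmod (h x))\<^sup>2) \<partial>M) * (\<integral>\<^sup>+x. ennreal ((cmod (k x))\<^sup>2) \<partial>M)"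
proof -
  have "ennreal (cmod (LINT x|M. h x * k x)) ^ 2 \<le> (\<integral>\<^sup>+x. ennreal (cmod (h x * k x)) \<partial>M) ^ 2"
    by (intro power_mono ennreal_norm_integral_le) auto
  also have "(\<integral>\<^sup>+x. ennreal (cmod (h x * k x)) \<partial>M) = (\<integral>\<^sup>+x. ennreal (cmod (h x)) * ennreal (cmod (k x)) \<partial>M)"
    by (simp add: norm_mult ennreal_mult)
  also have "\<dots> ^ 2 \<le> (\<integral>\<^sup>+x. ennreal (cmod (h x)) ^ 2 \<partial>M) * (\<integral>\<^sup>+x. ennreal (cmod (k x)) ^ 2 \<partial>M)"
    by (intro Cauchy_Schwarz_nn_integral) auto
  finally show ?thesis by (simp add: ennreal_power)
qed

lemma integrable_mult_bounded:
  fixes h k :: "'a \<Rightarrow> complex"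
  assumes h: "integrable M h" and k [measurable]: "k \<in> borel_measurable M" and b: "\<And>x. cmod (k x) \<le> C"
  shows "integrable M (\<lambda>x. h x * k x)" "integrable M (\<lambda>x. k x * h x)"
proof -
  have [measurable]: "h \<in> borel_measurable M" using h by auto
  have C: "0 \<le> C" using b[of undefined] by (meson norm_ge_zero order_trans)
  show "integrable M (\<lambda>x. h x * k x)"
  proof (rule Bochner_Integration.integrable_bound[of _ "\<lambda>x. of_real C * h x"])
    show "AE x in M. cmod (h x * k x) \<le> cmod (of_real C * h x)"
      using mult_right_mono[OF b norm_ge_zero] C by (intro AE_I2) (simp add: norm_mult mult.commute)
  qed (use h in auto)
  thus "integrable M (\<lambda>x. k x * h x)" by (simp add: mult.commute)
qed

text \<open>The integrand is dominated by \<open>C\<close> times a product of two integrable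
  functions, hence jointly integrable. The shape fits characters \<open>cis (x * u)\<close> between
  two integrable functions, and expectations, where one of the two functions is the constant
  1.\<close>

lemma Fubini_bounded_kernel:
  fixes F :: "'a \<Rightarrow> complex" and G :: "'b \<Rightarrow> complex"
  assumes M: "sigma_finite_measure M" and N: "sigma_finite_measure N"
    and F: "integrable M F" and G: "integrable N G"
    and K: "(\<lambda>(x, u). K x u) \<in> borel_measurable (M \<Otimes>\<^sub>M N)"
    and b: "\<And>x u. cmod (K x u) \<le> C"
  shows "(LINT u|N. (LINT x|M. F x * K x u) * G u) = (LINT x|M. F x * (LINT u|N. K x u * G u))"
proof -
  interpret M: sigma_finite_measure M by fact
  interpret N: sigma_finite_measure N by fact
  interpret pair_sigma_finite M N ..
  note [measurable] = K
  have [measurable]: "F \<in> borel_measurable M" "G \<in> borel_measurable N" using F G by auto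
  have "integrable (M \<Otimes>\<^sub>M N) (case_prod (\<lambda>x u. F x * K x u * G u))"
  proof (rule integrableI_bounded)
    show "case_prod (\<lambda>x u. F x * K x u * G u) \<in> borel_measurable (M \<Otimes>\<^sub>M N)" by measurable
    have "(\<integral>\<^sup>+p. ennreal (norm (case_prod (\<lambda>x u. F x * K x u * G u) p)) \<partial>(M \<Otimes>\<^sub>M N))
       = (\<integral>\<^sup>+x. \<integral>\<^sup>+u. ennreal (norm (F x * K x u * G u)) \<partial>N \<partial>M)"
      by (subst N.nn_integral_fst[symmetric]) auto
    also have "\<dots> \<le> (\<integral>\<^sup>+x. \<integral>\<^sup>+u. ennreal (norm (F x) * C) * ennreal (norm (G u)) \<partial>N \<partial>M)"
      using b[of undefined undefined] order_trans[OF norm_ge_zero b]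
      by (intro nn_integral_mono)
         (auto simp: norm_mult ennreal_mult[symmetric] intro!: ennreal_leI mult_right_mono mult_left_mono b)
    also have "\<dots> = (\<integral>\<^sup>+x. ennreal (norm (F x)) * (ennreal C * (\<integral>\<^sup>+u. ennreal (norm (G u)) \<partial>N)) \<partial>M)"
      using order_trans[OF norm_ge_zero b]
      by (subst nn_integral_cmult) (auto simp: ennreal_mult mult.assoc)
    also have "\<dots> = (\<integral>\<^sup>+x. ennreal (norm (F x)) \<partial>M) * (ennreal C * (\<integral>\<^sup>+u. ennreal (norm (G u)) \<partial>N))"
      by (subst nn_integral_multc) auto
    also have "\<dots> < \<infinity>"
      using F G unfolding integrable_iff_bounded by (auto simp: ennreal_mult_less_top)
    finally show "(\<integral>\<^sup>+p. ennreal (norm (case_prod (\<lambda>x u. F x * K x u * G u) p)) \<partial>(M \<Otimes>\<^sub>M N)) < \<infinity>" .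
  qed
  from Fubini_integral[OF this]
  have "(LINT u|N. LINT x|M. F x * K x u * G u) = (LINT x|M. LINT u|N. F x * K x u * G u)" .
  moreover have "(LINT x|M. F x * K x u * G u) = (LINT x|M. F x * K x u) * G u" for u
    by simp
  moreover have "(LINT u|N. F x * K x u * G u) = F x * (LINT u|N. K x u * G u)" for x
    by (simp add: mult.assoc)
  ultimately show ?thesis by simp
qed

section \<open>Plancherel's theorem for the Fourier transform\<close>

text \<open>The sign is positive and there is no normalising factor, so that the Mellin transform
  becomes \<open>fourier\<close> after the substitution \<open>x = exp u\<close>; the Plancherel
  constant is then \<open>2 * pi\<close>.\<close>

definition fourier :: "(real \<Rightarrow> complex) \<Rightarrow> real \<Rightarrow> complex" where
  "fourier H u = (LINT t|lborel. H t * cis (t * u))"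

lemma borel_measurable_fourier [measurable]:
  assumes [measurable]: "H \<in> borel_measurable borel"
  shows "fourier H \<in> borel_measurable borel"
  unfolding fourier_def by measurable

lemma norm_fourier_le: "cmod (fourier H u) \<le> (LINT t|lborel. cmod (H t))"
  unfolding fourier_def by (rule integral_norm_bound[THEN order_trans]) (simp add: norm_mult)

section \<open>Gaussian regularisation and the upper Plancherel inequality\<close>

text \<open>Substituting \<open>u = x / e\<close> turns the left side into a multiple of the
  characteristic function of the standard normal law at \<open>z / e\<close>.\<close>

lemma fourier_gauss:
  assumes e: "0 < e"
  shows "(LINT u|lborel. cis (z * u) * of_real (exp (- (e * u)\<^sup>2 / 2))) = of_real (2 * pi * normal_density 0 e z)"
proof -
  have "(LINT u|lborel. cis (z * u) * of_real (exp (- (e * u)\<^sup>2 / 2)))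
      = \<bar>1 / e\<bar> *\<^sub>R (LINT x|lborel. cis (z * (0 + 1 / e * x)) * of_real (exp (- (e * (0 + 1 / e * x))\<^sup>2 / 2)))"
    using e by (intro lborel_integral_real_affine) auto
  also have "(LINT x|lborel. cis (z * (0 + 1 / e * x)) * of_real (exp (- (e * (0 + 1 / e * x))\<^sup>2 / 2)))
      = (LINT x|lborel. of_real (sqrt (2 * pi)) * (std_normal_density x *\<^sub>R iexp ((z / e) * x)))"
    using e by (intro Bochner_Integration.integral_cong)
      (auto simp: std_normal_density_def cis_conv_exp scaleR_conv_of_real mult_ac)
  also have "\<dots> = of_real (sqrt (2 * pi)) * char std_normal_distribution (z / e)"
    unfolding char_def
    by (subst integral_density) (simp_all add: mult_scaleR_right[symmetric] del: mult_scaleR_right)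
  also have "\<bar>1 / e\<bar> *\<^sub>R \<dots> = of_real (2 * pi * normal_density 0 e z)"
  proof -
    have "sqrt (2 * pi) = 2 * pi / sqrt (2 * pi)"
      by (simp add: real_div_sqrt)
    hence "1 / e * (sqrt (2 * pi) * exp (- (z / e)\<^sup>2 / 2)) = 2 * pi * normal_density 0 e z"
      using e by (simp add: normal_density_def real_sqrt_mult power_divide mult.commute) (simp add: field_simps)
    from arg_cong[OF this, of complex_of_real] show ?thesis using e
      by (simp add: char_std_normal_distribution scaleR_conv_of_real)
  qed
  finally show ?thesis .
qed

lemma integrable_gauss: "0 < e \<Longrightarrow> integrable lborel (\<lambda>u::real. exp (- (e * u)\<^sup>2 / 2))"
proof -
  assume e: "0 < e"
  have "integrable lborel (\<lambda>u. sqrt (2 * pi * (1 / e)\<^sup>2) * normal_density 0 (1 / e) u)"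
    using e by (intro integrable_mult_right integrable_normal_density) simp
  also have "(\<lambda>u. sqrt (2 * pi * (1 / e)\<^sup>2) * normal_density 0 (1 / e) u) = (\<lambda>u. exp (- (e * u)\<^sup>2 / 2))"
    using e by (auto simp: normal_density_def fun_eq_iff field_simps)
  finally show ?thesis .
qed

text \<open>The Gaussian weight makes all integrals absolutely convergent, so Fubini can be applied
  twice: once to unfold \<open>fourier phi\<close>, once to unfold \<open>fourier H\<close>. The
  remaining integral over \<open>u\<close> is Gaussian and produces a mollifier of width
  \<open>e\<close> acting on \<open>H\<close>.\<close>

lemma fourier_gauss_parseval:
  assumes phi: "integrable lborel phi" and H: "integrable lborel H" and e: "0 < e"
  shows "(LINT u|lborel. fourier phi u * (cnj (fourier H u) * of_real (exp (- (e * u)\<^sup>2 / 2))))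
    = of_real (2 * pi) * (LINT x|lborel. phi x * (LINT s|lborel. cnj (H s) * of_real (normal_density 0 e (x - s))))"
proof -
  define w where "w = (\<lambda>u::real. complex_of_real (exp (- (e * u)\<^sup>2 / 2)))"
  have w: "integrable lborel w" unfolding w_def using integrable_gauss[OF e] by simp
  have [measurable]: "phi \<in> borel_measurable borel" "H \<in> borel_measurable borel" using phi H by auto
  have "integrable lborel (\<lambda>u. cnj (fourier H u) * w u)"
    by (rule integrable_mult_bounded(2)[OF w, of _ "LINT t|lborel. cmod (H t)"])
       (auto intro: norm_fourier_le)
  from Fubini_bounded_kernel[OF lborel.sigma_finite_measure_axioms lborel.sigma_finite_measure_axioms phi this,
      of "\<lambda>x u. cis (x * u)" 1]
  have "(LINT u|lborel. fourier phi u * (cnj (fourier H u) * w u))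
      = (LINT x|lborel. phi x * (LINT u|lborel. cis (x * u) * (cnj (fourier H u) * w u)))"
    unfolding fourier_def by auto
  moreover have "(LINT u|lborel. cis (x * u) * (cnj (fourier H u) * w u))
      = (LINT s|lborel. cnj (H s) * of_real (2 * pi * normal_density 0 e (x - s)))" for x
  proof -
    have "cnj (fourier H u) = (LINT s|lborel. cnj (H s) * cis (- (s * u)))" for u
      unfolding fourier_def Bochner_Integration.integral_cnj[symmetric] by (simp add: cis_cnj)
    hence "(LINT u|lborel. cis (x * u) * (cnj (fourier H u) * w u))
       = (LINT u|lborel. (LINT s|lborel. cnj (H s) * cis (- (s * u))) * (cis (x * u) * w u))"
      by (simp add: mult_ac)
    also have "\<dots> = (LINT s|lborel. cnj (H s) * (LINT u|lborel. cis (- (s * u)) * (cis (x * u) * w u)))"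
      using H by (intro Fubini_bounded_kernel[where C = 1] integrable_mult_bounded(2)[OF w, of _ 1]
          lborel.sigma_finite_measure_axioms) auto
    moreover have "(LINT u|lborel. cis (- (s * u)) * (cis (x * u) * w u)) = of_real (2 * pi * normal_density 0 e (x - s))" for s
    proof -
      have "(LINT u|lborel. cis (- (s * u)) * (cis (x * u) * w u)) = (LINT u|lborel. cis ((x - s) * u) * w u)"
        by (intro Bochner_Integration.integral_cong refl, simp only: mult.assoc[symmetric] cis_mult)
          (simp add: algebra_simps)
      thus ?thesis unfolding w_def using fourier_gauss[OF e] by simp
    qed
    ultimately show ?thesis by (simp only:)
  qed
  moreover have "(LINT x|lborel. phi x * (LINT s|lborel. cnj (H s) * of_real (2 * pi * normal_density 0 e (x - s))))
     = of_real (2 * pi) * (LINT x|lborel. phi x * (LINT s|lborel. cnj (H s) * of_real (normal_density 0 e (x - s))))"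
  proof -
    have "(LINT s|lborel. cnj (H s) * of_real (2 * pi * normal_density 0 e (x - s)))
       = of_real (2 * pi) * (LINT s|lborel. cnj (H s) * of_real (normal_density 0 e (x - s)))" for x
      by (subst integral_mult_right_zero[symmetric]) (simp add: mult_ac)
    thus ?thesis by (subst integral_mult_right_zero[symmetric]) (simp add: mult_ac)
  qed
  ultimately show ?thesis unfolding w_def by (simp only:)
qed

lemma nn_integral_normal_density: "0 < e \<Longrightarrow> (\<integral>\<^sup>+x. ennreal (normal_density m e x) \<partial>lborel) = 1"
  by (subst nn_integral_eq_integral) auto

text \<open>The product of \<open>cmod (H x)\<close> and \<open>cmod (H s)\<close> is at most half
  the sum of the squares, and the normal density integrates to 1 in either variable, so each half
  contributes \<open>norm2 H / 2\<close>. The bound is uniform in \<open>e\<close>.\<close>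

lemma normal_density_convolution_le:
  assumes [measurable]: "H \<in> borel_measurable borel" and e: "0 < e"
  shows "ennreal (cmod (LINT x|lborel. H x * (LINT s|lborel. cnj (H s) * of_real (normal_density 0 e (x - s)))))
    \<le> norm2 H"
proof -
  obtain q :: real where q: "0 \<le> q" "q + q = 1" "q = 1 / 2" by (rule that[of "1 / 2"]) auto
  let ?d = "\<lambda>x s. ennreal (normal_density 0 e (x - s))" and ?h = "\<lambda>x. ennreal ((cmod (H x))\<^sup>2)"
  have d1: "(\<integral>\<^sup>+s. ?d x s \<partial>lborel) = 1" "(\<integral>\<^sup>+s. ?d s x \<partial>lborel) = 1" for x
  proof -
    have "?d x s = ennreal (normal_density x e s)" "?d s x = ennreal (normal_density x e s)" for s
      by (simp_all add: normal_density_def power2_commute)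
    thus "(\<integral>\<^sup>+s. ?d x s \<partial>lborel) = 1" "(\<integral>\<^sup>+s. ?d s x \<partial>lborel) = 1"
      by (simp_all add: nn_integral_normal_density e)
  qed
  have "ennreal (cmod (LINT x|lborel. H x * (LINT s|lborel. cnj (H s) * of_real (normal_density 0 e (x - s)))))
     \<le> (\<integral>\<^sup>+x. ennreal (cmod (H x)) * (\<integral>\<^sup>+s. ennreal (cmod (H s)) * ?d x s \<partial>lborel) \<partial>lborel)"
  proof (rule ennreal_norm_integral_le[THEN order_trans], rule nn_integral_mono)
    fix x
    have "ennreal (cmod (LINT s|lborel. cnj (H s) * of_real (normal_density 0 e (x - s))))
        \<le> (\<integral>\<^sup>+s. ennreal (cmod (H s)) * ?d x s \<partial>lborel)"
      by (rule ennreal_norm_integral_le[THEN order_trans]) (auto simp: norm_mult ennreal_mult intro!: nn_integral_mono)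
    thus "ennreal (cmod (H x * (LINT s|lborel. cnj (H s) * of_real (normal_density 0 e (x - s)))))
        \<le> ennreal (cmod (H x)) * (\<integral>\<^sup>+s. ennreal (cmod (H s)) * ?d x s \<partial>lborel)"
      by (simp add: norm_mult ennreal_mult mult_left_mono)
  qed
  also have "\<dots> = (\<integral>\<^sup>+x. (\<integral>\<^sup>+s. ennreal (cmod (H x)) * (ennreal (cmod (H s)) * ?d x s) \<partial>lborel) \<partial>lborel)"
    by (subst nn_integral_cmult) auto
  also have "\<dots> \<le> (\<integral>\<^sup>+x. (\<integral>\<^sup>+s. ennreal q * (?h x * ?d x s) + ennreal q * (?h s * ?d x s) \<partial>lborel) \<partial>lborel)"
  proof (intro nn_integral_mono)
    fix x s
    have "2 * (cmod (H x) * cmod (H s)) \<le> (cmod (H x))\<^sup>2 + (cmod (H s))\<^sup>2"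
      using zero_le_power2[of "cmod (H x) - cmod (H s)"] by (simp add: power2_diff)
    hence "cmod (H x) * cmod (H s) * normal_density 0 e (x - s)
        \<le> (q * (cmod (H x))\<^sup>2 + q * (cmod (H s))\<^sup>2) * normal_density 0 e (x - s)"
      unfolding q(3) by (intro mult_right_mono) auto
    thus "ennreal (cmod (H x)) * (ennreal (cmod (H s)) * ?d x s)
        \<le> ennreal q * (?h x * ?d x s) + ennreal q * (?h s * ?d x s)"
      using q(1) by (simp add: ennreal_mult[symmetric] ennreal_plus[symmetric] algebra_simps del: ennreal_plus)
  qed
  also have "\<dots> = ennreal q * (\<integral>\<^sup>+x. (\<integral>\<^sup>+s. ?h x * ?d x s \<partial>lborel) \<partial>lborel)
      + ennreal q * (\<integral>\<^sup>+x. (\<integral>\<^sup>+s. ?h s * ?d x s \<partial>lborel) \<partial>lborel)"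
    by (simp add: nn_integral_add nn_integral_cmult)
  also have "(\<integral>\<^sup>+x. (\<integral>\<^sup>+s. ?h x * ?d x s \<partial>lborel) \<partial>lborel) = norm2 H"
    unfolding norm2_def by (subst nn_integral_cmult) (auto simp: d1)
  also have "(\<integral>\<^sup>+x. (\<integral>\<^sup>+s. ?h s * ?d x s \<partial>lborel) \<partial>lborel) = (\<integral>\<^sup>+s. (\<integral>\<^sup>+x. ?h s * ?d x s \<partial>lborel) \<partial>lborel)"
    by (intro lborel_pair.Fubini') simp
  also have "\<dots> = norm2 H"
    unfolding norm2_def by (subst nn_integral_cmult) (auto simp: d1)
  also have "ennreal q * norm2 H + ennreal q * norm2 H = (ennreal q + ennreal q) * norm2 H"
    by (simp add: distrib_right)
  also have "ennreal q + ennreal q = 1"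
    using q by (simp add: ennreal_plus[symmetric] del: ennreal_plus)
  finally show ?thesis by simp
qed

text \<open>Fatou's lemma along \<open>e = 1 / (n + 1)\<close>, where the damping factor tends to 1
  pointwise.\<close>

lemma nn_integral_gauss_limit_le:
  assumes [measurable]: "h \<in> borel_measurable borel"
    and le: "\<And>e. 0 < e \<Longrightarrow> (\<integral>\<^sup>+u. h u * ennreal (exp (- (e * u)\<^sup>2 / 2)) \<partial>lborel) \<le> C"
  shows "(\<integral>\<^sup>+u. h u \<partial>lborel) \<le> C"
proof -
  have "(\<lambda>n. h u * ennreal (exp (- (1 / real (Suc n) * u)\<^sup>2 / 2))) \<longlonglongrightarrow> h u * ennreal 1" for u
  proof (rule tendsto_mult_ennreal)
    have "(\<lambda>n. 1 / real (Suc n)) \<longlonglongrightarrow> 0"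
      by (rule LIMSEQ_Suc[OF lim_1_over_n])
    hence "(\<lambda>n. exp (- (1 / real (Suc n) * u)\<^sup>2 / 2)) \<longlonglongrightarrow> exp (- (0 * u)\<^sup>2 / 2)"
      by (intro tendsto_exp tendsto_divide tendsto_minus tendsto_power tendsto_mult tendsto_const) simp_all
    thus "(\<lambda>n. ennreal (exp (- (1 / real (Suc n) * u)\<^sup>2 / 2))) \<longlonglongrightarrow> ennreal 1"
      by (intro tendsto_ennrealI) simp
  qed auto
  hence "liminf (\<lambda>n. h u * ennreal (exp (- (1 / real (Suc n) * u)\<^sup>2 / 2))) = h u" for u
    by (subst lim_imp_Liminf[of _ _ "h u"]) auto
  hence "(\<integral>\<^sup>+u. h u \<partial>lborel) = (\<integral>\<^sup>+u. liminf (\<lambda>n. h u * ennreal (exp (- (1 / real (Suc n) * u)\<^sup>2 / 2))) \<partial>lborel)"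
    by (simp only:)
  also have "\<dots> \<le> liminf (\<lambda>n. \<integral>\<^sup>+u. h u * ennreal (exp (- (1 / real (Suc n) * u)\<^sup>2 / 2)) \<partial>lborel)"
    by (intro nn_integral_liminf) auto
  also have "\<dots> \<le> C"
    by (intro Liminf_le always_eventually allI le) simp_all
  finally show ?thesis .
qed

text \<open>Parseval with damping for the pair \<open>H\<close>, \<open>H\<close>: the mollified
  inner product is at most \<open>norm2 H\<close> for every width, and Fatou's lemma removes the
  damping. \<open>norm2 H\<close> may be infinite.\<close>

lemma norm2_fourier_le:
  assumes H: "integrable lborel H"
  shows "norm2 (fourier H) \<le> ennreal (2 * pi) * norm2 H"
  unfolding norm2_def[of "fourier H"]
proof (rule nn_integral_gauss_limit_le)
  have [measurable]: "H \<in> borel_measurable borel" using H by auto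
  show "(\<lambda>x. ennreal ((cmod (fourier H x))\<^sup>2)) \<in> borel_measurable borel" by measurable
  fix e :: real assume e: "0 < e"
  let ?w = "\<lambda>u. exp (- (e * u)\<^sup>2 / 2)"
  have int: "integrable lborel (\<lambda>u. (cmod (fourier H u))\<^sup>2 * ?w u)"
  proof (rule Bochner_Integration.integrable_bound[of _ "\<lambda>u. (LINT t|lborel. cmod (H t))\<^sup>2 * ?w u"])
    show "AE u in lborel. norm ((cmod (fourier H u))\<^sup>2 * ?w u) \<le> norm ((LINT t|lborel. cmod (H t))\<^sup>2 * ?w u)"
      by (auto intro!: AE_I2 mult_right_mono power_mono norm_fourier_le simp: abs_mult)
    show "integrable lborel (\<lambda>u. (LINT t|lborel. cmod (H t))\<^sup>2 * ?w u)"
      using integrable_gauss[OF e] by (intro integrable_mult_right)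
  qed (use H in measurable)
  have "(\<integral>\<^sup>+u. ennreal ((cmod (fourier H u))\<^sup>2) * ennreal (?w u) \<partial>lborel) = ennreal (LINT u|lborel. (cmod (fourier H u))\<^sup>2 * ?w u)"
    by (subst nn_integral_eq_integral[symmetric, OF int]) (auto simp: ennreal_mult)
  moreover have "(LINT u|lborel. (cmod (fourier H u))\<^sup>2 * ?w u)
      = cmod (LINT u|lborel. fourier H u * (cnj (fourier H u) * of_real (?w u)))"
  proof -
    have "(LINT u|lborel. fourier H u * (cnj (fourier H u) * of_real (?w u)))
        = (LINT u|lborel. complex_of_real ((cmod (fourier H u))\<^sup>2 * ?w u))"
      by (intro Bochner_Integration.integral_cong) (auto simp only: of_real_mult complex_norm_square mult.assoc)
    thus ?thesis
      by (subst (asm) integral_complex_of_real) (simp add: Bochner_Integration.integral_nonneg)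
  qed
  moreover have "ennreal (cmod (LINT u|lborel. fourier H u * (cnj (fourier H u) * of_real (?w u))))
      \<le> ennreal (2 * pi) * norm2 H"
    unfolding fourier_gauss_parseval[OF H H e]
    using normal_density_convolution_le[OF _ e, of H]
    by (simp add: norm_mult ennreal_mult mult_left_mono)
  ultimately show "(\<integral>\<^sup>+u. ennreal ((cmod (fourier H u))\<^sup>2) * ennreal (?w u) \<partial>lborel) \<le> ennreal (2 * pi) * norm2 H"
    by simp
qed

section \<open>The reverse Plancherel inequality, by duality\<close>

lemma gauss_mollifier_eq:
  fixes g :: "real \<Rightarrow> real"
  assumes [measurable]: "g \<in> borel_measurable borel" and e: "0 < e"
  shows "(LINT s|lborel. g s * normal_density 0 e (x - s)) = (LINT z|lborel. g (x - e * z) * std_normal_density z)"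
proof -
  have "e * normal_density 0 e (e * z) = std_normal_density z" for z
    using e by (simp add: normal_density_def real_sqrt_mult power_mult_distrib)
  hence *: "\<bar>- e\<bar> * (g (x + - e * z) * normal_density 0 e (x - (x + - e * z))) = g (x - e * z) * std_normal_density z" for z
    using e by (simp add: mult.left_commute)
  have "(LINT s|lborel. g s * normal_density 0 e (x - s))
      = \<bar>- e\<bar> *\<^sub>R (LINT z|lborel. g (x + - e * z) * normal_density 0 e (x - (x + - e * z)))"
    using e by (intro lborel_integral_real_affine) auto
  also have "\<dots> = (LINT z|lborel. \<bar>- e\<bar> * (g (x + - e * z) * normal_density 0 e (x - (x + - e * z))))"
    by (simp only: real_scaleR_def Bochner_Integration.integral_mult_right_zero)
  finally show ?thesis by (simp only: *)
qed

text \<open>In the form of \<open>gauss_mollifier_eq\<close> the density no longer depends on the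
  width, so dominated convergence applies twice: inside with majorant
  \<open>C * std_normal_density\<close>, outside with \<open>C * \<bar>phi x\<bar>\<close>.\<close>

lemma gauss_mollifier_tendsto:
  fixes g phi :: "real \<Rightarrow> real"
  assumes phi: "integrable lborel phi" and g: "continuous_on UNIV g" and C: "\<And>x. \<bar>g x\<bar> \<le> C"
  shows "(\<lambda>n. LINT x|lborel. phi x * (LINT s|lborel. g s * normal_density 0 (1 / real (Suc n)) (x - s)))
    \<longlonglongrightarrow> (LINT x|lborel. phi x * g x)"
proof -
  have [measurable]: "phi \<in> borel_measurable borel" using phi by auto
  have [measurable]: "g \<in> borel_measurable borel" using g by (rule borel_measurable_continuous_onI)
  have C0: "0 \<le> C" using C[of 0] by simp
  let ?G = "\<lambda>n x. LINT z|lborel. g (x - 1 / real (Suc n) * z) * std_normal_density z"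
  have lim: "(\<lambda>n. ?G n x) \<longlonglongrightarrow> g x" for x
  proof -
    have "(\<lambda>n. ?G n x) \<longlonglongrightarrow> (LINT z|lborel. g x * std_normal_density z)"
    proof (rule integral_dominated_convergence[where w = "\<lambda>z. C * std_normal_density z"])
      show "AE z in lborel. (\<lambda>n. g (x - 1 / real (Suc n) * z) * std_normal_density z) \<longlonglongrightarrow> g x * std_normal_density z"
      proof (intro AE_I2 tendsto_mult tendsto_const)
        fix z
        have "(\<lambda>n. x - 1 / real (Suc n) * z) \<longlonglongrightarrow> x - 0 * z"
          by (intro tendsto_diff tendsto_mult tendsto_const LIMSEQ_Suc[OF lim_1_over_n])
        moreover have "isCont g x" using g by (simp add: continuous_on_eq_continuous_at)
        ultimately show "(\<lambda>n. g (x - 1 / real (Suc n) * z)) \<longlonglongrightarrow> g x"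
          using isCont_tendsto_compose[of x g] by simp
      qed
      show "AE z in lborel. norm (g (x - 1 / real (Suc n) * z) * std_normal_density z) \<le> C * std_normal_density z" for n
        using C by (intro AE_I2) (simp add: abs_mult mult_right_mono)
    qed auto
    thus ?thesis by simp
  qed
  have bnd: "\<bar>?G n x\<bar> \<le> C" for n x
  proof -
    have int: "integrable lborel (\<lambda>z. g (x - 1 / real (Suc n) * z) * std_normal_density z)"
      by (rule Bochner_Integration.integrable_bound[of _ "\<lambda>z. C * std_normal_density z"])
         (use C C0 in \<open>auto simp: abs_mult intro!: mult_right_mono\<close>)
    have "\<bar>?G n x\<bar> \<le> (LINT z|lborel. \<bar>g (x - 1 / real (Suc n) * z) * std_normal_density z\<bar>)"
      by (rule integral_abs_bound)
    also have "\<dots> \<le> (LINT z|lborel. C * std_normal_density z)"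
      by (rule integral_mono) (use integrable_abs[OF int] C in \<open>auto simp: abs_mult intro!: mult_right_mono\<close>)
    finally have "\<bar>?G n x\<bar> \<le> (LINT z|lborel. C * std_normal_density z)" .
    thus ?thesis by simp
  qed
  have "(\<lambda>n. LINT x|lborel. phi x * ?G n x) \<longlonglongrightarrow> (LINT x|lborel. phi x * g x)"
  proof (rule integral_dominated_convergence[where w = "\<lambda>x. C * \<bar>phi x\<bar>"])
    show "AE x in lborel. (\<lambda>n. phi x * ?G n x) \<longlonglongrightarrow> phi x * g x"
      by (intro AE_I2 tendsto_mult tendsto_const lim)
    show "AE x in lborel. norm (phi x * ?G n x) \<le> C * \<bar>phi x\<bar>" for n
      using mult_right_mono[OF bnd abs_ge_zero] by (intro AE_I2) (simp add: abs_mult mult.commute)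
  qed (use phi in auto)
  thus ?thesis by (subst gauss_mollifier_eq) auto
qed

text \<open>The inner product of \<open>phi\<close> with a test function \<open>g\<close> is the
  limit of mollified ones. Each of these is computed on the Fourier side, where Cauchy-Schwarz
  separates the two transforms, and the transform of \<open>g\<close> is bounded by
  \<open>norm2_fourier_le\<close>. Only the norm of \<open>fourier phi\<close> is left, which is
  what duality needs.\<close>

lemma integral_square_le_fourier:
  fixes g phi :: "real \<Rightarrow> real"
  assumes phi: "integrable lborel phi" and g: "continuous_on UNIV g" and C: "\<And>x. \<bar>g x\<bar> \<le> C"
    and int: "integrable lborel g" and fin: "norm2 (fourier (\<lambda>x. of_real (phi x))) < \<infinity>"
  shows "ennreal (2 * pi * (LINT x|lborel. phi x * g x)\<^sup>2)
    \<le> norm2 (fourier (\<lambda>x. of_real (phi x))) * (\<integral>\<^sup>+x. ennreal ((g x)\<^sup>2) \<partial>lborel)"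
    (is "_ \<le> ?F * ?G")
proof -
  have [measurable]: "phi \<in> borel_measurable borel" using phi by auto
  have [measurable]: "g \<in> borel_measurable borel" using g by (rule borel_measurable_continuous_onI)
  let ?I = "\<lambda>e. LINT x|lborel. phi x * (LINT s|lborel. g s * normal_density 0 e (x - s))"
  let ?w = "\<lambda>e u. exp (- (e * u)\<^sup>2 / 2) :: real"
  have le: "ennreal ((2 * pi * ?I e)\<^sup>2) \<le> ?F * (ennreal (2 * pi) * ?G)" if e: "0 < e" for e
  proof -
    have "(LINT u|lborel. fourier (\<lambda>x. of_real (phi x)) u * (cnj (fourier (\<lambda>x. of_real (g x)) u) * of_real (?w e u)))
      = of_real (2 * pi) * (LINT x|lborel. of_real (phi x) * (LINT s|lborel. cnj (of_real (g s)) * of_real (normal_density 0 e (x - s))))"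
      using phi int e by (intro fourier_gauss_parseval) auto
    also have "\<dots> = of_real (2 * pi * ?I e)"
      by (simp flip: of_real_mult)
    finally have eq: "(LINT u|lborel. fourier (\<lambda>x. of_real (phi x)) u * (cnj (fourier (\<lambda>x. of_real (g x)) u) * of_real (?w e u)))
      = of_real (2 * pi * ?I e)" .
    have "ennreal ((cmod (LINT u|lborel. fourier (\<lambda>x. of_real (phi x)) u * (cnj (fourier (\<lambda>x. of_real (g x)) u) * of_real (?w e u))))\<^sup>2)
        \<le> (\<integral>\<^sup>+x. ennreal ((cmod (fourier (\<lambda>x. of_real (phi x)) x))\<^sup>2) \<partial>lborel)
          * (\<integral>\<^sup>+x. ennreal ((cmod (cnj (fourier (\<lambda>x. of_real (g x)) x) * of_real (?w e x)))\<^sup>2) \<partial>lborel)"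
      by (rule norm_integral_square_le) measurable
    hence "ennreal ((2 * pi * ?I e)\<^sup>2)
        \<le> ?F * (\<integral>\<^sup>+x. ennreal ((cmod (cnj (fourier (\<lambda>x. of_real (g x)) x) * of_real (?w e x)))\<^sup>2) \<partial>lborel)"
      unfolding eq norm2_def norm_of_real power2_abs .
    also have "\<dots> \<le> ?F * norm2 (fourier (\<lambda>x. of_real (g x)))"
      unfolding norm2_def
      by (intro mult_left_mono nn_integral_mono ennreal_leI power_mono) (simp_all add: norm_mult mult_left_le)
    also have "\<dots> \<le> ?F * (ennreal (2 * pi) * norm2 (\<lambda>x. of_real (g x)))"
      using int by (intro mult_left_mono norm2_fourier_le) auto
    finally show ?thesis by (simp add: norm2_def)
  qed
  have "(\<lambda>n. ?I (1 / real (Suc n))) \<longlonglongrightarrow> (LINT x|lborel. phi x * g x)"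
    by (rule gauss_mollifier_tendsto[OF phi g C])
  hence "(\<lambda>n. ennreal ((2 * pi * ?I (1 / real (Suc n)))\<^sup>2)) \<longlonglongrightarrow> ennreal ((2 * pi * (LINT x|lborel. phi x * g x))\<^sup>2)"
    by (intro tendsto_ennrealI tendsto_power tendsto_mult tendsto_const)
  hence "ennreal ((2 * pi * (LINT x|lborel. phi x * g x))\<^sup>2) \<le> ?F * (ennreal (2 * pi) * ?G)"
    by (rule LIMSEQ_le_const2) (intro exI[of _ 0] allI impI le, simp)
  \<comment> \<open>Parseval contributes the square of \<open>2 * pi\<close>, the upper inequality
    for \<open>g\<close> one such factor; one factor therefore remains after cancellation.\<close>
  also have "ennreal ((2 * pi * (LINT x|lborel. phi x * g x))\<^sup>2)
      = ennreal (2 * pi) * ennreal (2 * pi * (LINT x|lborel. phi x * g x)\<^sup>2)"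
    by (simp add: ennreal_mult[symmetric] power_mult_distrib power2_eq_square mult_ac)
  also have "?F * (ennreal (2 * pi) * ?G) = ennreal (2 * pi) * (?F * ?G)"
    by (simp add: mult_ac)
  finally show ?thesis by (subst (asm) ennreal_mult_le_mult_iff) (auto simp: ennreal_zero_less_mult_iff)
qed

text \<open>The ideal test function in \<open>integral_square_le_fourier\<close> is
  \<open>phi\<close> itself, but it need be neither continuous nor bounded. It is approximated
  almost everywhere by continuous functions, which are then truncated in height and support. Because
  \<open>phi\<close> is nonnegative, its truncation stays below it, so the inner product of the two
  dominates the square norm of the truncation.\<close>

lemma norm2_le_fourier:
  fixes phi :: "real \<Rightarrow> real"
  assumes phi: "integrable lborel phi" and nn: "\<And>x. 0 \<le> phi x"
  shows "ennreal (2 * pi) * norm2 (\<lambda>x. of_real (phi x)) \<le> norm2 (fourier (\<lambda>x. of_real (phi x)))" (is "_ \<le> ?F")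
proof (cases "?F < \<infinity>")
  case fin: True
  have [measurable]: "phi \<in> borel_measurable borel" using phi by auto
  define F where "F = enn2real ?F"
  have F: "?F = ennreal F" "0 \<le> F" using fin by (auto simp: F_def)
  \<comment> \<open>A continuous plateau: 1 on \<open>[-m, m]\<close>, 0 outside
    \<open>[-(m + 1), m + 1]\<close>. Continuity is kept because the truncated approximants must be
    admissible test functions.\<close>
  define cut where "cut = (\<lambda>(m::nat) x::real. max 0 (min 1 (real m + 1 - \<bar>x\<bar>)))"
  have cut: "0 \<le> cut m x" "cut m x \<le> 1" "cut m x \<noteq> 0 \<Longrightarrow> x \<in> {- (real m + 1)..real m + 1}" for m x
    by (auto simp: cut_def split: if_splits)
  have cont: "continuous_on UNIV (cut m)" for m
    unfolding cut_def by (intro continuous_intros)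
  have [measurable]: "cut m \<in> borel_measurable borel" for m
    by (rule borel_measurable_continuous_onI[OF cont])
  define trunc where "trunc = (\<lambda>m (y::real) x. max 0 (min (real m) y) * cut m x)"
  have tr: "0 \<le> trunc m y x" "trunc m y x \<le> real m" for m y x
    using cut[of m x] by (auto simp: trunc_def intro: order_trans[OF mult_left_le])
  have tr2: "\<bar>trunc m y x\<bar> \<le> real m * indicator {- (real m + 1)..real m + 1} x" for m y x
  proof (cases "cut m x = 0")
    case False
    thus ?thesis using tr[of m y x] cut(3)[of m x] by (simp add: indicator_def)
  qed (simp add: trunc_def)
  have bint: "integrable lborel (\<lambda>x. real m * indicator {- (real m + 1)..real m + 1} x)" for m
    by (intro integrable_mult_right) (auto simp: integrable_indicator_iff emeasure_lborel_Icc_eq)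
  have [measurable]: "(\<lambda>x. trunc m (h x) x) \<in> borel_measurable borel" if [measurable]: "h \<in> borel_measurable borel" for m h
    unfolding trunc_def by measurable
  have tint: "integrable lborel (\<lambda>x. trunc m (h x) x)" if [measurable]: "h \<in> borel_measurable borel" for m h
    by (rule Bochner_Integration.integrable_bound[OF bint[of m]]) (use tr2 in \<open>auto simp: intro!: AE_I2 order_trans[OF tr2]\<close>)
  have tint2: "integrable lborel (\<lambda>x. (trunc m (h x) x)\<^sup>2)" if [measurable]: "h \<in> borel_measurable borel" for m h
  proof (rule Bochner_Integration.integrable_bound[OF integrable_mult_right[OF bint[of m], of "real m"]])
    show "AE x in lborel. norm ((trunc m (h x) x)\<^sup>2) \<le> norm (real m * (real m * indicator {- (real m + 1)..real m + 1} x))"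
      using mult_mono[OF tr(2) tr2] tr by (intro AE_I2) (auto simp: power2_eq_square abs_mult)
  qed auto
  \<comment> \<open>A Lebesgue measurable function is the limit of continuous functions off a
    negligible set; the null set is carried back from the completion to
    \<open>lborel\<close>.\<close>
  have "phi \<in> borel_measurable lebesgue" by (rule measurable_completion) simp
  hence "phi measurable_on UNIV" by (rule lebesgue_measurable_imp_measurable_on) auto
  then obtain N g where N: "negligible N" and g: "\<And>n. continuous_on UNIV (g n)"
    and lim: "\<And>x. x \<notin> N \<Longrightarrow> (\<lambda>n. g n x) \<longlonglongrightarrow> phi x"
    unfolding measurable_on_def by auto
  have AE: "AE x in lborel. (\<lambda>n. g n x) \<longlonglongrightarrow> phi x"
  proof -
    have "AE x in lebesgue. x \<notin> N" using N by (simp add: negligible_iff_null_sets AE_not_in)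
    hence "AE x in lebesgue. (\<lambda>n. g n x) \<longlonglongrightarrow> phi x" by eventually_elim (rule lim)
    thus ?thesis by (simp add: AE_completion_iff)
  qed
  have [measurable]: "g n \<in> borel_measurable borel" for n
    by (rule borel_measurable_continuous_onI[OF g])
  have ttend: "(\<lambda>n. trunc m (g n x) x) \<longlonglongrightarrow> trunc m (phi x) x" if "(\<lambda>n. g n x) \<longlonglongrightarrow> phi x" for m x
    unfolding trunc_def by (intro tendsto_intros that)
  \<comment> \<open>With \<open>S\<close> the square integral of the truncation, duality gives
    \<open>2 * pi * (integral of phi * truncation)\<^sup>2 \<le> F * S\<close>. Since
    \<open>S\<close> is at most that integral, \<open>2 * pi * S\<^sup>2 \<le> F * S\<close>, and
    \<open>S\<close> is finite, so one factor cancels.\<close>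
  have bound: "2 * pi * (LINT x|lborel. (trunc m (phi x) x)\<^sup>2) \<le> F" for m
  proof -
    let ?S = "LINT x|lborel. (trunc m (phi x) x)\<^sup>2"
    have "2 * pi * (LINT x|lborel. phi x * trunc m (g n x) x)\<^sup>2 \<le> F * (LINT x|lborel. (trunc m (g n x) x)\<^sup>2)" for n
    proof -
      have "ennreal (2 * pi * (LINT x|lborel. phi x * trunc m (g n x) x)\<^sup>2)
         \<le> ?F * (\<integral>\<^sup>+x. ennreal ((trunc m (g n x) x)\<^sup>2) \<partial>lborel)"
      proof (rule integral_square_le_fourier[OF phi _ _ _ fin])
        show "continuous_on UNIV (\<lambda>x. trunc m (g n x) x)"
          unfolding trunc_def by (intro continuous_intros g cont)
        show "\<bar>trunc m (g n x) x\<bar> \<le> real m" for x using tr[where m = m] by simp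
      qed (rule tint, measurable)
      also have "\<dots> = ennreal (F * (LINT x|lborel. (trunc m (g n x) x)\<^sup>2))"
        using tint2[of "g n" m] F by (subst nn_integral_eq_integral) (auto simp: ennreal_mult)
      finally show ?thesis
        using F by (subst (asm) ennreal_le_iff) (auto intro!: mult_nonneg_nonneg Bochner_Integration.integral_nonneg)
    qed
    moreover have "(\<lambda>n. LINT x|lborel. phi x * trunc m (g n x) x) \<longlonglongrightarrow> (LINT x|lborel. phi x * trunc m (phi x) x)"
    proof (rule integral_dominated_convergence[where w = "\<lambda>x. real m * phi x"])
      show "AE x in lborel. (\<lambda>n. phi x * trunc m (g n x) x) \<longlonglongrightarrow> phi x * trunc m (phi x) x"
        using AE by eventually_elim (intro tendsto_mult tendsto_const ttend)
      show "AE x in lborel. norm (phi x * trunc m (g n x) x) \<le> real m * phi x" for n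
        using mult_left_mono[OF tr(2) nn] tr nn by (intro AE_I2) (simp add: abs_mult mult.commute)
    qed (use phi in auto)
    moreover have "(\<lambda>n. LINT x|lborel. (trunc m (g n x) x)\<^sup>2) \<longlonglongrightarrow> ?S"
    proof (rule integral_dominated_convergence[where w = "\<lambda>x. real m * (real m * indicator {- (real m + 1)..real m + 1} x)"])
      show "AE x in lborel. (\<lambda>n. (trunc m (g n x) x)\<^sup>2) \<longlonglongrightarrow> (trunc m (phi x) x)\<^sup>2"
        using AE by eventually_elim (intro tendsto_power ttend)
      show "AE x in lborel. norm ((trunc m (g n x) x)\<^sup>2) \<le> real m * (real m * indicator {- (real m + 1)..real m + 1} x)" for n
        using mult_mono[OF tr(2) tr2] tr by (intro AE_I2) (auto simp: power2_eq_square abs_mult)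
    qed (use integrable_mult_right[OF bint] in auto)
    ultimately have le: "2 * pi * (LINT x|lborel. phi x * trunc m (phi x) x)\<^sup>2 \<le> F * ?S"
      by (intro LIMSEQ_le[where X = "\<lambda>n. 2 * pi * (LINT x|lborel. phi x * trunc m (g n x) x)\<^sup>2"
            and Y = "\<lambda>n. F * (LINT x|lborel. (trunc m (g n x) x)\<^sup>2)"]
          tendsto_mult tendsto_power tendsto_const) auto
    have S0: "0 \<le> ?S" by (intro Bochner_Integration.integral_nonneg) simp
    have "?S \<le> (LINT x|lborel. phi x * trunc m (phi x) x)"
    proof (rule integral_mono)
      show "integrable lborel (\<lambda>x. phi x * trunc m (phi x) x)"
        by (rule Bochner_Integration.integrable_bound[OF integrable_mult_right[OF phi, of "real m"]])
          (use mult_left_mono[OF tr(2) nn] tr nn in \<open>auto simp: abs_mult mult.commute\<close>)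
      show "(trunc m (phi x) x)\<^sup>2 \<le> phi x * trunc m (phi x) x" for x
      proof -
        have "trunc m (phi x) x \<le> phi x"
          using cut[of m x] nn[of x] by (auto simp: trunc_def intro: order_trans[OF mult_left_le])
        thus ?thesis using tr by (simp add: power2_eq_square mult_right_mono)
      qed
    qed (use tint2 in auto)
    hence "?S\<^sup>2 \<le> (LINT x|lborel. phi x * trunc m (phi x) x)\<^sup>2"
      using S0 by (rule power_mono)
    hence "2 * pi * ?S\<^sup>2 \<le> 2 * pi * (LINT x|lborel. phi x * trunc m (phi x) x)\<^sup>2"
      by (intro mult_left_mono) auto
    hence "2 * pi * ?S\<^sup>2 \<le> F * ?S"
      using le by (rule order_trans)
    thus ?thesis
    proof (cases "?S = 0")
      case False
      hence "(2 * pi * ?S) * ?S \<le> F * ?S" using \<open>2 * pi * ?S\<^sup>2 \<le> F * ?S\<close> by (simp add: power2_eq_square)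
      thus ?thesis using False S0 by (simp only: mult_le_cancel_right split: if_splits)
    qed (use F(2) in simp)
  qed
  \<comment> \<open>At each fixed point the truncation equals \<open>phi\<close> for all large
    \<open>m\<close>; Fatou's lemma then passes \<open>bound\<close> to the limit.\<close>
  have "ennreal (2 * pi) * norm2 (\<lambda>x. of_real (phi x)) = (\<integral>\<^sup>+x. liminf (\<lambda>m. ennreal (2 * pi * (trunc m (phi x) x)\<^sup>2)) \<partial>lborel)"
  proof -
    have "liminf (\<lambda>m. ennreal (2 * pi * (trunc m (phi x) x)\<^sup>2)) = ennreal (2 * pi * (phi x)\<^sup>2)" for x
    proof -
      have "eventually (\<lambda>m. trunc m (phi x) x = phi x) sequentially"
        using eventually_ge_at_top[of "nat \<lceil>max (phi x) \<bar>x\<bar>\<rceil>"]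
      proof eventually_elim
        case (elim m)
        hence "phi x \<le> real m" "\<bar>x\<bar> \<le> real m" by linarith+
        thus ?case using nn[of x] by (simp add: trunc_def cut_def)
      qed
      hence "(\<lambda>m. ennreal (2 * pi * (trunc m (phi x) x)\<^sup>2)) \<longlonglongrightarrow> ennreal (2 * pi * (phi x)\<^sup>2)"
        by (intro tendsto_eventually) (auto elim: eventually_mono)
      thus ?thesis by (rule lim_imp_Liminf[OF sequentially_bot])
    qed
    thus ?thesis unfolding norm2_def
      by (subst nn_integral_cmult[symmetric]) (auto simp: ennreal_mult)
  qed
  also have "\<dots> \<le> liminf (\<lambda>m. \<integral>\<^sup>+x. ennreal (2 * pi * (trunc m (phi x) x)\<^sup>2) \<partial>lborel)"
    by (intro nn_integral_liminf) simp
  also have "\<dots> \<le> ennreal F"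
  proof (intro Liminf_le always_eventually allI)
    fix m show "(\<integral>\<^sup>+x. ennreal (2 * pi * (trunc m (phi x) x)\<^sup>2) \<partial>lborel) \<le> ennreal F"
      using bound[of m] tint2[of phi m] by (subst nn_integral_eq_integral) (auto intro!: ennreal_leI)
  qed simp
  finally show ?thesis using F by simp
qed (auto simp: not_less top_unique)

section \<open>The Mellin transform\<close>

lemma powr_Complex:
  assumes "0 < x"
  shows "of_real x powr Complex a b = of_real (x powr a) * cis (b * ln x)"
proof -
  have "of_real x powr Complex a b = exp (Complex (a * ln x) (b * ln x))"
  proof -
    have "Complex a b * Ln (of_real x) = Complex (a * ln x) (b * ln x)"
      using assms by (simp add: Ln_of_real complex_eq_iff)
    thus ?thesis using assms by (simp add: powr_def)
  qed
  also have "\<dots> = of_real (exp (a * ln x)) * cis (b * ln x)"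
    by (simp add: exp_eq_polar)
  finally show ?thesis using assms by (simp add: powr_def)
qed

lemma borel_measurable_imp_Rplus: "h \<in> borel_measurable borel \<Longrightarrow> h \<in> borel_measurable Rplus"
  by (simp add: Rplus_def measurable_restrict_space1)

lemma measurable_exp_Rplus [measurable]: "exp \<in> lborel \<rightarrow>\<^sub>M Rplus"
proof -
  have "(exp :: real \<Rightarrow> real) \<in> borel \<rightarrow>\<^sub>M restrict_space borel {0<..}"
    by (intro measurable_restrict_space2) auto
  thus ?thesis unfolding measurable_cong_sets[OF sets_lborel sets_Rplus] .
qed

text \<open>The substitution rule is applied on the compact intervals \<open>[-n, n]\<close>, whose
  images \<open>[exp (-n), exp n]\<close> exhaust the half-line; monotone convergence on both sides
  does the rest.\<close>

lemma nn_integral_Rplus_exp: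
  assumes h: "h \<in> borel_measurable Rplus"
  shows "(\<integral>\<^sup>+x. h x \<partial>Rplus) = (\<integral>\<^sup>+u. h (exp u) * ennreal (exp u) \<partial>lborel)"
proof -
  define h' where "h' = (\<lambda>x. h x * indicator {0<..} x)"
  have h' [measurable]: "h' \<in> borel_measurable borel"
    using h unfolding h'_def by (subst (asm) Rplus_def) (simp add: borel_measurable_restrict_space_iff_ennreal)
  have "(\<integral>\<^sup>+x. h x \<partial>Rplus) = (\<integral>\<^sup>+x. (SUP n. h' x * indicator {exp (- real n)..exp (real n)} x) \<partial>lborel)"
    unfolding nn_integral_Rplus
  proof (intro nn_integral_cong)
    fix x :: real
    show "h x * indicator {0<..} x = (SUP n. h' x * indicator {exp (- real n)..exp (real n)} x)"
    proof (cases "0 < x")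
      case True
      obtain n :: nat where n: "\<bar>ln x\<bar> \<le> real n" using real_arch_simple by blast
      hence "x \<in> {exp (- real n)..exp (real n)}"
        using True exp_le_cancel_iff[of "- real n" "ln x"] exp_le_cancel_iff[of "ln x" "real n"] by (simp add: abs_le_iff)
      hence "(SUP n. h' x * indicator {exp (- real n)..exp (real n)} x) = h' x"
        by (intro antisym SUP_least SUP_upper2[of n]) (auto simp: indicator_def)
      thus ?thesis by (simp add: h'_def)
    qed (auto simp: h'_def)
  qed
  also have "\<dots> = (SUP n. \<integral>\<^sup>+x. h' x * indicator {exp (- real n)..exp (real n)} x \<partial>lborel)"
  proof (intro nn_integral_monotone_convergence_SUP)
    show "incseq (\<lambda>n x. h' x * indicator {exp (- real n)..exp (real n)} x)"
    proof (clarsimp simp: incseq_def le_fun_def)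
      fix m n :: nat and x :: real assume "m \<le> n"
      hence "{exp (- real m)..exp (real m)} \<subseteq> {exp (- real n)..exp (real n)}" by simp
      from subsetD[OF this]
      show "h' x * indicator {exp (- real m)..exp (real m)} x \<le> h' x * indicator {exp (- real n)..exp (real n)} x"
        by (auto simp: indicator_def simp del: atLeastAtMost_iff)
    qed
  qed measurable
  also have "(\<lambda>n. \<integral>\<^sup>+x. h' x * indicator {exp (- real n)..exp (real n)} x \<partial>lborel)
      = (\<lambda>n. \<integral>\<^sup>+u. h' (exp u) * ennreal (exp u) * indicator {- real n..real n} u \<partial>lborel)"
  proof
    fix n :: nat
    show "(\<integral>\<^sup>+x. h' x * indicator {exp (- real n)..exp (real n)} x \<partial>lborel)
      = (\<integral>\<^sup>+u. h' (exp u) * ennreal (exp u) * indicator {- real n..real n} u \<partial>lborel)"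
    proof (cases "n = 0")
      case False
      thus ?thesis
        by (intro nn_integral_substitution_aux) (auto intro!: derivative_eq_intros continuous_intros)
    next
      \<comment> \<open>For \<open>n = 0\<close> both intervals degenerate to a point, outside the
        range of the substitution rule; both integrals vanish.\<close>
      case True
      have "AE x in lborel. x \<noteq> (1::real)" "AE x in lborel. x \<noteq> (0::real)"
        by (rule AE_lborel_singleton)+
      hence "(\<integral>\<^sup>+x. h' x * indicator {1::real} x \<partial>lborel) = (\<integral>\<^sup>+x. 0 \<partial>(lborel::real measure))"
         "(\<integral>\<^sup>+u. h' (exp u) * ennreal (exp u) * indicator {0::real} u \<partial>lborel) = (\<integral>\<^sup>+x. 0 \<partial>(lborel::real measure))"
        by (intro nn_integral_cong_AE; eventually_elim; simp)+
      thus ?thesis using True by simp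
    qed
  qed
  also have "(SUP n. \<integral>\<^sup>+u. h' (exp u) * ennreal (exp u) * indicator {- real n..real n} u \<partial>lborel)
      = (\<integral>\<^sup>+u. (SUP n. h' (exp u) * ennreal (exp u) * indicator {- real n..real n} u) \<partial>lborel)"
  proof (intro nn_integral_monotone_convergence_SUP[symmetric])
    show "incseq (\<lambda>n u. h' (exp u) * ennreal (exp u) * indicator {- real n..real n} u)"
      by (auto simp: incseq_def le_fun_def indicator_def)
  qed measurable
  also have "\<dots> = (\<integral>\<^sup>+u. h (exp u) * ennreal (exp u) \<partial>lborel)"
  proof (intro nn_integral_cong)
    fix u :: real
    obtain n :: nat where n: "\<bar>u\<bar> \<le> real n" using real_arch_simple by blast
    hence "(SUP n. h' (exp u) * ennreal (exp u) * indicator {- real n..real n} u) = h' (exp u) * ennreal (exp u)"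
      by (intro antisym SUP_least SUP_upper2[of n]) (auto simp: indicator_def)
    thus "(SUP n. h' (exp u) * ennreal (exp u) * indicator {- real n..real n} u) = h (exp u) * ennreal (exp u)"
      by (simp add: h'_def)
  qed
  finally show ?thesis .
qed

text \<open>Stating the substitution as an image measure makes it available for Bochner integrals as
  well.\<close>

lemma Rplus_eq_distr: "Rplus = distr (density lborel (\<lambda>u. ennreal (exp u))) Rplus exp"
proof (rule measure_eqI)
  fix A assume A: "A \<in> sets Rplus"
  hence [measurable]: "indicator A \<in> borel_measurable Rplus" by simp
  have m: "exp \<in> density lborel (\<lambda>u. ennreal (exp u)) \<rightarrow>\<^sub>M Rplus" by simp
  have "emeasure Rplus A = (\<integral>\<^sup>+x. indicator A x \<partial>Rplus)" using A by simp
  also have "\<dots> = (\<integral>\<^sup>+u. indicator A (exp u) * ennreal (exp u) \<partial>lborel)"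
    by (rule nn_integral_Rplus_exp) measurable
  also have "\<dots> = (\<integral>\<^sup>+u. indicator A (exp u) \<partial>density lborel (\<lambda>u. ennreal (exp u)))"
    by (subst nn_integral_density) (auto simp: mult.commute)
  also have "\<dots> = (\<integral>\<^sup>+x. indicator A x \<partial>distr (density lborel (\<lambda>u. ennreal (exp u))) Rplus exp)"
    by (rule nn_integral_distr[OF m, symmetric]) simp
  finally show "emeasure Rplus A = emeasure (distr (density lborel (\<lambda>u. ennreal (exp u))) Rplus exp) A"
    using A by simp
qed simp

lemma integral_Rplus_exp:
  fixes h :: "real \<Rightarrow> complex"
  assumes [measurable]: "h \<in> borel_measurable Rplus"
  shows "(LINT x|Rplus. h x) = (LINT u|lborel. of_real (exp u) * h (exp u))"
proof -
  have m: "exp \<in> density lborel (\<lambda>u. ennreal (exp u)) \<rightarrow>\<^sub>M Rplus" by simp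
  have "(LINT x|Rplus. h x) = (LINT u|density lborel (\<lambda>u. ennreal (exp u)). h (exp u))"
    by (subst Rplus_eq_distr, rule integral_distr[OF m]) simp
  also have "\<dots> = (LINT u|lborel. exp u *\<^sub>R h (exp u))"
    by (rule integral_density) auto
  finally show ?thesis by (simp add: scaleR_conv_of_real)
qed

lemma exp_mult_powr: "exp (u::real) powr a = exp (a * u)"
  by (simp add: powr_def)

lemma borel_measurable_mellin_kernel [measurable]:
  "(\<lambda>x. of_real x powr Complex a t) \<in> borel_measurable Rplus"
proof -
  have "(\<lambda>x. of_real (x powr a) * cis (t * ln x)) \<in> borel_measurable Rplus"
    by (rule borel_measurable_imp_Rplus) measurable
  also have "?this \<longleftrightarrow> ?thesis" by (intro measurable_cong) (simp add: powr_Complex)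
  finally show ?thesis .
qed

lemma mellin_eq_fourier:
  assumes [measurable]: "h \<in> borel_measurable Rplus"
  shows "mellin c h t = fourier (\<lambda>u. of_real (exp (c * u) * h (exp u))) t"
  unfolding mellin_def fourier_def
proof (subst integral_Rplus_exp)
  show "(LINT u|lborel. of_real (exp u) * (of_real (exp u) powr Complex (c - 1) t * of_real (h (exp u))))
      = (LINT u|lborel. of_real (exp (c * u) * h (exp u)) * cis (u * t))"
  proof (intro Bochner_Integration.integral_cong refl)
    fix u
    have "exp u * exp ((c - 1) * u) = exp (c * u)" by (simp flip: exp_add) (simp add: algebra_simps)
    hence "of_real (exp u) * complex_of_real (exp ((c - 1) * u)) = of_real (exp (c * u))"
      by (simp flip: of_real_mult)
    thus "of_real (exp u) * (of_real (exp u) powr Complex (c - 1) t * of_real (h (exp u)))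
        = of_real (exp (c * u) * h (exp u)) * cis (u * t)"
      by (simp add: powr_Complex exp_mult_powr mult_ac)
  qed
qed measurable

text \<open>The Jacobian \<open>exp u\<close> raises the weight exponent from
  \<open>2 * c - 1\<close> to \<open>2 * c\<close>. The same map, from \<open>h\<close> to
  \<open>exp (c * u) * h (exp u)\<close>, turns \<open>mellin\<close> into \<open>fourier\<close>,
  so the Mellin-Plancherel bounds are the Fourier ones in logarithmic coordinates.\<close>

lemma wnorm2_eq_norm2:
  assumes [measurable]: "h \<in> borel_measurable Rplus"
  shows "wnorm2 c h = norm2 (\<lambda>u. of_real (exp (c * u)) * h (exp u))"
  unfolding wnorm2_def norm2_def
proof (subst nn_integral_Rplus_exp)
  have [measurable]: "(\<lambda>x. x powr (2 * c - 1)) \<in> borel_measurable Rplus"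
    by (rule borel_measurable_imp_Rplus) measurable
  show "(\<lambda>x. ennreal ((cmod (h x))\<^sup>2 * x powr (2 * c - 1))) \<in> borel_measurable Rplus" by measurable
  have "(cmod (h (exp u)))\<^sup>2 * exp u powr (2 * c - 1) * exp u = (cmod (of_real (exp (c * u)) * h (exp u)))\<^sup>2" for u
  proof -
    have "exp ((2 * c - 1) * u) * exp u = exp (c * u) ^ 2"
      by (simp add: power2_eq_square flip: exp_add) (simp add: algebra_simps)
    thus ?thesis by (simp add: exp_mult_powr norm_mult power_mult_distrib)
  qed
  thus "(\<integral>\<^sup>+u. ennreal ((cmod (h (exp u)))\<^sup>2 * exp u powr (2 * c - 1)) * ennreal (exp u) \<partial>lborel)
    = (\<integral>\<^sup>+u. ennreal ((cmod (of_real (exp (c * u)) * h (exp u)))\<^sup>2) \<partial>lborel)"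
    by (simp flip: ennreal_mult)
qed

text \<open>The inversion integral of the Mellin transform; \<open>fhat\<close> is its value at
  \<open>emp_mellin\<close> times \<open>ridge\<close> (\<open>fhat_eq\<close>).\<close>

definition mellin_inv :: "real \<Rightarrow> (real \<Rightarrow> complex) \<Rightarrow> real \<Rightarrow> complex" where
  "mellin_inv c H x = (LINT t|lborel. of_real x powr Complex (- c) (- t) * H t) / of_real (2 * pi)"

lemma mellin_inv_eq_fourier:
  assumes "0 < x"
  shows "mellin_inv c H x = of_real (x powr - c) * fourier H (- ln x) / of_real (2 * pi)"
proof -
  have "(LINT t|lborel. of_real x powr Complex (- c) (- t) * H t)
      = (LINT t|lborel. of_real (x powr - c) * (H t * cis (t * (- ln x))))"
    using assms by (simp add: powr_Complex mult_ac)
  thus ?thesis unfolding mellin_inv_def fourier_def by simp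
qed

lemma borel_measurable_mellin_inv [measurable]:
  assumes [measurable]: "H \<in> borel_measurable borel"
  shows "mellin_inv c H \<in> borel_measurable Rplus"
proof -
  have "(\<lambda>x. of_real (x powr - c) * fourier H (- ln x) / of_real (2 * pi)) \<in> borel_measurable Rplus"
    by (rule borel_measurable_imp_Rplus) measurable
  also have "?this \<longleftrightarrow> ?thesis" by (intro measurable_cong) (simp add: mellin_inv_eq_fourier)
  finally show ?thesis .
qed

lemma exp_mult_mellin_inv:
  "of_real (exp (c * u)) * mellin_inv c H (exp u) = fourier H (- u) / of_real (2 * pi)"
proof -
  have "of_real (exp (c * u)) * complex_of_real (exp u powr - c) = 1"
    by (simp add: exp_mult_powr exp_minus flip: of_real_mult)
  thus ?thesis by (simp add: mellin_inv_eq_fourier mult.assoc[symmetric] del: of_real_mult)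
qed

lemma norm2_fourier_reflect:
  assumes [measurable]: "H \<in> borel_measurable borel"
  shows "norm2 (\<lambda>u. fourier H (- u) / of_real (2 * pi)) = ennreal (1 / (2 * pi)\<^sup>2) * norm2 (fourier H)"
proof -
  have "norm2 (\<lambda>u. fourier H (- u) / of_real (2 * pi))
      = (\<integral>\<^sup>+u. ennreal (1 / (2 * pi)\<^sup>2) * ennreal ((cmod (fourier H (- u)))\<^sup>2) \<partial>lborel)"
    unfolding norm2_def by (simp add: norm_divide power_divide flip: ennreal_mult)
  also have "\<dots> = ennreal (1 / (2 * pi)\<^sup>2) * (\<integral>\<^sup>+u. ennreal ((cmod (fourier H (- u)))\<^sup>2) \<partial>lborel)"
    by (rule nn_integral_cmult) measurable
  also have "(\<integral>\<^sup>+u. ennreal ((cmod (fourier H (- u)))\<^sup>2) \<partial>lborel) = norm2 (fourier H)"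
    unfolding norm2_def by (subst nn_integral_real_affine[of _ "-1" 0]) auto
  finally show ?thesis .
qed

lemma wnorm2_mellin_inv_le:
  assumes H: "integrable lborel H"
  shows "wnorm2 c (mellin_inv c H) \<le> ennreal (1 / (2 * pi)) * norm2 H"
proof -
  have [measurable]: "H \<in> borel_measurable borel" using H by auto
  have "wnorm2 c (mellin_inv c H) = ennreal (1 / (2 * pi)\<^sup>2) * norm2 (fourier H)"
    by (subst wnorm2_eq_norm2, measurable) (simp only: exp_mult_mellin_inv norm2_fourier_reflect[OF \<open>H \<in> borel_measurable borel\<close>])
  also have "\<dots> \<le> ennreal (1 / (2 * pi)\<^sup>2) * (ennreal (2 * pi) * norm2 H)"
    by (intro mult_left_mono norm2_fourier_le H) simp
  also have "\<dots> = ennreal (1 / (2 * pi)) * norm2 H"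
    unfolding mult.assoc[symmetric]
    by (subst ennreal_mult[symmetric]) (auto simp: power2_eq_square)
  finally show ?thesis .
qed

lemma norm2_eq_integral:
  assumes [measurable]: "H \<in> borel_measurable borel" and fin: "norm2 H < \<infinity>"
  shows "integrable lborel (\<lambda>t. (cmod (H t))\<^sup>2)" "norm2 H = ennreal (LINT t|lborel. (cmod (H t))\<^sup>2)"
proof -
  show i: "integrable lborel (\<lambda>t. (cmod (H t))\<^sup>2)"
    using fin by (intro integrableI_bounded) (auto simp: norm2_def)
  show "norm2 H = ennreal (LINT t|lborel. (cmod (H t))\<^sup>2)"
    unfolding norm2_def by (rule nn_integral_eq_integral[OF i]) simp
qed

lemma cmod_diff_square: "(cmod (x - y))\<^sup>2 = (cmod x)\<^sup>2 - 2 * Re (x * cnj y) + (cmod y)\<^sup>2"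
  by (simp add: cmod_power2) algebra

lemma integral_cmod_diff_square:
  assumes "integrable M (\<lambda>u. (cmod (x u))\<^sup>2)" "integrable M (\<lambda>u. (cmod (y u))\<^sup>2)" "integrable M (\<lambda>u. x u * cnj (y u))"
  shows "integrable M (\<lambda>u. (cmod (x u - y u))\<^sup>2)"
    and "(LINT u|M. (cmod (x u - y u))\<^sup>2) = (LINT u|M. (cmod (x u))\<^sup>2) - 2 * Re (LINT u|M. x u * cnj (y u)) + (LINT u|M. (cmod (y u))\<^sup>2)"
proof -
  have i: "integrable M (\<lambda>u. Re (x u * cnj (y u)))" by (rule integrable_Re[OF assms(3)])
  show "integrable M (\<lambda>u. (cmod (x u - y u))\<^sup>2)"
    unfolding cmod_diff_square by (intro Bochner_Integration.integrable_add Bochner_Integration.integrable_diff Bochner_Integration.integrable_mult_right assms i)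
  have "(LINT u|M. (cmod (x u))\<^sup>2 - 2 * Re (x u * cnj (y u)) + (cmod (y u))\<^sup>2)
    = (LINT u|M. (cmod (x u))\<^sup>2) - (LINT u|M. 2 * Re (x u * cnj (y u))) + (LINT u|M. (cmod (y u))\<^sup>2)"
    by (simp only: Bochner_Integration.integral_add Bochner_Integration.integral_diff
        Bochner_Integration.integrable_add Bochner_Integration.integrable_diff Bochner_Integration.integrable_mult_right assms i)
  thus "(LINT u|M. (cmod (x u - y u))\<^sup>2) = (LINT u|M. (cmod (x u))\<^sup>2) - 2 * Re (LINT u|M. x u * cnj (y u)) + (LINT u|M. (cmod (y u))\<^sup>2)"
    unfolding cmod_diff_square integral_Re[OF assms(3), symmetric]
    by (simp only: integral_mult_right_zero)
qed

text \<open>The function \<open>f\<close> is only in weighted \<open>L\<^sup>2\<close>, and its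
  transform need not be integrable, so the difference is not itself an inversion integral. Both
  squared distances are expanded instead: the square of the inverted \<open>H\<close> is bounded by
  \<open>norm2_fourier_le\<close>, the square of \<open>f\<close> by
  \<open>norm2_le_fourier\<close>, and the cross terms agree by Fubini.\<close>

lemma wnorm2_mellin_inv_diff_le:
  assumes H: "integrable lborel H" and H2: "norm2 H < \<infinity>"
    and f [measurable]: "f \<in> borel_measurable Rplus" and nn: "\<And>x. 0 < x \<Longrightarrow> 0 \<le> f x"
    and int: "integrable lborel (\<lambda>u. exp (c * u) * f (exp u))"
    and f2: "wnorm2 c (\<lambda>x. of_real (f x)) < \<infinity>"
  shows "wnorm2 c (\<lambda>x. mellin_inv c H x - of_real (f x)) \<le> ennreal (1 / (2 * pi)) * norm2 (\<lambda>t. H t - mellin c f t)"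
proof -
  have [measurable]: "H \<in> borel_measurable borel" using H by auto
  define phi where "phi = (\<lambda>u. exp (c * u) * f (exp u))"
  have [measurable]: "phi \<in> borel_measurable borel" unfolding phi_def by measurable
  have phi: "integrable lborel phi" "0 \<le> phi u" for u using int nn unfolding phi_def by auto
  have trunc_centered: "integrable lborel (\<lambda>u. complex_of_real (phi u))" using phi by simp
  define P where "P = fourier (\<lambda>u. of_real (phi u))"
  have [measurable]: "P \<in> borel_measurable borel" unfolding P_def by measurable
  have M: "mellin c f = P" unfolding P_def phi_def by (intro ext mellin_eq_fourier) simp
  define psi where "psi = (\<lambda>u. fourier H (- u) / of_real (2 * pi))"
  have [measurable]: "psi \<in> borel_measurable borel" unfolding psi_def by measurable
  have eq: "wnorm2 c (\<lambda>x. mellin_inv c H x - of_real (f x)) = norm2 (\<lambda>u. psi u - of_real (phi u))"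
    by (subst wnorm2_eq_norm2) (auto simp: right_diff_distrib exp_mult_mellin_inv psi_def phi_def)
  have fphi: "norm2 (\<lambda>u. of_real (phi u)) < \<infinity>"
    using f2 by (subst (asm) wnorm2_eq_norm2) (auto simp: phi_def)
  have fP: "norm2 P < \<infinity>"
    using norm2_fourier_le[OF trunc_centered] fphi unfolding P_def
    by (auto simp: ennreal_mult_less_top intro: le_less_trans)
  have fpsi: "norm2 psi \<le> ennreal (1 / (2 * pi)) * norm2 H"
    using wnorm2_mellin_inv_le[OF H, of c]
    by (subst (asm) wnorm2_eq_norm2) (auto simp: exp_mult_mellin_inv psi_def)
  hence fpsi': "norm2 psi < \<infinity>" using H2 by (auto simp: ennreal_mult_less_top intro: le_less_trans)
  have "(\<lambda>u. complex_of_real (phi u)) \<in> borel_measurable borel" by measurable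
  note ip = norm2_eq_integral[OF this fphi] norm2_eq_integral[OF \<open>P \<in> borel_measurable borel\<close> fP]
    norm2_eq_integral[OF \<open>psi \<in> borel_measurable borel\<close> fpsi'] norm2_eq_integral[OF \<open>H \<in> borel_measurable borel\<close> H2]
  have bP: "cmod (P u) \<le> (LINT t|lborel. cmod (phi t))" for u
    unfolding P_def by (rule norm_fourier_le[THEN order_trans]) simp
  have cr1: "integrable lborel (\<lambda>t. H t * cnj (P t))"
    by (rule integrable_mult_bounded[OF H]) (use bP in auto)
  have cr2: "integrable lborel (\<lambda>u. psi u * of_real (phi u))"
    by (rule integrable_mult_bounded[OF trunc_centered, where C = "(LINT t|lborel. cmod (H t)) / (2 * pi)"])
       (auto simp: psi_def norm_divide intro!: divide_right_mono norm_fourier_le)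
  \<comment> \<open>\<open>H\<close> and \<open>phi\<close> are integrable, so the kernel
    \<open>cis\<close> is integrated against two integrable functions; no extension of the transform
    to \<open>L\<^sup>2\<close> is involved.\<close>
  have cross: "(LINT u|lborel. psi u * of_real (phi u)) = (LINT t|lborel. H t * cnj (P t)) / of_real (2 * pi)"
  proof -
    have "(LINT u|lborel. (LINT t|lborel. H t * cis (- (t * u))) * of_real (phi u))
       = (LINT t|lborel. H t * (LINT u|lborel. cis (- (t * u)) * of_real (phi u)))"
      by (rule Fubini_bounded_kernel[where C = 1]) (auto intro: lborel.sigma_finite_measure_axioms H trunc_centered)
    moreover have "(LINT u|lborel. cis (- (t * u)) * of_real (phi u)) = cnj (P t)" for t
      unfolding P_def fourier_def Bochner_Integration.integral_cnj[symmetric] by (simp add: cis_cnj mult_ac)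
    ultimately have "(LINT u|lborel. fourier H (- u) * of_real (phi u)) = (LINT t|lborel. H t * cnj (P t))"
      unfolding fourier_def by (simp add: mult_ac)
    moreover have "(LINT u|lborel. psi u * of_real (phi u)) = (LINT u|lborel. fourier H (- u) * of_real (phi u)) / of_real (2 * pi)"
      unfolding psi_def by (subst integral_divide_zero[symmetric]) (simp add: field_simps)
    ultimately show ?thesis by simp
  qed
  note 1 = integral_cmod_diff_square[OF ip(5,1), unfolded complex_cnj_complex_of_real, OF cr2]
  note 2 = integral_cmod_diff_square[OF ip(7,3) cr1]
  have "(LINT u|lborel. (cmod (psi u))\<^sup>2) \<le> 1 / (2 * pi) * (LINT t|lborel. (cmod (H t))\<^sup>2)"
    using fpsi ip(6,8) by (simp add: ennreal_mult[symmetric] Bochner_Integration.integral_nonneg)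
  moreover have "(LINT u|lborel. (cmod (of_real (phi u)))\<^sup>2) \<le> 1 / (2 * pi) * (LINT t|lborel. (cmod (P t))\<^sup>2)"
  proof -
    have "2 * pi * (LINT u|lborel. (cmod (of_real (phi u)))\<^sup>2) \<le> (LINT t|lborel. (cmod (P t))\<^sup>2)"
      using norm2_le_fourier[OF phi] ip(2,4) unfolding P_def[symmetric]
      by (simp add: ennreal_mult[symmetric] Bochner_Integration.integral_nonneg)
    thus ?thesis by (simp add: field_simps)
  qed
  moreover have "Re ((LINT t|lborel. H t * cnj (P t)) / of_real (2 * pi)) = 1 / (2 * pi) * Re (LINT t|lborel. H t * cnj (P t))"
    by (subst Re_divide_of_real) simp
  ultimately have "(LINT u|lborel. (cmod (psi u - of_real (phi u)))\<^sup>2) \<le> 1 / (2 * pi) * (LINT t|lborel. (cmod (H t - P t))\<^sup>2)"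
    unfolding 1(2) 2(2) cross distrib_left right_diff_distrib by linarith
  hence "norm2 (\<lambda>u. psi u - of_real (phi u)) \<le> ennreal (1 / (2 * pi)) * norm2 (\<lambda>t. H t - P t)"
    unfolding norm2_def nn_integral_eq_integral[OF 1(1) AE_I2[OF zero_le_power2]] nn_integral_eq_integral[OF 2(1) AE_I2[OF zero_le_power2]]
    by (simp add: ennreal_mult[symmetric] Bochner_Integration.integral_nonneg)
  thus ?thesis unfolding M eq by simp
qed

section \<open>Sums of independent centered random functions\<close>

text \<open>For negative \<open>x\<close>, \<open>(1 - x) * exp x \<le> 1 \<le> 1 - x ^ 3 = (1 - x)
  * (1 + x + x\<^sup>2)\<close>. A one-sided condition on \<open>x\<close> is enough.\<close>

lemma exp_le_quadratic:
  fixes x :: real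
  assumes "x \<le> 1"
  shows "exp x \<le> 1 + x + x\<^sup>2"
proof (cases "0 \<le> x")
  case True
  thus ?thesis using exp_bound assms by simp
next
  case False
  have "(1 - x) * exp x \<le> exp (- x) * exp x"
    using exp_ge_add_one_self[of "- x"] by (intro mult_right_mono) auto
  also have "\<dots> = 1" by (simp flip: exp_add)
  also have "1 \<le> 1 - x ^ 3" using False by (simp add: power3_eq_cube mult_nonneg_nonpos mult_nonpos_nonpos)
  also have "\<dots> = (1 - x) * (1 + x + x\<^sup>2)" by (simp add: power2_eq_square power3_eq_cube algebra_simps)
  finally show ?thesis using False by (subst (asm) mult_le_cancel_left_pos) auto
qed

text \<open>With \<open>u = mu * (x - b)\<close> the difference of squares is
  \<open>u\<^sup>2 / mu\<^sup>2 + 2 * b * u / mu\<close>, and \<open>u \<le> exp u\<close>,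
  \<open>u\<^sup>2 \<le> 2 * exp u\<close> for nonnegative \<open>u\<close>. It converts an
  exponential moment of a norm into an expected excess of its square.\<close>

lemma square_diff_le_exp:
  fixes x b mu :: real
  assumes x: "0 \<le> x" and b: "0 \<le> b" and mu: "0 < mu"
  shows "x\<^sup>2 - b\<^sup>2 \<le> (2 / mu\<^sup>2 + 2 * b / mu) * exp (mu * (x - b))"
proof (cases "x \<le> b")
  case True
  hence "x\<^sup>2 - b\<^sup>2 \<le> 0" using x by (simp add: power_mono)
  also have "0 \<le> (2 / mu\<^sup>2 + 2 * b / mu) * exp (mu * (x - b))"
    using b mu by (intro mult_nonneg_nonneg add_nonneg_nonneg divide_nonneg_pos) auto
  finally show ?thesis .
next
  case False
  define u where "u = mu * (x - b)"
  have u: "0 \<le> u" using False mu by (simp add: u_def)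
  have xb: "x = b + u / mu" using mu by (simp add: u_def)
  have "u\<^sup>2 / 2 \<le> exp u" "u \<le> exp u"
    using exp_lower_Taylor_quadratic[OF u] u exp_ge_add_one_self[of u] by (auto intro: order_trans[of _ "1 + u + u\<^sup>2 / 2"])
  hence *: "u\<^sup>2 \<le> 2 * exp u" "u \<le> exp u" by auto
  have "x\<^sup>2 - b\<^sup>2 = u\<^sup>2 / mu\<^sup>2 + 2 * b / mu * u"
    using mu by (simp add: xb power2_eq_square field_simps)
  also have "\<dots> \<le> (2 * exp u) / mu\<^sup>2 + 2 * b / mu * exp u"
    using b mu by (intro add_mono divide_right_mono mult_left_mono *) auto
  finally show ?thesis unfolding u_def[symmetric] by (simp add: algebra_simps)
qed

text \<open>The concave square root lies below its tangent at \<open>A\<^sup>2\<close>.\<close>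

lemma sqrt_add_le:
  fixes A d :: real
  assumes "0 < A" "0 \<le> A\<^sup>2 + d"
  shows "sqrt (A\<^sup>2 + d) \<le> A + d / (2 * A)"
proof (rule real_le_lsqrt)
  have eq: "A + d / (2 * A) = (A\<^sup>2 + (A\<^sup>2 + d)) / (2 * A)"
    using assms by (simp add: field_simps power2_eq_square)
  show "0 \<le> A + d / (2 * A)" unfolding eq
    using add_nonneg_nonneg[OF zero_le_power2[of A] assms(2)] assms(1) by (intro divide_nonneg_pos) simp_all
  have "(A + d / (2 * A))\<^sup>2 = A\<^sup>2 + d + (d / (2 * A))\<^sup>2"
    using assms by (simp add: power2_sum)
  thus "A\<^sup>2 + d \<le> (A + d / (2 * A))\<^sup>2" by simp
qed

text \<open>Splits off the last observation; the inductions on the sample size rest on it.\<close>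

lemma nn_integral_PiM_Suc:
  fixes h :: "(nat \<Rightarrow> 'a) \<Rightarrow> ennreal"
  assumes "prob_space P" and "h \<in> borel_measurable (PiM {..<Suc n} (\<lambda>_. P))"
  shows "(\<integral>\<^sup>+Y. h Y \<partial>PiM {..<Suc n} (\<lambda>_. P)) = (\<integral>\<^sup>+Y. (\<integral>\<^sup>+y. h (Y(n := y)) \<partial>P) \<partial>PiM {..<n} (\<lambda>_. P))"
proof -
  interpret prob_space P by fact
  interpret product_sigma_finite "\<lambda>_::nat. P" ..
  show ?thesis
    using product_nn_integral_insert[of "{..<n}" n h] assms(2) by (simp add: lessThan_Suc)
qed

text \<open>Independent centered variables are orthogonal, so second moments add up. With an
  infinite second moment the right side is infinite unless \<open>n = 0\<close>, where both sides
  vanish.\<close>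

lemma nn_integral_sum_square_le:
  fixes psi :: "'a \<Rightarrow> complex"
  assumes P: "prob_space P" and int: "integrable P psi" and zero: "(LINT y|P. psi y) = 0"
  shows "(\<integral>\<^sup>+Y. ennreal ((cmod (\<Sum>i<n. psi (Y i)))\<^sup>2) \<partial>PiM {..<n} (\<lambda>_. P))
    \<le> of_nat n * (\<integral>\<^sup>+y. ennreal ((cmod (psi y))\<^sup>2) \<partial>P)"
proof (cases "(\<integral>\<^sup>+y. ennreal ((cmod (psi y))\<^sup>2) \<partial>P) < \<infinity>")
  case True
  interpret P: prob_space P by fact
  have [measurable]: "psi \<in> borel_measurable P" using int by auto
  have sq: "integrable P (\<lambda>y. (cmod (psi y))\<^sup>2)"
    using True by (intro integrableI_bounded) auto
  have step: "(\<integral>\<^sup>+y. ennreal ((cmod (s + psi y))\<^sup>2) \<partial>P) = ennreal ((cmod s)\<^sup>2) + (\<integral>\<^sup>+y. ennreal ((cmod (psi y))\<^sup>2) \<partial>P)" for s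
  proof -
    have eq: "(cmod (s + psi y))\<^sup>2 = (cmod s)\<^sup>2 + 2 * Re (cnj s * psi y) + (cmod (psi y))\<^sup>2" for y
      by (simp add: cmod_power2) algebra
    have i: "integrable P (\<lambda>y. Re (cnj s * psi y))" using int by (intro integrable_Re) auto
    have "(LINT y|P. Re (cnj s * psi y)) = Re (LINT y|P. cnj s * psi y)"
      using int by (intro integral_Re) auto
    hence z: "(LINT y|P. Re (cnj s * psi y)) = 0" by (simp add: zero)
    have i2: "integrable P (\<lambda>y. (cmod (s + psi y))\<^sup>2)"
      unfolding eq using i sq by (intro Bochner_Integration.integrable_add Bochner_Integration.integrable_mult_right) auto
    have "(LINT y|P. (cmod (s + psi y))\<^sup>2) = (cmod s)\<^sup>2 + (LINT y|P. (cmod (psi y))\<^sup>2)"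
      unfolding eq using i sq z
      by (simp only: Bochner_Integration.integral_add Bochner_Integration.integrable_add
          Bochner_Integration.integrable_mult_right P.integrable_const integral_mult_right_zero) (simp add: P.prob_space)
    thus ?thesis
      using i2 sq by (simp add: nn_integral_eq_integral Bochner_Integration.integral_nonneg)
  qed
  show ?thesis
  proof (induction n)
    case (Suc n)
    have "(\<integral>\<^sup>+Y. ennreal ((cmod (\<Sum>i<Suc n. psi (Y i)))\<^sup>2) \<partial>PiM {..<Suc n} (\<lambda>_. P))
       = (\<integral>\<^sup>+Y. (\<integral>\<^sup>+y. ennreal ((cmod ((\<Sum>i<n. psi (Y i)) + psi y))\<^sup>2) \<partial>P) \<partial>PiM {..<n} (\<lambda>_. P))"
      by (subst nn_integral_PiM_Suc[OF P]) auto
    also have "\<dots> = (\<integral>\<^sup>+Y. ennreal ((cmod (\<Sum>i<n. psi (Y i)))\<^sup>2) \<partial>PiM {..<n} (\<lambda>_. P))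
       + (\<integral>\<^sup>+y. ennreal ((cmod (psi y))\<^sup>2) \<partial>P)"
    proof -
      interpret Q: prob_space "PiM {..<n} (\<lambda>_. P)" by (intro prob_space_PiM P)
      show ?thesis unfolding step by (subst nn_integral_add) (auto simp: Q.emeasure_space_1)
    qed
    also have "\<dots> \<le> of_nat (Suc n) * (\<integral>\<^sup>+y. ennreal ((cmod (psi y))\<^sup>2) \<partial>P)"
      using add_right_mono[OF Suc.IH] by (simp add: distrib_right add.commute)
    finally show ?case .
  qed (simp add: nn_integral_empty)
next
  case False
  thus ?thesis by (cases n) (auto simp: not_less top_unique nn_integral_empty ennreal_mult_eq_top_iff)
qed

section \<open>A Bernstein inequality for sums of random functions\<close>

text \<open>\<open>phi y\<close> is a random element of \<open>L\<^sup>2(N)\<close> with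
  \<open>y\<close> drawn from \<open>P\<close>: \<open>a\<close> bounds the expected squared norm,
  \<open>M\<close> the norm itself, and \<open>v\<close> the variance of one-dimensional
  projections. \<open>D\<close> is a qualitative bound that secures integrability and joint exchange
  of integrals. Projections are tested on bounded functions only, since every partial sum is
  bounded.\<close>

locale centered_random_function = P: prob_space P + N: finite_measure N
  for P :: "'a measure" and N :: "'b measure" +
  fixes phi :: "'a \<Rightarrow> 'b \<Rightarrow> complex" and D v a M :: real
  assumes meas: "(\<lambda>(y, t). phi y t) \<in> borel_measurable (P \<Otimes>\<^sub>M N)"
    and bounded: "\<And>y t. cmod (phi y t) \<le> D"
    and centered: "\<And>t. t \<in> space N \<Longrightarrow> (LINT y|P. phi y t) = 0"
    and weak_variance: "\<And>s B. s \<in> borel_measurable N \<Longrightarrow> (\<And>t. cmod (s t) \<le> B) \<Longrightarrow>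
      (LINT y|P. (Re (LINT t|N. s t * cnj (phi y t)))\<^sup>2) \<le> v * (LINT t|N. (cmod (s t))\<^sup>2)"
    and strong_variance: "(LINT y|P. LINT t|N. (cmod (phi y t))\<^sup>2) \<le> a"
    and sup_norm: "\<And>y. y \<in> space P \<Longrightarrow> (LINT t|N. (cmod (phi y t))\<^sup>2) \<le> M\<^sup>2"
    and M_pos: "0 < M" and v_nonneg: "0 \<le> v"
begin

abbreviation sq :: "('b \<Rightarrow> complex) \<Rightarrow> real" where
  "sq s \<equiv> LINT t|N. (cmod (s t))\<^sup>2"

lemma sq_nonneg: "0 \<le> sq s"
  by (intro Bochner_Integration.integral_nonneg) simp

lemma measurable_phi [measurable (raw)]:
  "g \<in> Q \<rightarrow>\<^sub>M P \<Longrightarrow> h \<in> Q \<rightarrow>\<^sub>M N \<Longrightarrow> (\<lambda>x. phi (g x) (h x)) \<in> borel_measurable Q"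
  using measurable_compose[OF measurable_Pair meas, of g Q h] by simp

lemma integrable_N_bounded:
  fixes h :: "'b \<Rightarrow> 'c::{banach, second_countable_topology}"
  shows "h \<in> borel_measurable N \<Longrightarrow> (\<And>t. norm (h t) \<le> B) \<Longrightarrow> integrable N h"
  by (rule N.integrable_const_bound) auto

lemma integrable_sq:
  "s \<in> borel_measurable N \<Longrightarrow> (\<And>t. cmod (s t) \<le> B) \<Longrightarrow> integrable N (\<lambda>t. (cmod (s t))\<^sup>2)"
  by (rule integrable_N_bounded[where B = "B\<^sup>2"]) (auto intro: power_mono)

lemma inner_square_le:
  assumes [measurable]: "s \<in> borel_measurable N" "s' \<in> borel_measurable N"
    and b: "\<And>t. cmod (s t) \<le> B" "\<And>t. cmod (s' t) \<le> B'"
  shows "(cmod (LINT t|N. s t * cnj (s' t)))\<^sup>2 \<le> sq s * sq s'"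
proof -
  have "ennreal ((cmod (LINT t|N. s t * cnj (s' t)))\<^sup>2)
      \<le> (\<integral>\<^sup>+t. ennreal ((cmod (s t))\<^sup>2) \<partial>N) * (\<integral>\<^sup>+t. ennreal ((cmod (cnj (s' t)))\<^sup>2) \<partial>N)"
    by (rule norm_integral_square_le) measurable
  also have "\<dots> = ennreal (sq s * sq s')"
    using integrable_sq[OF _ b(1)] integrable_sq[OF _ b(2)]
    by (simp add: nn_integral_eq_integral ennreal_mult sq_nonneg)
  finally show ?thesis by (simp add: sq_nonneg)
qed

lemma measurable_section: "y \<in> space P \<Longrightarrow> phi y \<in> borel_measurable N"
  using measurable_phi[of "\<lambda>_. y" N "\<lambda>t. t"] by simp

lemma cmod_inner_le:
  assumes s: "s \<in> borel_measurable N" "\<And>t. cmod (s t) \<le> B" and y: "y \<in> space P"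
  shows "cmod (LINT t|N. s t * cnj (phi y t)) \<le> sqrt (sq s) * M"
proof -
  have "(cmod (LINT t|N. s t * cnj (phi y t)))\<^sup>2 \<le> sq s * M\<^sup>2"
    using inner_square_le[OF s(1) measurable_section[OF y] s(2) bounded] sup_norm[OF y]
    by (rule order_trans[OF _ mult_left_mono]) (auto intro: sq_nonneg)
  also have "\<dots> = (sqrt (sq s) * M)\<^sup>2" by (simp add: power_mult_distrib sq_nonneg)
  finally show ?thesis
    by (rule power2_le_imp_le) (use M_pos sq_nonneg in auto)
qed

lemma mean_inner:
  assumes s [measurable]: "s \<in> borel_measurable N" and b: "\<And>t. cmod (s t) \<le> B"
  shows "(LINT y|P. Re (LINT t|N. s t * cnj (phi y t))) = 0"
proof -
  have "(LINT y|P. (LINT t|N. s t * cnj (phi y t)) * 1) = (LINT t|N. s t * (LINT y|P. cnj (phi y t) * 1))"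
    by (rule Fubini_bounded_kernel[where C = D])
       (auto intro: N.sigma_finite_measure_axioms P.sigma_finite_measure_axioms bounded integrable_N_bounded[OF s b])
  also have "\<dots> = (LINT t|N. 0)"
    by (intro Bochner_Integration.integral_cong) (simp_all add: centered)
  finally have *: "(LINT y|P. LINT t|N. s t * cnj (phi y t)) = 0" by simp
  have "integrable P (\<lambda>y. LINT t|N. s t * cnj (phi y t))"
    by (rule P.integrable_const_bound[where B = "sqrt (sq s) * M"])
       (auto intro!: AE_I2 cmod_inner_le[OF s b])
  from integral_Re[OF this] * show ?thesis by simp
qed

text \<open>\<open>L\<close> is the smoothing level in \<open>q\<close>. By \<open>M \<le> L\<close>
  the quadratic part of an increment is at most \<open>M / 2\<close>; then
  \<open>2 * mu * M \<le> 1\<close> keeps \<open>mu\<close> times the increment below 3/4, inside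
  the range of \<open>exp_le_quadratic\<close>.\<close>

context
  fixes L mu :: real
  assumes L: "0 < L" "M \<le> L" and mu: "0 < mu" "2 * mu * M \<le> 1"
begin

definition q :: "('b \<Rightarrow> complex) \<Rightarrow> real" where
  "q s = sqrt (L\<^sup>2 + sq s)"

lemma q_ge: "L \<le> q s" "sqrt (sq s) \<le> q s" "0 < q s" "(q s)\<^sup>2 = L\<^sup>2 + sq s"
proof -
  show "L \<le> q s" unfolding q_def using sq_nonneg by (intro real_le_rsqrt) auto
  thus "0 < q s" using L by simp
  show "sqrt (sq s) \<le> q s" unfolding q_def by (intro real_sqrt_le_mono) simp
  show "(q s)\<^sup>2 = L\<^sup>2 + sq s" unfolding q_def using sq_nonneg by simp
qed

text \<open>The square root makes the increment of \<open>q\<close> uniformly bounded, however large \<open>s\<close> is, while its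
  conditional variance stays below the weak variance \<open>v\<close>.\<close>

lemma exp_q_step:
  assumes s [measurable]: "s \<in> borel_measurable N" and b: "\<And>t. cmod (s t) \<le> B"
  shows "(\<integral>\<^sup>+y. ennreal (exp (mu * q (\<lambda>t. s t + phi y t))) \<partial>P)
    \<le> ennreal (exp (mu * q s + (3 / 4 * mu * a / L + 2 * mu\<^sup>2 * v)))"
proof -
  \<comment> \<open>The tangent bound splits the increment of \<open>q\<close> into a linear part
    \<open>x\<close> and a quadratic part \<open>z\<close>. Dividing by \<open>q s\<close>, which is
    at least \<open>sqrt (sq s)\<close> and at least \<open>L\<close>, gives
    \<open>\<bar>x\<bar> \<le> M\<close>, mean 0 and second moment at most \<open>v\<close> for
    \<open>x\<close>, and mean at most \<open>a / (2 * L)\<close> for \<open>z\<close>.\<close>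
  define x where "x = (\<lambda>y. Re (LINT t|N. s t * cnj (phi y t)) / q s)"
  define z where "z = (\<lambda>y. sq (phi y) / (2 * q s))"
  have [measurable]: "x \<in> borel_measurable P" "z \<in> borel_measurable P" unfolding x_def z_def by measurable
  have xb: "\<bar>x y\<bar> \<le> M" if "y \<in> space P" for y
  proof -
    have "\<bar>Re (LINT t|N. s t * cnj (phi y t))\<bar> \<le> sqrt (sq s) * M"
      using abs_Re_le_cmod cmod_inner_le[OF s b that] by (rule order_trans)
    also have "\<dots> \<le> q s * M" using q_ge M_pos by (intro mult_right_mono) auto
    finally show ?thesis using q_ge(3)[of s] by (simp add: x_def abs_div field_simps)
  qed
  have z0: "0 \<le> z y" for y unfolding z_def using sq_nonneg q_ge(3)[of s] by simp
  have zb: "z y \<le> M / 2" if "y \<in> space P" for y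
  proof -
    have "sq (phi y) / (2 * q s) \<le> M\<^sup>2 / (2 * L)"
      using sup_norm[OF that] L q_ge(1)[of s] by (intro frac_le) auto
    also have "\<dots> \<le> M / 2" using L M_pos by (simp add: power2_eq_square field_simps)
    finally show ?thesis unfolding z_def .
  qed
  have ix: "integrable P x" by (rule P.integrable_const_bound[where B = M]) (auto intro: xb)
  have iz: "integrable P z"
  proof (rule P.integrable_const_bound[where B = "M / 2"])
    show "AE y in P. norm (z y) \<le> M / 2" using zb z0 by (intro AE_I2) simp
  qed measurable
  have ix2: "integrable P (\<lambda>y. (x y)\<^sup>2)"
    by (rule P.integrable_const_bound[where B = "M\<^sup>2"]) (use xb in \<open>auto simp: power_mono[of "\<bar>x _\<bar>" M 2, simplified]\<close>)
  have mx: "(LINT y|P. x y) = 0" unfolding x_def using mean_inner[OF s b] by simp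
  have mz: "(LINT y|P. z y) \<le> a / (2 * L)"
  proof -
    have "(LINT y|P. z y) = (LINT y|P. sq (phi y)) / (2 * q s)" unfolding z_def by simp
    also have "\<dots> \<le> a / (2 * L)"
      using strong_variance L q_ge(1)[of s]
      by (intro frac_le) (auto intro!: order_trans[OF _ strong_variance] Bochner_Integration.integral_nonneg sq_nonneg)
    finally show ?thesis .
  qed
  have vx: "(LINT y|P. (x y)\<^sup>2) \<le> v"
  proof -
    have "(LINT y|P. (x y)\<^sup>2) = (LINT y|P. (Re (LINT t|N. s t * cnj (phi y t)))\<^sup>2) / (q s)\<^sup>2"
      unfolding x_def power_divide by simp
    also have "\<dots> \<le> v * sq s / (q s)\<^sup>2" by (intro divide_right_mono weak_variance[OF s b]) auto
    also have "\<dots> \<le> v"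
    proof -
      have "v * sq s \<le> v * (q s)\<^sup>2" using q_ge(4)[of s] v_nonneg by (intro mult_left_mono) auto
      thus ?thesis using q_ge(3)[of s] by (simp add: pos_divide_le_eq)
    qed
    finally show ?thesis .
  qed
  have step: "exp (mu * q (\<lambda>t. s t + phi y t))
      \<le> exp (mu * q s) * (1 + mu * x y + 3 / 2 * mu * z y + 2 * mu\<^sup>2 * (x y)\<^sup>2)" if y: "y \<in> space P" for y
  proof -
    have my: "phi y \<in> borel_measurable N" by (rule measurable_section[OF y])
    have isn: "integrable N (\<lambda>t. s t * cnj (phi y t))"
      using my by (intro integrable_mult_bounded(1)[OF integrable_N_bounded[OF s b], of _ D]) (auto simp: bounded)
    have i1: "integrable N (\<lambda>t. Re (s t * cnj (phi y t)))" by (rule integrable_Re[OF isn])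
    have eq: "(cmod (s t + phi y t))\<^sup>2 = (cmod (s t))\<^sup>2 + 2 * Re (s t * cnj (phi y t)) + (cmod (phi y t))\<^sup>2" for t
      by (simp add: cmod_power2) algebra
    have "sq (\<lambda>t. s t + phi y t) = sq s + 2 * Re (LINT t|N. s t * cnj (phi y t)) + sq (phi y)"
      unfolding eq integral_Re[OF isn, symmetric]
      by (simp only: Bochner_Integration.integral_add Bochner_Integration.integrable_add
          Bochner_Integration.integrable_mult_right integral_mult_right_zero i1
          integrable_sq[OF s b] integrable_sq[OF my bounded])
    also have "\<dots> = sq s + 2 * q s * (x y + z y)"
      using q_ge(3)[of s] by (simp add: x_def z_def field_simps)
    finally have "q (\<lambda>t. s t + phi y t) = sqrt ((q s)\<^sup>2 + 2 * q s * (x y + z y))"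
      unfolding q_ge(4) by (simp add: q_def add.assoc)
    moreover have "0 \<le> (q s)\<^sup>2 + 2 * q s * (x y + z y)"
      using calculation q_ge(3)[of "\<lambda>t. s t + phi y t"] by (metis less_eq_real_def real_sqrt_gt_0_iff)
    ultimately have "q (\<lambda>t. s t + phi y t) \<le> q s + (x y + z y)"
      using sqrt_add_le[of "q s" "2 * q s * (x y + z y)"] q_ge(3)[of s] by simp
    hence "exp (mu * q (\<lambda>t. s t + phi y t)) \<le> exp (mu * q s + mu * (x y + z y))"
      using mu by (simp flip: distrib_left)
    also have "\<dots> = exp (mu * q s) * exp (mu * (x y + z y))" by (rule exp_add)
    also have "exp (mu * (x y + z y)) \<le> 1 + mu * (x y + z y) + (mu * (x y + z y))\<^sup>2"
    proof (rule exp_le_quadratic)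
      have "mu * (x y + z y) \<le> mu * (M + M / 2)"
        using xb[OF y] zb[OF y] mu by (intro mult_left_mono) auto
      thus "mu * (x y + z y) \<le> 1" using mu(2) by simp
    qed
    \<comment> \<open>Since \<open>mu * z \<le> 1/4\<close>, the term
      \<open>2 * (mu * z)\<^sup>2\<close> is at most \<open>mu * z / 2\<close>. Together with the
      linear term this gives the coefficient 3/2, and the mean of \<open>z\<close> turns it into 3/4
      of \<open>mu * a / L\<close>.\<close>
    also have "(mu * (x y + z y))\<^sup>2 \<le> 2 * mu\<^sup>2 * (x y)\<^sup>2 + 1 / 2 * mu * z y"
    proof -
      have "(x y + z y)\<^sup>2 \<le> 2 * (x y)\<^sup>2 + 2 * (z y)\<^sup>2"
        using zero_le_power2[of "x y - z y"] by (simp add: power2_diff power2_sum)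
      hence "(mu * (x y + z y))\<^sup>2 \<le> mu\<^sup>2 * (2 * (x y)\<^sup>2 + 2 * (z y)\<^sup>2)"
        by (simp add: power_mult_distrib mult_left_mono)
      moreover have "mu\<^sup>2 * (2 * (z y)\<^sup>2) \<le> 1 / 2 * mu * z y"
      proof -
        have "mu * z y \<le> mu * (M / 2)" using zb[OF y] mu by (intro mult_left_mono) auto
        hence "mu * z y \<le> 1 / 4" using mu(2) by simp
        hence "(mu * z y) * (mu * z y) \<le> 1 / 4 * (mu * z y)" using z0 mu by (intro mult_right_mono) auto
        thus ?thesis by (simp add: power2_eq_square mult_ac)
      qed
      ultimately show ?thesis by (simp add: algebra_simps)
    qed
    finally show ?thesis by (simp add: algebra_simps)
  qed
  have i: "integrable P (\<lambda>y. 1 + mu * x y + 3 / 2 * mu * z y + 2 * mu\<^sup>2 * (x y)\<^sup>2)"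
    using ix iz ix2 by (intro Bochner_Integration.integrable_add Bochner_Integration.integrable_mult_right) auto
  have "(\<integral>\<^sup>+y. ennreal (exp (mu * q (\<lambda>t. s t + phi y t))) \<partial>P)
      \<le> (\<integral>\<^sup>+y. ennreal (exp (mu * q s) * (1 + mu * x y + 3 / 2 * mu * z y + 2 * mu\<^sup>2 * (x y)\<^sup>2)) \<partial>P)"
    by (intro nn_integral_mono ennreal_leI step)
  also have "\<dots> = ennreal (LINT y|P. exp (mu * q s) * (1 + mu * x y + 3 / 2 * mu * z y + 2 * mu\<^sup>2 * (x y)\<^sup>2))"
    by (intro nn_integral_eq_integral Bochner_Integration.integrable_mult_right i AE_I2)
       (rule order_trans[OF less_imp_le[OF exp_gt_zero] step])
  also have "\<dots> \<le> ennreal (exp (mu * q s + (3 / 4 * mu * a / L + 2 * mu\<^sup>2 * v)))"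
  proof (rule ennreal_leI)
    have "(LINT y|P. 1 + mu * x y + 3 / 2 * mu * z y + 2 * mu\<^sup>2 * (x y)\<^sup>2)
        = 1 + mu * (LINT y|P. x y) + 3 / 2 * mu * (LINT y|P. z y) + 2 * mu\<^sup>2 * (LINT y|P. (x y)\<^sup>2)"
      using ix iz ix2
      by (simp only: Bochner_Integration.integral_add Bochner_Integration.integrable_add P.integrable_const
          Bochner_Integration.integrable_mult_right integral_mult_right_zero) (simp add: P.prob_space)
    also have "\<dots> \<le> 1 + 3 / 2 * mu * (a / (2 * L)) + 2 * mu\<^sup>2 * v"
      unfolding mx using mz vx mu by (intro add_mono mult_left_mono) auto
    also have "\<dots> \<le> exp (3 / 4 * mu * a / L + 2 * mu\<^sup>2 * v)"
      by (rule order_trans[OF _ exp_ge_add_one_self]) simp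
    finally show "(LINT y|P. exp (mu * q s) * (1 + mu * x y + 3 / 2 * mu * z y + 2 * mu\<^sup>2 * (x y)\<^sup>2))
        \<le> exp (mu * q s + (3 / 4 * mu * a / L + 2 * mu\<^sup>2 * v))"
      by (simp add: exp_add)
  qed
  finally show ?thesis .
qed

lemma measurable_sum_process [measurable]:
  "(\<lambda>(Y, t). \<Sum>i<n. phi (Y i) t) \<in> borel_measurable (PiM {..<n} (\<lambda>_. P) \<Otimes>\<^sub>M N)"
  unfolding split_beta
  by (intro borel_measurable_sum measurable_phi measurable_snd
      measurable_compose[OF measurable_fst measurable_component_singleton])

lemma measurable_sq_sum:
  "(\<lambda>Y. sq (\<lambda>t. \<Sum>i<n. phi (Y i) t)) \<in> borel_measurable (PiM {..<n} (\<lambda>_. P))"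
  using measurable_sum_process[of n] by measurable

text \<open>The factor gained in \<open>exp_q_step\<close> does not depend on \<open>s\<close>, so
  it can be taken out of the integral at every step of the induction. The empty sum starts it at
  \<open>q 0 = L\<close>.\<close>

lemma exp_q_sum:
  "(\<integral>\<^sup>+Y. ennreal (exp (mu * q (\<lambda>t. \<Sum>i<n. phi (Y i) t))) \<partial>PiM {..<n} (\<lambda>_. P))
    \<le> ennreal (exp (mu * L + real n * (3 / 4 * mu * a / L + 2 * mu\<^sup>2 * v)))"
proof (induction n)
  case 0
  show ?case using L by (simp add: q_def PiM_empty)
next
  case (Suc n)
  let ?k = "3 / 4 * mu * a / L + 2 * mu\<^sup>2 * v"
  have m: "(\<lambda>Y. ennreal (exp (mu * q (\<lambda>t. \<Sum>i<n. phi (Y i) t)))) \<in> borel_measurable (PiM {..<n} (\<lambda>_. P))" for n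
    unfolding q_def using measurable_sq_sum[of n] by measurable
  have "(\<integral>\<^sup>+Y. ennreal (exp (mu * q (\<lambda>t. \<Sum>i<Suc n. phi (Y i) t))) \<partial>PiM {..<Suc n} (\<lambda>_. P))
     = (\<integral>\<^sup>+Y. (\<integral>\<^sup>+y. ennreal (exp (mu * q (\<lambda>t. (\<Sum>i<n. phi (Y i) t) + phi y t))) \<partial>P) \<partial>PiM {..<n} (\<lambda>_. P))"
    by (subst nn_integral_PiM_Suc[OF P.prob_space_axioms m]) simp
  also have "\<dots> \<le> (\<integral>\<^sup>+Y. ennreal (exp (mu * q (\<lambda>t. \<Sum>i<n. phi (Y i) t))) * ennreal (exp ?k) \<partial>PiM {..<n} (\<lambda>_. P))"
  proof (rule nn_integral_mono)
    fix Y assume Y: "Y \<in> space (PiM {..<n} (\<lambda>_. P))"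
    have ms: "(\<lambda>t. \<Sum>i<n. phi (Y i) t) \<in> borel_measurable N"
      using Y by (intro borel_measurable_sum measurable_section) (auto simp: space_PiM)
    have "cmod (\<Sum>i<n. phi (Y i) t) \<le> real n * D" for t
      using sum_norm_bound[of "{..<n}" "\<lambda>i. phi (Y i) t" D] bounded by simp
    from exp_q_step[OF ms this]
    show "(\<integral>\<^sup>+y. ennreal (exp (mu * q (\<lambda>t. (\<Sum>i<n. phi (Y i) t) + phi y t))) \<partial>P)
      \<le> ennreal (exp (mu * q (\<lambda>t. \<Sum>i<n. phi (Y i) t))) * ennreal (exp ?k)"
      by (simp add: exp_add ennreal_mult)
  qed
  also have "\<dots> \<le> ennreal (exp (mu * L + real n * ?k)) * ennreal (exp ?k)"
    by (subst nn_integral_multc[OF m]) (intro mult_right_mono Suc.IH zero_le)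
  also have "\<dots> = ennreal (exp (mu * L + real (Suc n) * ?k))"
    by (simp add: ennreal_mult[symmetric] distrib_right flip: exp_add)
  finally show ?case .
qed

text \<open>\<open>square_diff_le_exp\<close> applied to \<open>sqrt (sq s) \<le> q s\<close>
  reduces the expected excess to the exponential moment. The condition on \<open>real n * a\<close>
  bounds the accumulated drift \<open>3/4 * mu * n * a / L\<close> by \<open>mu * L\<close>, so
  \<open>L\<close> should be of the order of the typical norm of the sum.\<close>

lemma tail_bound:
  assumes na: "real n * a \<le> L\<^sup>2" and b: "0 \<le> b"
  shows "(\<integral>\<^sup>+Y. ennreal (sq (\<lambda>t. \<Sum>i<n. phi (Y i) t) - b\<^sup>2) \<partial>PiM {..<n} (\<lambda>_. P))
    \<le> ennreal ((2 / mu\<^sup>2 + 2 * b / mu) * exp (2 * mu * L + 2 * real n * mu\<^sup>2 * v - mu * b))"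
proof -
  let ?c = "(2 / mu\<^sup>2 + 2 * b / mu) * exp (- mu * b)"
  have c: "0 \<le> ?c" using mu b by simp
  have m: "(\<lambda>Y. ennreal (exp (mu * q (\<lambda>t. \<Sum>i<n. phi (Y i) t)))) \<in> borel_measurable (PiM {..<n} (\<lambda>_. P))"
    unfolding q_def using measurable_sq_sum[of n] by measurable
  have "(\<integral>\<^sup>+Y. ennreal (sq (\<lambda>t. \<Sum>i<n. phi (Y i) t) - b\<^sup>2) \<partial>PiM {..<n} (\<lambda>_. P))
     \<le> (\<integral>\<^sup>+Y. ennreal ?c * ennreal (exp (mu * q (\<lambda>t. \<Sum>i<n. phi (Y i) t))) \<partial>PiM {..<n} (\<lambda>_. P))"
  proof (rule nn_integral_mono)
    fix Y
    let ?s = "\<lambda>t. \<Sum>i<n. phi (Y i) t"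
    have "sq ?s - b\<^sup>2 = (sqrt (sq ?s))\<^sup>2 - b\<^sup>2" using sq_nonneg by simp
    also have "\<dots> \<le> (2 / mu\<^sup>2 + 2 * b / mu) * exp (mu * (sqrt (sq ?s) - b))"
      by (rule square_diff_le_exp) (use sq_nonneg b mu in auto)
    also have "\<dots> \<le> (2 / mu\<^sup>2 + 2 * b / mu) * exp (mu * (q ?s - b))"
      using q_ge(2)[of ?s] mu b by (intro mult_left_mono) auto
    also have "\<dots> = ?c * exp (mu * q ?s)"
      by (simp add: right_diff_distrib exp_diff exp_minus field_simps)
    finally show "ennreal (sq ?s - b\<^sup>2) \<le> ennreal ?c * ennreal (exp (mu * q ?s))"
      using c by (simp add: ennreal_mult[symmetric] ennreal_leI)
  qed
  also have "\<dots> \<le> ennreal ?c * ennreal (exp (mu * L + real n * (3 / 4 * mu * a / L + 2 * mu\<^sup>2 * v)))"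
    by (subst nn_integral_cmult[OF m]) (intro mult_left_mono exp_q_sum zero_le)
  also have "\<dots> \<le> ennreal ?c * ennreal (exp (2 * mu * L + 2 * real n * mu\<^sup>2 * v))"
  proof (intro mult_left_mono ennreal_leI)
    have "real n * a / L \<le> L" using na L by (simp add: power2_eq_square divide_le_eq)
    hence "3 / 4 * mu * (real n * a / L) \<le> 3 / 4 * mu * L" using mu by (intro mult_left_mono) auto
    also have "\<dots> \<le> mu * L" using mu L by simp
    finally show "exp (mu * L + real n * (3 / 4 * mu * a / L + 2 * mu\<^sup>2 * v)) \<le> exp (2 * mu * L + 2 * real n * mu\<^sup>2 * v)"
      by (simp add: algebra_simps)
  qed simp
  also have "\<dots> = ennreal ((2 / mu\<^sup>2 + 2 * b / mu) * exp (2 * mu * L + 2 * real n * mu\<^sup>2 * v - mu * b))"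
    using c by (simp add: ennreal_mult[symmetric] exp_diff exp_minus field_simps)
  finally show ?thesis .
qed

end

end

section \<open>The ridge multiplier\<close>

lemma nn_integral_powr_tail:
  assumes p: "1 < p"
  shows "(\<integral>\<^sup>+t. ennreal (t powr - p) * indicator {1..} t \<partial>lborel) = ennreal (1 / (p - 1))"
proof -
  have "(\<integral>\<^sup>+t. ennreal (t powr - p) * indicator {1..} t \<partial>lborel) = ennreal (0 - 1 powr (1 - p) / (1 - p))"
  proof (rule nn_integral_FTC_atLeast[where F = "\<lambda>t. t powr (1 - p) / (1 - p)"])
    show "((\<lambda>t. t powr (1 - p) / (1 - p)) has_real_derivative t powr - p) (at t)" if "1 \<le> t" for t
    proof -
      have "((\<lambda>t. t powr (1 - p) / (1 - p)) has_real_derivative ((1 - p) * t powr (1 - p - 1)) / (1 - p)) (at t)"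
        using that by (intro DERIV_cdivide has_real_derivative_powr) auto
      thus ?thesis using p by simp
    qed
    have "((\<lambda>t::real. t powr (1 - p)) \<longlongrightarrow> 0) at_top"
      using p by (intro tendsto_neg_powr filterlim_ident) auto
    from tendsto_divide[OF this tendsto_const[of "1 - p"]] p
    show "((\<lambda>t. t powr (1 - p) / (1 - p)) \<longlongrightarrow> 0) at_top" by simp
  qed auto
  also have "0 - 1 powr (1 - p) / (1 - p) = 1 / (p - 1)" using p by (simp add: field_simps)
  finally show ?thesis .
qed

lemma integrable_bracket_powr:
  assumes p: "1 < p"
  shows "integrable lborel (\<lambda>t::real. (1 + t\<^sup>2) powr (- p / 2))"
proof (rule integrableI_bounded)
  let ?j = "\<lambda>t::real. ennreal (t powr - p) * indicator {1..} t"
  have bd: "(1 + t\<^sup>2) powr (- p / 2) \<le> t powr - p" if "1 \<le> t" for t :: real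
  proof -
    have "(1 + t\<^sup>2) powr (- p / 2) \<le> (t\<^sup>2) powr (- p / 2)" using p that by (intro powr_mono2') auto
    also have "\<dots> = (t powr 2) powr (- p / 2)" using that by (simp add: powr_numeral)
    also have "\<dots> = t powr - p" by (simp add: powr_powr)
    finally show ?thesis .
  qed
  have "(\<integral>\<^sup>+t. ennreal (norm ((1 + t\<^sup>2) powr (- p / 2))) \<partial>lborel)
      \<le> (\<integral>\<^sup>+t. indicator {-1..1} t + ?j t + ?j (- t) \<partial>lborel)"
  proof (rule nn_integral_mono)
    fix t :: real
    consider "\<bar>t\<bar> \<le> 1" | "1 \<le> t" | "1 \<le> - t" by linarith
    thus "ennreal (norm ((1 + t\<^sup>2) powr (- p / 2))) \<le> indicator {-1..1} t + ?j t + ?j (- t)"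
    proof cases
      case 1
      have "(1 + t\<^sup>2) powr (- p / 2) \<le> (1 + t\<^sup>2) powr 0" using p by (intro powr_mono) auto
      hence "(1 + t\<^sup>2) powr (- p / 2) \<le> 1" by (simp add: add_nonneg_eq_0_iff)
      hence "ennreal (norm ((1 + t\<^sup>2) powr (- p / 2))) \<le> ennreal 1" by (intro ennreal_leI) simp
      also have "\<dots> \<le> indicator {-1..1} t + ?j t + ?j (- t)"
        using 1 by (simp add: abs_le_iff add_increasing2 add.assoc)
      finally show ?thesis .
    next
      case 2
      hence "ennreal (norm ((1 + t\<^sup>2) powr (- p / 2))) \<le> ?j t" using bd[OF 2] by (simp add: ennreal_leI)
      also have "\<dots> \<le> indicator {-1..1} t + ?j t + ?j (- t)" by (simp add: add_increasing add_increasing2)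
      finally show ?thesis .
    next
      case 3
      hence "ennreal (norm ((1 + t\<^sup>2) powr (- p / 2))) \<le> ?j (- t)" using bd[OF 3] by (simp add: ennreal_leI)
      also have "\<dots> \<le> indicator {-1..1} t + ?j t + ?j (- t)" by (simp add: add_increasing)
      finally show ?thesis .
    qed
  qed
  also have "\<dots> = 2 + ennreal (1 / (p - 1)) + (\<integral>\<^sup>+t. ?j (- t) \<partial>lborel)"
    by (simp add: nn_integral_add nn_integral_powr_tail[OF p])
  also have "(\<integral>\<^sup>+t. ?j (- t) \<partial>lborel) = (\<integral>\<^sup>+t. ?j t \<partial>lborel)"
    by (subst (2) nn_integral_real_affine[of _ "-1" 0]) auto
  finally show "(\<integral>\<^sup>+t. ennreal (norm ((1 + t\<^sup>2) powr (- p / 2))) \<partial>lborel) < \<infinity>"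
    unfolding nn_integral_powr_tail[OF p] by (rule le_less_trans) simp
qed simp

section \<open>Pointwise bounds for the multiplier\<close>

text \<open>As \<open>h\<close> is real, reflecting \<open>t\<close> conjugates the kernel. Hence
  the numerator of \<open>ridge\<close> carries the conjugate of the transform of \<open>g\<close>,
  and their product is real and nonnegative.\<close>

lemma mellin_reflect: "mellin c h (- t) = cnj (mellin c h t)"
  unfolding mellin_def Bochner_Integration.integral_cnj[symmetric]
  by (intro Bochner_Integration.integral_cong refl) (simp add: powr_Complex cis_cnj)

lemma borel_measurable_mellin:
  assumes [measurable]: "h \<in> borel_measurable Rplus"
  shows "mellin c h \<in> borel_measurable borel"
proof -
  have "mellin c h = fourier (\<lambda>u. of_real (exp (c * u) * h (exp u)))"
    by (intro ext mellin_eq_fourier) measurable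
  thus ?thesis by simp
qed

locale ridge_multiplier =
  fixes c :: real and g :: "real \<Rightarrow> real" and cg Cg \<gamma> r :: real
  assumes g_density: "pos_density g"
    and const_pos: "0 < cg" "0 < Cg" "0 < \<gamma>"
    and mellin_lower: "\<And>t. cg * (1 + t\<^sup>2) powr (- \<gamma> / 2) \<le> cmod (mellin c g t)"
    and mellin_upper: "\<And>t. cmod (mellin c g t) \<le> Cg * (1 + t\<^sup>2) powr (- \<gamma> / 2)"
    and r_gt: "0 < r" "1 / \<gamma> - 1 < r"
begin

abbreviation G :: "real \<Rightarrow> complex" where "G \<equiv> mellin c g"

abbreviation R :: "nat \<Rightarrow> real \<Rightarrow> complex" where "R k \<equiv> ridge c g r (real k)"

text \<open>The positive radial factor of the multiplier: \<open>R k t\<close> is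
  \<open>cnj (G t)\<close> times it. All comparisons between different \<open>k\<close> reduce to
  its monotonicity in \<open>k\<close>.\<close>

definition \<rho> :: "nat \<Rightarrow> real \<Rightarrow> real" where
  "\<rho> k t = cmod (G t) powr r / max (cmod (G t)) (1 / real k) powr (r + 2)"

lemma g_measurable [measurable]: "g \<in> borel_measurable Rplus"
  using g_density by (simp add: pos_density_def)

lemma G_measurable [measurable]: "G \<in> borel_measurable borel"
  by (rule borel_measurable_mellin) measurable

lemma G_pos: "0 < cmod (G t)"
proof -
  have "0 < cg * (1 + t\<^sup>2) powr (- \<gamma> / 2)"
    using const_pos by (intro mult_pos_pos) (auto simp: add_nonneg_eq_0_iff)
  thus ?thesis using mellin_lower[of t] by linarith
qed

lemma max_pos: "0 < max (cmod (G t)) (1 / real k)"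
  using G_pos[of t] by (simp add: less_max_iff_disj)

lemma R_eq: "R k t = cnj (G t) * of_real (\<rho> k t)"
  by (simp add: ridge_def \<rho>_def mellin_reflect)

lemma \<rho>_pos: "0 < \<rho> k t"
proof -
  have "0 < max (cmod (G t)) (1 / real k) powr (r + 2)" using max_pos[of t k] by (simp only: powr_gt_zero)
  thus ?thesis using G_pos[of t] by (simp add: \<rho>_def)
qed

lemma cmod_R: "cmod (R k t) = cmod (G t) * \<rho> k t"
  using \<rho>_pos[of k t] by (simp add: R_eq norm_mult)

lemma R_measurable [measurable]: "R k \<in> borel_measurable borel"
proof -
  have [measurable]: "\<rho> k \<in> borel_measurable borel" unfolding \<rho>_def by measurable
  have "(\<lambda>t. cnj (G t) * of_real (\<rho> k t)) \<in> borel_measurable borel" by measurable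
  thus ?thesis by (simp only: R_eq[symmetric])
qed

lemma \<rho>_mono: "1 \<le> k \<Longrightarrow> k \<le> k' \<Longrightarrow> \<rho> k t \<le> \<rho> k' t"
proof -
  assume k: "1 \<le> k" "k \<le> k'"
  hence "1 / real k' \<le> 1 / real k" by (simp add: frac_le)
  hence "max (cmod (G t)) (1 / real k') \<le> max (cmod (G t)) (1 / real k)" by linarith
  hence "max (cmod (G t)) (1 / real k') powr (r + 2) \<le> max (cmod (G t)) (1 / real k) powr (r + 2)"
    using r_gt max_pos[of t k'] by (intro powr_mono2) auto
  moreover have "0 < max (cmod (G t)) (1 / real k') powr (r + 2)"
    using max_pos[of t k'] by (simp only: powr_gt_zero)
  ultimately show ?thesis unfolding \<rho>_def by (intro divide_left_mono mult_pos_pos) auto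
qed

lemma cmod_R_mono: "1 \<le> k \<Longrightarrow> k \<le> k' \<Longrightarrow> cmod (R k t) \<le> cmod (R k' t)"
  unfolding cmod_R by (intro mult_left_mono \<rho>_mono) auto

text \<open>The multipliers for \<open>k\<close> and \<open>k'\<close> have the same argument, so
  the modulus of the difference is the difference of the moduli.\<close>

lemma cmod_R_diff: "1 \<le> k \<Longrightarrow> k \<le> k' \<Longrightarrow> cmod (R k' t - R k t) \<le> cmod (R k' t)"
proof -
  assume k: "1 \<le> k" "k \<le> k'"
  have "R k' t - R k t = cnj (G t) * of_real (\<rho> k' t - \<rho> k t)" by (simp add: R_eq algebra_simps)
  hence "cmod (R k' t - R k t) = cmod (G t) * (\<rho> k' t - \<rho> k t)"
    using \<rho>_mono[OF k, of t] by (simp add: norm_mult del: of_real_diff)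
  also have "\<dots> \<le> cmod (G t) * \<rho> k' t" using \<rho>_pos[of k t] by (intro mult_left_mono) auto
  finally show ?thesis by (simp add: cmod_R)
qed

lemma cmod_G_powr: "cmod (G t) * cmod (G t) powr a = cmod (G t) powr (a + 1)"
  using G_pos[of t] by (simp add: powr_add)

text \<open>The numerator \<open>cmod (G t) powr (r + 1)\<close> is at most the same power of the
  maximum in the denominator, which leaves the reciprocal of that maximum.\<close>

lemma cmod_R_le: "1 \<le> k \<Longrightarrow> cmod (R k t) \<le> real k"
proof -
  assume k: "1 \<le> k"
  let ?m = "max (cmod (G t)) (1 / real k)"
  have mp: "0 < ?m powr (r + 2)" using max_pos[of t k] by (simp only: powr_gt_zero)
  have "cmod (R k t) = cmod (G t) powr (r + 1) / ?m powr (r + 2)"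
    by (simp add: cmod_R \<rho>_def cmod_G_powr)
  also have "\<dots> \<le> ?m powr (r + 1) / ?m powr (r + 2)"
    using r_gt mp by (intro divide_right_mono powr_mono2) auto
  also have "\<dots> = ?m powr (- 1)" by (simp flip: powr_diff)
  also have "\<dots> \<le> (1 / real k) powr (- 1)"
    using k by (intro powr_mono2') auto
  also have "\<dots> = real k" using k by (simp add: powr_minus_divide)
  finally show ?thesis .
qed

lemma G_R: "G t * R k t = of_real ((cmod (G t))\<^sup>2 * \<rho> k t)"
  by (simp add: R_eq mult.assoc[symmetric] flip: complex_norm_square)

lemma G_R_eq: "(cmod (G t))\<^sup>2 * \<rho> k t = (cmod (G t) / max (cmod (G t)) (1 / real k)) powr (r + 2)"
proof -
  have "(cmod (G t))\<^sup>2 * cmod (G t) powr r = cmod (G t) powr (r + 2)"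
    using G_pos[of t] by (simp add: powr_add powr_numeral)
  thus ?thesis by (simp add: \<rho>_def powr_divide)
qed

lemma G_R_bounds:
  shows "0 \<le> (cmod (G t))\<^sup>2 * \<rho> k t" "(cmod (G t))\<^sup>2 * \<rho> k t \<le> 1"
    and "t \<notin> Gset c g (real k) \<Longrightarrow> (cmod (G t))\<^sup>2 * \<rho> k t = 1"
proof -
  show "0 \<le> (cmod (G t))\<^sup>2 * \<rho> k t" using \<rho>_pos[of k t] by simp
  show "(cmod (G t))\<^sup>2 * \<rho> k t \<le> 1"
    unfolding G_R_eq using max_pos[of t k] r_gt by (intro powr_le1) auto
  assume "t \<notin> Gset c g (real k)"
  hence "max (cmod (G t)) (1 / real k) = cmod (G t)" by (auto simp: Gset_def)
  thus "(cmod (G t))\<^sup>2 * \<rho> k t = 1" unfolding G_R_eq using G_pos[of t] by simp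
qed

lemma cmod_G_R_minus_1: "cmod (G t * R k t - 1) \<le> indicator (Gset c g (real k)) t"
proof -
  have "G t * R k t - 1 = of_real ((cmod (G t))\<^sup>2 * \<rho> k t - 1)" by (simp add: G_R)
  hence "cmod (G t * R k t - 1) = 1 - (cmod (G t))\<^sup>2 * \<rho> k t"
    using G_R_bounds(2)[of t k] by (simp only: norm_of_real)
  thus ?thesis using G_R_bounds[of t k] by (auto simp: indicator_def)
qed

text \<open>Both products lie in \<open>[0, 1]\<close> and increase with the index. Off
  \<open>Gset\<close> for the smaller index \<open>k\<close> that product is already 1, which forces
  the other one to be 1 as well.\<close>

lemma cmod_G_R_diff:
  assumes k: "1 \<le> k" "k \<le> k'"
  shows "cmod (G t * (R k' t - R k t)) \<le> indicator (Gset c g (real k)) t"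
proof -
  have "G t * (R k' t - R k t) = of_real ((cmod (G t))\<^sup>2 * \<rho> k' t - (cmod (G t))\<^sup>2 * \<rho> k t)"
    by (simp add: right_diff_distrib G_R)
  moreover have le: "(cmod (G t))\<^sup>2 * \<rho> k t \<le> (cmod (G t))\<^sup>2 * \<rho> k' t"
    by (intro mult_left_mono \<rho>_mono k) auto
  ultimately have "cmod (G t * (R k' t - R k t)) = (cmod (G t))\<^sup>2 * \<rho> k' t - (cmod (G t))\<^sup>2 * \<rho> k t"
    by (simp only: norm_of_real)
  thus ?thesis using le G_R_bounds(2)[of t k'] G_R_bounds(1,3)[of t k] by (auto simp: indicator_def)
qed

text \<open>The maximum in the denominator is at least \<open>1 / k\<close>, so the multiplier
  decays like \<open>cmod (G t) powr (r + 1)\<close>, that is like \<open>\<bar>t\<bar>\<close> to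
  the power \<open>- \<gamma> * (r + 1)\<close>. Integrability is the condition
  \<open>\<gamma> * (r + 1) > 1\<close>, equivalent to \<open>r > 1 / \<gamma> - 1\<close>.\<close>

lemma R_integrable: "1 \<le> k \<Longrightarrow> integrable lborel (R k)"
proof -
  assume k: "1 \<le> k"
  let ?C = "real k powr (r + 2) * Cg powr (r + 1)"
  have p: "1 < \<gamma> * (r + 1)"
    using r_gt const_pos by (simp add: field_simps)
  show ?thesis
  proof (rule Bochner_Integration.integrable_bound[OF integrable_mult_right[OF integrable_bracket_powr[OF p], of ?C]])
    show "AE t in lborel. cmod (R k t) \<le> norm (?C * (1 + t\<^sup>2) powr (- (\<gamma> * (r + 1)) / 2))"
    proof (rule AE_I2)
      fix t
      have "cmod (R k t) = cmod (G t) powr (r + 1) / max (cmod (G t)) (1 / real k) powr (r + 2)"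
        by (simp add: cmod_R \<rho>_def cmod_G_powr)
      also have "\<dots> \<le> (Cg * (1 + t\<^sup>2) powr (- \<gamma> / 2)) powr (r + 1) / (1 / real k) powr (r + 2)"
        using k r_gt G_pos[of t] mellin_upper[of t] by (intro frac_le powr_mono2) auto
      also have "\<dots> = real k powr (r + 2) * (Cg powr (r + 1) * (1 + t\<^sup>2) powr (- \<gamma> / 2 * (r + 1)))"
        using k const_pos by (simp add: powr_mult powr_powr powr_divide)
      also have "- \<gamma> / 2 * (r + 1) = - (\<gamma> * (r + 1)) / 2" by simp
      finally show "cmod (R k t) \<le> norm (?C * (1 + t\<^sup>2) powr (- (\<gamma> * (r + 1)) / 2))" by simp
    qed
  qed measurable
qed

section \<open>Size of the multiplier and of the set of admissible parameters\<close>

definition ridge_sq :: "nat \<Rightarrow> real" where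
  "ridge_sq k = (LINT t|lborel. (cmod (R k t))\<^sup>2)"

lemma norm2_R: 
  assumes k: "1 \<le> k"
  shows "integrable lborel (\<lambda>t. (cmod (R k t))\<^sup>2)" "norm2 (R k) = ennreal (ridge_sq k)"
proof -
  show i: "integrable lborel (\<lambda>t. (cmod (R k t))\<^sup>2)"
    by (rule Bochner_Integration.integrable_bound[OF integrable_mult_right[OF integrable_norm[OF R_integrable[OF k]], of "real k"]])
      (use cmod_R_le[OF k] in \<open>auto simp: power2_eq_square intro!: mult_right_mono\<close>)
  show "norm2 (R k) = ennreal (ridge_sq k)"
    unfolding norm2_def ridge_sq_def by (rule nn_integral_eq_integral[OF i]) simp
qed

lemma ridge_sq_nonneg: "0 \<le> ridge_sq k"
  unfolding ridge_sq_def by (intro Bochner_Integration.integral_nonneg) simp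

lemma ridge_sq_pos:
  assumes k: "1 \<le> k"
  shows "0 < ridge_sq k"
proof -
  have "norm2 (R k) \<noteq> 0"
  proof
    assume "norm2 (R k) = 0"
    hence "AE t in lborel. ennreal ((cmod (R k t))\<^sup>2) = 0"
      unfolding norm2_def by (subst (asm) nn_integral_0_iff_AE) auto
    moreover have "(cmod (R k t))\<^sup>2 > 0" for t
      unfolding cmod_R using G_pos[of t] \<rho>_pos[of k t] by simp
    ultimately have "AE t in (lborel :: real measure). False"
      by (auto simp: ennreal_eq_0_iff not_le[symmetric] elim!: eventually_mono)
    thus False by (simp add: eventually_False ae_filter_eq_bot_iff)
  qed
  thus ?thesis unfolding norm2_R[OF k] using ridge_sq_nonneg[of k] by (auto simp: less_le)
qed

text \<open>On \<open>[0, T]\<close> with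
  \<open>1 + T\<^sup>2 = (cg * k) powr (2 / \<gamma>)\<close> the lower bound on \<open>G\<close>
  excludes the ridge, so \<open>R k\<close> has modulus \<open>1 / cmod (G t)\<close>. On the upper
  half of this interval the upper bound on \<open>G\<close> makes that modulus of order
  \<open>k\<close>, and the half has length at least half of
  \<open>(cg * k) powr (1 / \<gamma>) - 1\<close>. If \<open>cg * k < 1\<close>, the left side is
  not positive.\<close>

lemma ridge_sq_lower:
  assumes k: "1 \<le> k"
  shows "cg\<^sup>2 / (2 * Cg\<^sup>2 * 4 powr \<gamma>) * (real k)\<^sup>2 * ((cg * real k) powr (1 / \<gamma>) - 1) \<le> ridge_sq k"
proof (cases "1 \<le> cg * real k")
  case True
  define A where "A = (cg * real k) powr (1 / \<gamma>)"
  define T where "T = sqrt (A\<^sup>2 - 1)"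
  have A: "1 \<le> A" unfolding A_def using True const_pos by (intro ge_one_powr_ge_zero) auto
  have T2: "T\<^sup>2 = A\<^sup>2 - 1" unfolding T_def using A by (simp add: power_increasing[of 0 2] one_le_power)
  have T0: "0 \<le> T" unfolding T_def using A by (simp add: one_le_power)
  have TA: "A - 1 \<le> T"
  proof (rule power2_le_imp_le[OF _ T0])
    show "(A - 1)\<^sup>2 \<le> T\<^sup>2" using A unfolding T2 by (simp add: power2_eq_square algebra_simps)
  qed
  have A\<gamma>: "A powr \<gamma> = cg * real k" unfolding A_def using True const_pos by (simp add: powr_powr)
  define w where "w = cg\<^sup>2 / (Cg\<^sup>2 * 4 powr \<gamma>) * (real k)\<^sup>2"
  have lower: "w \<le> (cmod (R k t))\<^sup>2" if t: "t \<in> {T / 2..T}" for t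
  proof -
    have t0: "0 \<le> t" using t T0 by auto
    have "t\<^sup>2 \<le> T\<^sup>2" using t t0 by (intro power_mono) auto
    hence up: "1 + t\<^sup>2 \<le> A\<^sup>2" using T2 by simp
    have "(T / 2)\<^sup>2 \<le> t\<^sup>2" using t T0 by (intro power_mono) auto
    hence lo: "A\<^sup>2 / 4 \<le> 1 + t\<^sup>2" using T2 by (simp add: power_divide)
    have AA: "(A\<^sup>2) powr a = (A powr a)\<^sup>2" for a
      using A by (simp add: power2_eq_square powr_mult)
    have Am: "A powr (\<gamma> / 2) * A powr (\<gamma> / 2) = cg * real k" by (simp flip: powr_add A\<gamma>)
    have "1 / real k = cg * (A\<^sup>2) powr (- \<gamma> / 2)"
      unfolding AA using Am const_pos k A by (simp add: powr_minus power2_eq_square field_simps)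
    also have "\<dots> \<le> cg * (1 + t\<^sup>2) powr (- \<gamma> / 2)"
      using up const_pos by (intro mult_left_mono powr_mono2') (auto simp: add_pos_nonneg)
    also have "\<dots> \<le> cmod (G t)" by (rule mellin_lower)
    finally have "t \<notin> Gset c g (real k)" by (auto simp: Gset_def)
    from G_R_bounds(3)[OF this] have "cmod (R k t) = 1 / cmod (G t)"
      using G_pos[of t] unfolding cmod_R by (simp add: field_simps power2_eq_square)
    also have "\<dots> \<ge> 1 / (Cg * (A\<^sup>2 / 4) powr (- \<gamma> / 2))"
    proof (rule divide_left_mono)
      have "cmod (G t) \<le> Cg * (1 + t\<^sup>2) powr (- \<gamma> / 2)" by (rule mellin_upper)
      also have "\<dots> \<le> Cg * (A\<^sup>2 / 4) powr (- \<gamma> / 2)"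
        using lo const_pos A by (intro mult_left_mono powr_mono2') auto
      finally show "cmod (G t) \<le> Cg * (A\<^sup>2 / 4) powr (- \<gamma> / 2)" .
    qed (use G_pos[of t] const_pos A in \<open>auto intro!: mult_pos_pos\<close>)
    finally have "1 / (Cg * (A\<^sup>2 / 4) powr (- \<gamma> / 2)) \<le> cmod (R k t)" .
    hence "(1 / (Cg * (A\<^sup>2 / 4) powr (- \<gamma> / 2)))\<^sup>2 \<le> (cmod (R k t))\<^sup>2"
      using const_pos by (intro power_mono) auto
    moreover have "(1 / (Cg * (A\<^sup>2 / 4) powr (- \<gamma> / 2)))\<^sup>2 = w"
    proof -
      have "(A\<^sup>2 / 4) powr (- \<gamma> / 2) = inverse ((A powr (\<gamma> / 2))\<^sup>2 / 4 powr (\<gamma> / 2))"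
        using A by (simp add: powr_divide AA powr_minus field_simps)
      also have "\<dots> = 4 powr (\<gamma> / 2) / (cg * real k)"
        using Am by (simp add: power2_eq_square)
      finally have "1 / (Cg * (A\<^sup>2 / 4) powr (- \<gamma> / 2)) = cg * real k / (Cg * 4 powr (\<gamma> / 2))"
        by simp
      moreover have "(4 powr (\<gamma> / 2))\<^sup>2 = (4::real) powr \<gamma>"
        unfolding power2_eq_square powr_add[symmetric] by simp
      ultimately show ?thesis by (simp add: w_def power_divide power_mult_distrib)
    qed
    ultimately show ?thesis by simp
  qed
  have w0: "0 \<le> w" by (simp add: w_def)
  have "ennreal (w * (T / 2)) = (\<integral>\<^sup>+t. ennreal w * indicator {T / 2..T} t \<partial>lborel)"
    using T0 w0 by (subst nn_integral_cmult_indicator) (simp_all add: ennreal_mult[symmetric])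
  also have "\<dots> \<le> norm2 (R k)"
    unfolding norm2_def by (intro nn_integral_mono) (auto simp: indicator_def intro: ennreal_leI lower)
  finally have "w * (T / 2) \<le> ridge_sq k" unfolding norm2_R[OF k] using ridge_sq_nonneg by simp
  moreover have "w * ((A - 1) / 2) \<le> w * (T / 2)" using TA w0 by (intro mult_left_mono) auto
  ultimately show ?thesis unfolding A_def w_def by (simp add: mult_ac)
next
  case False
  have "(cg * real k) powr (1 / \<gamma>) \<le> 1" using False const_pos by (intro powr_le1) auto
  hence "cg\<^sup>2 / (2 * Cg\<^sup>2 * 4 powr \<gamma>) * (real k)\<^sup>2 * ((cg * real k) powr (1 / \<gamma>) - 1) \<le> 0"
    by (intro mult_nonneg_nonpos) auto
  thus ?thesis using ridge_sq_nonneg[of k] by linarith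
qed

lemma Kset_iff: "k \<in> Kset c g r n \<longleftrightarrow> 1 \<le> k \<and> ridge_sq k \<le> real n"
  using norm2_R(2)[of k] ridge_sq_nonneg[of k]
  by (auto simp: Kset_def ennreal_of_nat_eq_real_of_nat)

text \<open>Beyond a fixed index \<open>ridge_sq k\<close> is at least a multiple of the square of
  \<open>k\<close>, hence of \<open>k\<close>. The linear bound is crude but sufficient, because it
  multiplies only the term \<open>tail_rate\<close>.\<close>

lemma Kset_card:
  obtains CK where "0 \<le> CK" "\<And>n. 1 \<le> n \<Longrightarrow> finite (Kset c g r n) \<and> real (card (Kset c g r n)) \<le> CK * real n"
proof -
  define c1 where "c1 = cg\<^sup>2 / (2 * Cg\<^sup>2 * 4 powr \<gamma>)"
  have c1: "0 < c1" using const_pos by (simp add: c1_def)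
  \<comment> \<open>Beyond \<open>k0\<close> the power \<open>(cg * k) powr (1 / \<gamma>)\<close>
    is at least 2, so the last factor in \<open>ridge_sq_lower\<close> is at least 1.\<close>
  define k0 where "k0 = 2 powr \<gamma> / cg"
  have k0: "0 < k0" using const_pos by (simp add: k0_def)
  have bd: "real k \<le> k0 + real n / c1" if "k \<in> Kset c g r n" for k n
  proof (cases "real k \<le> k0")
    case True
    thus ?thesis using c1 by (simp add: add_increasing2)
  next
    case False
    have k: "1 \<le> k" "ridge_sq k \<le> real n" using that by (auto simp: Kset_iff)
    have "2 powr \<gamma> \<le> cg * real k" using False const_pos by (simp add: k0_def field_simps)
    hence "(2 powr \<gamma>) powr (1 / \<gamma>) \<le> (cg * real k) powr (1 / \<gamma>)"
      using const_pos by (intro powr_mono2) auto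
    hence "2 \<le> (cg * real k) powr (1 / \<gamma>)" using const_pos by (simp add: powr_powr)
    hence "c1 * (real k)\<^sup>2 * 1 \<le> c1 * (real k)\<^sup>2 * ((cg * real k) powr (1 / \<gamma>) - 1)"
      using c1 by (intro mult_left_mono) auto
    also have "\<dots> \<le> real n" using ridge_sq_lower[OF k(1)] k(2) by (simp add: c1_def)
    finally have "c1 * (real k)\<^sup>2 \<le> real n" by simp
    moreover have "c1 * real k \<le> c1 * (real k)\<^sup>2" using c1 k by (simp add: power2_eq_square)
    ultimately have "c1 * real k \<le> real n" by (rule order_trans[rotated])
    hence "real k \<le> real n / c1" using c1 by (simp add: field_simps)
    thus ?thesis using k0 by simp
  qed
  show thesis
  proof (rule that[of "k0 + 1 / c1"])
    fix n :: nat assume n: "1 \<le> n"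
    let ?b = "k0 + real n / c1"
    have b0: "0 \<le> ?b" using k0 c1 by simp
    have sub: "Kset c g r n \<subseteq> {1..nat \<lfloor>?b\<rfloor>}"
      using bd b0 by (auto simp: Kset_iff le_nat_floor)
    have "card (Kset c g r n) \<le> nat \<lfloor>?b\<rfloor>" using card_mono[OF _ sub] by simp
    hence "real (card (Kset c g r n)) \<le> ?b" using b0 by linarith
    also have "\<dots> \<le> (k0 + 1 / c1) * real n"
      using n k0 c1 by (simp add: distrib_right mult_le_cancel_left1)
    finally show "finite (Kset c g r n) \<and> real (card (Kset c g r n)) \<le> (k0 + 1 / c1) * real n"
      using finite_subset[OF sub] by simp
  qed (use k0 c1 in simp)
qed

end

section \<open>The law of the observations\<close>

lemma pos_density_measurable: "pos_density h \<Longrightarrow> h \<in> borel_measurable Rplus"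
  by (simp add: pos_density_def)

lemma prob_space_pos_density:
  assumes "pos_density h"
  shows "prob_space (density Rplus (\<lambda>x. ennreal (h x)))"
proof (rule prob_spaceI)
  have [measurable]: "h \<in> borel_measurable Rplus" using assms by (simp add: pos_density_def)
  have "emeasure (density Rplus (\<lambda>x. ennreal (h x))) (space Rplus) = (\<integral>\<^sup>+x. ennreal (h x) * indicator (space Rplus) x \<partial>Rplus)"
    by (intro emeasure_density sets.top) measurable
  also have "\<dots> = (\<integral>\<^sup>+x. ennreal (h x) \<partial>Rplus)" by (intro nn_integral_cong) auto
  finally show "emeasure (density Rplus (\<lambda>x. ennreal (h x))) (space (density Rplus (\<lambda>x. ennreal (h x)))) = 1"
    using assms by (simp add: pos_density_def)
qed

lemma measurable_mult_Rplus: "(\<lambda>(x, u). x * u) \<in> Rplus \<Otimes>\<^sub>M Rplus \<rightarrow>\<^sub>M Rplus"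
proof -
  have id: "(\<lambda>x. x) \<in> borel_measurable Rplus" by (rule borel_measurable_imp_Rplus) simp
  have "(\<lambda>p. fst p * snd p) \<in> borel_measurable (Rplus \<Otimes>\<^sub>M Rplus)"
    by (intro borel_measurable_times measurable_compose[OF measurable_fst id] measurable_compose[OF measurable_snd id])
  thus ?thesis
    unfolding measurable_cong_sets[OF refl sets_Rplus] split_beta
    by (intro measurable_restrict_space2) (auto simp: space_pair_measure)
qed

definition mom :: "(real \<Rightarrow> real) \<Rightarrow> real \<Rightarrow> ennreal" where
  "mom h p = (\<integral>\<^sup>+x. ennreal (h x) * ennreal (x powr p) \<partial>Rplus)"

lemma powr_measurable_Rplus [measurable]: "(\<lambda>x. x powr p) \<in> borel_measurable Rplus"
  by (rule borel_measurable_imp_Rplus) measurable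

lemma mom_nonzero:
  assumes "pos_density h"
  shows "mom h p \<noteq> 0"
proof
  assume 0: "mom h p = 0"
  have [measurable]: "h \<in> borel_measurable Rplus" using assms by (simp add: pos_density_def)
  have "AE x in Rplus. ennreal (h x) * ennreal (x powr p) = 0"
    using 0 unfolding mom_def by (subst (asm) nn_integral_0_iff_AE) auto
  moreover have "AE x in Rplus. 0 < x" by (intro AE_I2) simp
  ultimately have "AE x in Rplus. ennreal (h x) = 0"
    by eventually_elim (auto simp: ennreal_eq_0_iff)
  hence "(\<integral>\<^sup>+x. ennreal (h x) \<partial>Rplus) = 0" by (subst nn_integral_0_iff_AE) auto
  thus False using assms by (simp add: pos_density_def)
qed

lemma powr_le_1_plus:
  fixes x p :: real
  assumes "0 < x" "0 \<le> j" "j \<le> 5"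
  shows "x powr (j * p) \<le> 1 + x powr (5 * p)"
proof (cases "x powr p \<le> 1")
  case True
  have "x powr (j * p) = (x powr p) powr j" by (simp add: powr_powr mult.commute)
  also have "\<dots> \<le> 1" using True assms by (intro powr_le1) auto
  finally show ?thesis by (simp add: add_increasing2)
next
  case False
  have "x powr (j * p) = (x powr p) powr j" by (simp add: powr_powr mult.commute)
  also have "\<dots> \<le> (x powr p) powr 5" using False assms by (intro powr_mono) auto
  also have "\<dots> = x powr (5 * p)" by (simp add: powr_powr mult.commute)
  finally show ?thesis by simp
qed

lemma mom_finite:
  assumes "pos_density h" "mom h (5 * p) < \<infinity>" "0 \<le> j" "j \<le> 5"
  shows "mom h (j * p) < \<infinity>"
proof -
  have [measurable]: "h \<in> borel_measurable Rplus" using assms by (simp add: pos_density_def)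
  have "mom h (j * p) \<le> (\<integral>\<^sup>+x. ennreal (h x) + ennreal (h x) * ennreal (x powr (5 * p)) \<partial>Rplus)"
    unfolding mom_def
  proof (rule nn_integral_mono)
    fix x assume "x \<in> space Rplus"
    hence "ennreal (x powr (j * p)) \<le> ennreal (1 + x powr (5 * p))"
      using assms by (intro ennreal_leI powr_le_1_plus) auto
    hence "ennreal (h x) * ennreal (x powr (j * p)) \<le> ennreal (h x) * (1 + ennreal (x powr (5 * p)))"
      by (intro mult_left_mono) auto
    thus "ennreal (h x) * ennreal (x powr (j * p)) \<le> ennreal (h x) + ennreal (h x) * ennreal (x powr (5 * p))"
      by (simp add: distrib_left)
  qed
  also have "\<dots> = 1 + mom h (5 * p)"
    using assms by (simp add: nn_integral_add mom_def pos_density_def)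
  finally show ?thesis using assms(2) by (auto intro: le_less_trans)
qed

context
  fixes f g :: "real \<Rightarrow> real"
  assumes f: "pos_density f" and g: "pos_density g"
begin

lemma mult_measurable_density:
  "(\<lambda>(x, u). x * u) \<in> density Rplus (\<lambda>x. ennreal (f x)) \<Otimes>\<^sub>M density Rplus (\<lambda>x. ennreal (g x)) \<rightarrow>\<^sub>M Rplus"
  using measurable_mult_Rplus by (simp cong: measurable_cong_sets sets_pair_measure_cong)

lemma sets_law_Y: "sets (law_Y f g) = sets Rplus" and space_law_Y: "space (law_Y f g) = {0<..}"
  by (simp_all add: law_Y_def)

lemma prob_space_law_Y: "prob_space (law_Y f g)"
proof -
  interpret pair_prob_space "density Rplus (\<lambda>x. ennreal (f x))" "density Rplus (\<lambda>x. ennreal (g x))"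
    by (simp add: pair_prob_space_def pair_sigma_finite_def prob_space_pos_density prob_space_imp_sigma_finite f g)
  show ?thesis unfolding law_Y_eq_distr[OF f g] by (rule prob_space_distr[OF mult_measurable_density])
qed

lemma nn_integral_law_Y:
  assumes h: "h \<in> borel_measurable Rplus"
  shows "(\<integral>\<^sup>+y. h y \<partial>law_Y f g) = (\<integral>\<^sup>+x. ennreal (f x) * (\<integral>\<^sup>+u. ennreal (g u) * h (x * u) \<partial>Rplus) \<partial>Rplus)"
proof -
  note [measurable] = f[THEN pos_density_measurable] g[THEN pos_density_measurable]
  let ?F = "density Rplus (\<lambda>x. ennreal (f x))" and ?G = "density Rplus (\<lambda>x. ennreal (g x))"
  interpret G: prob_space ?G by (rule prob_space_pos_density[OF g])
  have hm: "(\<lambda>p. h (fst p * snd p)) \<in> borel_measurable (Rplus \<Otimes>\<^sub>M Rplus)"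
    using measurable_compose[OF measurable_mult_Rplus h] by (simp add: split_beta)
  have hm': "(\<lambda>p. h (fst p * snd p)) \<in> borel_measurable (?F \<Otimes>\<^sub>M ?G)"
    using hm by (simp cong: measurable_cong_sets sets_pair_measure_cong)
  interpret R: sigma_finite_measure Rplus by (rule sigma_finite_Rplus)
  have "(\<integral>\<^sup>+y. h y \<partial>law_Y f g) = (\<integral>\<^sup>+p. h (fst p * snd p) \<partial>(?F \<Otimes>\<^sub>M ?G))"
    unfolding law_Y_eq_distr[OF f g]
    by (subst nn_integral_distr[OF mult_measurable_density]) (auto simp: h split_beta)
  also have "\<dots> = (\<integral>\<^sup>+x. (\<integral>\<^sup>+u. h (x * u) \<partial>?G) \<partial>?F)"
    using G.nn_integral_fst[OF hm'] by simp
  also have "\<dots> = (\<integral>\<^sup>+x. (\<integral>\<^sup>+u. ennreal (g u) * h (x * u) \<partial>Rplus) \<partial>?F)"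
  proof (intro nn_integral_cong nn_integral_density)
    fix x assume "x \<in> space ?F"
    thus "(\<lambda>u. h (x * u)) \<in> borel_measurable Rplus"
      using measurable_compose[OF measurable_Pair1' hm, of x] by simp
  qed simp
  also have "\<dots> = (\<integral>\<^sup>+x. ennreal (f x) * (\<integral>\<^sup>+u. ennreal (g u) * h (x * u) \<partial>Rplus) \<partial>Rplus)"
  proof (rule nn_integral_density)
    have "(\<lambda>p. ennreal (g (snd p)) * h (fst p * snd p)) \<in> borel_measurable (Rplus \<Otimes>\<^sub>M Rplus)"
      using hm by measurable
    from R.borel_measurable_nn_integral_fst[OF this]
    show "(\<lambda>x. \<integral>\<^sup>+u. ennreal (g u) * h (x * u) \<partial>Rplus) \<in> borel_measurable Rplus" by simp
  qed simp
  finally show ?thesis .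
qed

lemma moment_Y_eq: "moment_Y f g p = mom f p * mom g p"
proof -
  note [measurable] = f[THEN pos_density_measurable] g[THEN pos_density_measurable]
  have "moment_Y f g p = (\<integral>\<^sup>+x. ennreal (f x) * (\<integral>\<^sup>+u. ennreal (g u) * ennreal ((x * u) powr p) \<partial>Rplus) \<partial>Rplus)"
    unfolding moment_Y_def by (rule nn_integral_law_Y) measurable
  also have "\<dots> = (\<integral>\<^sup>+x. ennreal (f x) * ennreal (x powr p) * mom g p \<partial>Rplus)"
  proof (rule nn_integral_cong)
    fix x assume "x \<in> space Rplus"
    hence "(\<integral>\<^sup>+u. ennreal (g u) * ennreal ((x * u) powr p) \<partial>Rplus)
       = (\<integral>\<^sup>+u. ennreal (x powr p) * (ennreal (g u) * ennreal (u powr p)) \<partial>Rplus)"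
      by (intro nn_integral_cong) (simp add: powr_mult ennreal_mult mult_ac)
    also have "\<dots> = ennreal (x powr p) * mom g p"
      unfolding mom_def by (rule nn_integral_cmult) measurable
    finally show "ennreal (f x) * (\<integral>\<^sup>+u. ennreal (g u) * ennreal ((x * u) powr p) \<partial>Rplus)
       = ennreal (f x) * ennreal (x powr p) * mom g p" by (simp add: mult_ac)
  qed
  also have "\<dots> = mom f p * mom g p" unfolding mom_def[of f] by (rule nn_integral_multc) measurable
  finally show ?thesis .
qed

text \<open>The moments of \<open>Y\<close> are products of moments of the two densities, and none
  of these vanishes; so a finite product has finite factors. Lower powers are dominated by 1 plus
  the fifth.\<close>

lemma moments_finite:
  assumes "moment_Y f g (5 * p) < \<infinity>" "0 \<le> j" "j \<le> 5"
  shows "mom f (j * p) < \<infinity>" "mom g (j * p) < \<infinity>" "moment_Y f g (j * p) < \<infinity>"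
proof -
  have "mom f (5 * p) < \<infinity>" "mom g (5 * p) < \<infinity>"
    using assms(1) mom_nonzero[OF f, of "5 * p"] mom_nonzero[OF g, of "5 * p"]
    by (auto simp: moment_Y_eq ennreal_mult_less_top less_top)
  thus "mom f (j * p) < \<infinity>" "mom g (j * p) < \<infinity>"
    using mom_finite[OF f _ assms(2,3)] mom_finite[OF g _ assms(2,3)] by auto
  thus "moment_Y f g (j * p) < \<infinity>" by (simp add: moment_Y_eq ennreal_mult_less_top)
qed

text \<open>This says that \<open>y powr (2 * c - 1)\<close> times the density of \<open>Y\<close>
  is bounded, with the test function \<open>h\<close> integrated against the scale-invariant measure
  \<open>dy / y\<close>. Conditionally on \<open>X = x\<close> the weight splits off
  \<open>x powr (2 * (c - 1))\<close>, and what remains of \<open>g\<close> is at most its weighted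
  supremum.\<close>

lemma weighted_integral_law_Y_le:
  assumes h: "h \<in> borel_measurable Rplus"
  shows "(\<integral>\<^sup>+y. ennreal (y powr (2 * (c - 1))) * h y \<partial>law_Y f g)
    \<le> wsup_norm c g * mom f (2 * (c - 1)) * (\<integral>\<^sup>+y. h y * ennreal (1 / y) \<partial>Rplus)"
proof -
  note [measurable] = f[THEN pos_density_measurable] g[THEN pos_density_measurable]
  let ?I = "\<integral>\<^sup>+y. h y * ennreal (1 / y) \<partial>Rplus"
  have [measurable]: "(\<lambda>y. 1 / y) \<in> borel_measurable Rplus"
    by (rule borel_measurable_imp_Rplus) measurable
  have ae: "AE u in Rplus. ennreal (u powr (2 * c - 1) * \<bar>g u\<bar>) \<le> wsup_norm c g"
    unfolding wsup_norm_def by (rule esssup_AE)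
  have inner: "(\<integral>\<^sup>+u. ennreal (g u) * (ennreal ((x * u) powr (2 * (c - 1))) * h (x * u)) \<partial>Rplus)
      \<le> ennreal (x powr (2 * (c - 1))) * (wsup_norm c g * ?I)" if x: "0 < x" for x
  proof -
    have hx: "(\<lambda>u. h (x * u)) \<in> borel_measurable Rplus"
      using measurable_compose[OF measurable_compose[OF measurable_Pair1'[of x Rplus Rplus] measurable_mult_Rplus] h] x
      by simp
    note [measurable] = hx
    have "(\<integral>\<^sup>+u. ennreal (g u) * (ennreal ((x * u) powr (2 * (c - 1))) * h (x * u)) \<partial>Rplus)
       \<le> (\<integral>\<^sup>+u. ennreal (x powr (2 * (c - 1))) * wsup_norm c g * (h (x * u) * ennreal (1 / u)) \<partial>Rplus)"
    proof (rule nn_integral_mono_AE)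
      have "AE u in Rplus. 0 < u" by (intro AE_I2) simp
      with ae show "AE u in Rplus. ennreal (g u) * (ennreal ((x * u) powr (2 * (c - 1))) * h (x * u))
        \<le> ennreal (x powr (2 * (c - 1))) * wsup_norm c g * (h (x * u) * ennreal (1 / u))"
      proof eventually_elim
        case (elim u)
        have gu: "0 \<le> g u" using g elim(2) by (simp add: pos_density_def)
        have "g u * (x * u) powr (2 * (c - 1)) = x powr (2 * (c - 1)) * (u powr (2 * c - 1) * \<bar>g u\<bar>) * (1 / u)"
        proof -
          have "u powr (2 * (c - 1)) = u powr (2 * c - 1) * (1 / u)"
            using elim(2) powr_diff[of u "2 * c - 1" 1] by (simp add: algebra_simps)
          thus ?thesis using x elim(2) gu by (simp add: powr_mult)
        qed
        hence "ennreal (g u) * ennreal ((x * u) powr (2 * (c - 1)))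
           = ennreal (x powr (2 * (c - 1))) * ennreal (u powr (2 * c - 1) * \<bar>g u\<bar>) * ennreal (1 / u)"
          using gu elim(2) by (simp add: ennreal_mult[symmetric])
        also have "\<dots> \<le> ennreal (x powr (2 * (c - 1))) * wsup_norm c g * ennreal (1 / u)"
          using elim(1) by (intro mult_left_mono mult_right_mono) auto
        finally have "ennreal (g u) * ennreal ((x * u) powr (2 * (c - 1))) * h (x * u)
          \<le> ennreal (x powr (2 * (c - 1))) * wsup_norm c g * ennreal (1 / u) * h (x * u)"
          by (rule mult_right_mono) simp
        thus ?case by (simp add: mult_ac)
      qed
    qed
    also have "\<dots> = ennreal (x powr (2 * (c - 1))) * wsup_norm c g * (\<integral>\<^sup>+u. h (x * u) * ennreal (1 / u) \<partial>Rplus)"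
      by (rule nn_integral_cmult) measurable
    \<comment> \<open>Scale invariance of \<open>du / u\<close> removes the dependence on
      \<open>x\<close>.\<close>
    also have "(\<integral>\<^sup>+u. h (x * u) * ennreal (1 / u) \<partial>Rplus) = ?I"
    proof -
      have "(\<integral>\<^sup>+u. h (x * u) * ennreal (1 / u) \<partial>Rplus) = (\<integral>\<^sup>+y. h (x * (y / x)) * ennreal (1 / (y / x)) * ennreal (1 / x) \<partial>Rplus)"
        by (rule nn_integral_Rplus_scale[OF _ x]) measurable
      also have "\<dots> = ?I"
        using x by (intro nn_integral_cong) (simp add: mult.assoc ennreal_mult[symmetric])
      finally show ?thesis .
    qed
    finally show ?thesis by (simp add: mult_ac)
  qed
  have "(\<integral>\<^sup>+y. ennreal (y powr (2 * (c - 1))) * h y \<partial>law_Y f g)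
     = (\<integral>\<^sup>+x. ennreal (f x) * (\<integral>\<^sup>+u. ennreal (g u) * (ennreal ((x * u) powr (2 * (c - 1))) * h (x * u)) \<partial>Rplus) \<partial>Rplus)"
    using h by (intro nn_integral_law_Y) measurable
  also have "\<dots> \<le> (\<integral>\<^sup>+x. ennreal (f x) * ennreal (x powr (2 * (c - 1))) * (wsup_norm c g * ?I) \<partial>Rplus)"
    using inner by (intro nn_integral_mono) (auto simp: mult.assoc intro!: mult_left_mono)
  also have "\<dots> = mom f (2 * (c - 1)) * (wsup_norm c g * ?I)"
    unfolding mom_def by (rule nn_integral_multc) measurable
  finally show ?thesis by (simp add: mult_ac)
qed

end

text \<open>On the positive half-line \<open>mellin_kernel c y t\<close> is \<open>y\<close> to the power \<open>c - 1 + it\<close>; unlike the complex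
  power, it has modulus \<open>y powr (c - 1)\<close> for every real \<open>y\<close>.\<close>

definition mellin_kernel :: "real \<Rightarrow> real \<Rightarrow> real \<Rightarrow> complex" where
  "mellin_kernel c y t = of_real (y powr (c - 1)) * cis (t * ln y)"

lemma cmod_mellin_kernel [simp]: "cmod (mellin_kernel c y t) = y powr (c - 1)"
  by (simp add: mellin_kernel_def norm_mult)

lemma mellin_kernel_mult:
  "0 < x \<Longrightarrow> 0 < u \<Longrightarrow> mellin_kernel c (x * u) t = mellin_kernel c x t * mellin_kernel c u t"
proof -
  assume "0 < x" "0 < u"
  moreover have "cis (t * ln x + t * ln u) = cis (t * ln x) * cis (t * ln u)" by (rule cis_mult[symmetric])
  ultimately show ?thesis by (simp add: mellin_kernel_def powr_mult ln_mult distrib_left)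
qed

lemma mellin_kernel_measurable [measurable]: "(\<lambda>y. mellin_kernel c y t) \<in> borel_measurable Rplus"
  unfolding mellin_kernel_def by (rule borel_measurable_imp_Rplus) measurable

lemma mellin_eq_expectation:
  assumes h: "pos_density h"
  shows "mellin c h t = (LINT x|density Rplus (\<lambda>x. ennreal (h x)). mellin_kernel c x t)"
proof -
  have [measurable]: "h \<in> borel_measurable Rplus" using h by (simp add: pos_density_def)
  have "(LINT x|density Rplus (\<lambda>x. ennreal (h x)). mellin_kernel c x t) = (LINT x|Rplus. h x *\<^sub>R mellin_kernel c x t)"
    using h by (intro integral_density) (auto simp: pos_density_def)
  also have "\<dots> = mellin c h t"
    unfolding mellin_def
    by (intro Bochner_Integration.integral_cong) (auto simp: mellin_kernel_def powr_Complex scaleR_conv_of_real mult_ac)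
  finally show ?thesis by simp
qed

lemma integrable_mellin_kernel:
  assumes f: "pos_density f" and g: "pos_density g" and fin: "moment_Y f g (c - 1) < \<infinity>"
  shows "integrable (law_Y f g) (\<lambda>y. mellin_kernel c y t)"
proof (rule integrableI_bounded)
  show "(\<lambda>y. mellin_kernel c y t) \<in> borel_measurable (law_Y f g)"
    unfolding measurable_cong_sets[OF sets_law_Y[OF f g] refl] by measurable
  show "(\<integral>\<^sup>+y. ennreal (cmod (mellin_kernel c y t)) \<partial>law_Y f g) < \<infinity>"
    using fin by (simp add: moment_Y_def)
qed

lemma expectation_mellin_kernel:
  assumes f: "pos_density f" and g: "pos_density g" and fin: "moment_Y f g (c - 1) < \<infinity>"
  shows "(LINT y|law_Y f g. mellin_kernel c y t) = mellin c f t * mellin c g t"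
proof -
  let ?F = "density Rplus (\<lambda>x. ennreal (f x))" and ?G = "density Rplus (\<lambda>x. ennreal (g x))"
  interpret pair_prob_space ?F ?G
    by (simp add: pair_prob_space_def pair_sigma_finite_def prob_space_pos_density prob_space_imp_sigma_finite f g)
  note mm = mult_measurable_density[OF f g]
  have i: "integrable (?F \<Otimes>\<^sub>M ?G) (\<lambda>p. mellin_kernel c (fst p * snd p) t)"
    using integrable_mellin_kernel[OF f g fin, of t] unfolding law_Y_eq_distr[OF f g]
    by (subst (asm) integrable_distr_eq[OF mm]) (auto simp: split_beta)
  have "(LINT y|law_Y f g. mellin_kernel c y t) = (LINT p|(?F \<Otimes>\<^sub>M ?G). mellin_kernel c (fst p * snd p) t)"
    unfolding law_Y_eq_distr[OF f g] by (subst integral_distr[OF mm]) (auto simp: split_beta)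
  also have "\<dots> = (LINT x|?F. LINT u|?G. mellin_kernel c (x * u) t)"
    using integral_fst'[OF i] by simp
  also have "\<dots> = (LINT x|?F. mellin_kernel c x t * (LINT u|?G. mellin_kernel c u t))"
  proof (intro Bochner_Integration.integral_cong refl)
    fix x assume "x \<in> space ?F"
    hence "(LINT u|?G. mellin_kernel c (x * u) t) = (LINT u|?G. mellin_kernel c x t * mellin_kernel c u t)"
      by (intro Bochner_Integration.integral_cong) (auto simp: mellin_kernel_mult)
    thus "(LINT u|?G. mellin_kernel c (x * u) t) = mellin_kernel c x t * (LINT u|?G. mellin_kernel c u t)" by simp
  qed
  also have "\<dots> = mellin c f t * mellin c g t"
    by (simp add: mellin_eq_expectation f g)
  finally show ?thesis .
qed

lemma integrable_exp_mult:
  assumes h: "pos_density h" and fin: "mom h (c - 1) < \<infinity>"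
  shows "integrable lborel (\<lambda>u. exp (c * u) * h (exp u))"
proof (rule integrableI_bounded)
  have [measurable]: "h \<in> borel_measurable Rplus" using h by (simp add: pos_density_def)
  show "(\<lambda>u. exp (c * u) * h (exp u)) \<in> borel_measurable lborel" by measurable
  have "mom h (c - 1) = (\<integral>\<^sup>+u. ennreal (h (exp u)) * ennreal (exp u powr (c - 1)) * ennreal (exp u) \<partial>lborel)"
    unfolding mom_def by (rule nn_integral_Rplus_exp) measurable
  also have "\<dots> = (\<integral>\<^sup>+u. ennreal (norm (exp (c * u) * h (exp u))) \<partial>lborel)"
  proof (intro nn_integral_cong)
    fix u
    have "exp u powr (c - 1) * exp u = exp (c * u)"
      by (simp add: exp_mult_powr flip: exp_add) (simp add: algebra_simps)
    moreover have "0 \<le> h (exp u)" using h by (simp add: pos_density_def)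
    ultimately show "ennreal (h (exp u)) * ennreal (exp u powr (c - 1)) * ennreal (exp u) = ennreal (norm (exp (c * u) * h (exp u)))"
      by (simp add: ennreal_mult[symmetric] abs_mult mult_ac)
  qed
  finally show "(\<integral>\<^sup>+u. ennreal (norm (exp (c * u) * h (exp u))) \<partial>lborel) < \<infinity>" using fin by simp
qed

section \<open>Moments of empirical means\<close>

lemma nn_integral_sum_PiM:
  fixes h :: "'a \<Rightarrow> ennreal"
  assumes P: "prob_space P" and h [measurable]: "h \<in> borel_measurable P"
  shows "(\<integral>\<^sup>+Y. (\<Sum>i<n. h (Y i)) \<partial>PiM {..<n} (\<lambda>_. P)) = of_nat n * (\<integral>\<^sup>+y. h y \<partial>P)"
proof (induction n)
  case (Suc n)
  interpret P: prob_space P by fact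
  interpret Q: prob_space "PiM {..<n} (\<lambda>_. P)" by (intro prob_space_PiM P)
  have "(\<integral>\<^sup>+Y. (\<Sum>i<Suc n. h (Y i)) \<partial>PiM {..<Suc n} (\<lambda>_. P))
      = (\<integral>\<^sup>+Y. (\<integral>\<^sup>+y. (\<Sum>i<n. h (Y i)) + h y \<partial>P) \<partial>PiM {..<n} (\<lambda>_. P))"
    by (subst nn_integral_PiM_Suc[OF P]) auto
  also have "\<dots> = (\<integral>\<^sup>+Y. (\<Sum>i<n. h (Y i)) + (\<integral>\<^sup>+y. h y \<partial>P) \<partial>PiM {..<n} (\<lambda>_. P))"
    by (intro nn_integral_cong) (simp add: nn_integral_add P.emeasure_space_1)
  also have "\<dots> = of_nat n * (\<integral>\<^sup>+y. h y \<partial>P) + (\<integral>\<^sup>+y. h y \<partial>P)"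
    by (subst nn_integral_add) (auto simp: Suc.IH Q.emeasure_space_1)
  finally show ?case by (simp add: distrib_right add.commute)
qed simp

lemma nn_integral_variance_le:
  fixes X :: "'a \<Rightarrow> complex"
  assumes P: "prob_space P" and X: "integrable P X"
  shows "(\<integral>\<^sup>+y. ennreal ((cmod (X y - (LINT y|P. X y)))\<^sup>2) \<partial>P) \<le> (\<integral>\<^sup>+y. ennreal ((cmod (X y))\<^sup>2) \<partial>P)"
proof (cases "(\<integral>\<^sup>+y. ennreal ((cmod (X y))\<^sup>2) \<partial>P) < \<infinity>")
  case True
  interpret P: prob_space P by fact
  have [measurable]: "X \<in> borel_measurable P" using X by auto
  define e where "e = (LINT y|P. X y)"
  have sq: "integrable P (\<lambda>y. (cmod (X y))\<^sup>2)" using True by (intro integrableI_bounded) auto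
  have sqe: "integrable P (\<lambda>y. (cmod e)\<^sup>2)" by simp
  have cr: "integrable P (\<lambda>y. X y * cnj e)" using X by simp
  note d = integral_cmod_diff_square[OF sq sqe cr]
  have "(LINT y|P. X y * cnj e) = of_real ((cmod e)\<^sup>2)"
    using X by (simp add: e_def[symmetric] complex_norm_square del: of_real_power)
  hence "Re (LINT y|P. X y * cnj e) = (cmod e)\<^sup>2" by (simp only: Re_complex_of_real)
  hence "(LINT y|P. (cmod (X y - e))\<^sup>2) \<le> (LINT y|P. (cmod (X y))\<^sup>2)"
    unfolding d(2) by (simp add: P.prob_space)
  thus ?thesis
    unfolding e_def[symmetric] using d(1) sq by (simp add: nn_integral_eq_integral ennreal_leI)
qed (simp add: not_less top_unique)

lemma centered_sum_measurable:
  fixes X :: "'a \<Rightarrow> real \<Rightarrow> complex"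
  assumes P: "prob_space P" and X: "(\<lambda>(y, t). X y t) \<in> borel_measurable (P \<Otimes>\<^sub>M lborel)"
    and R [measurable]: "R \<in> borel_measurable borel"
  shows "(\<lambda>(Y, t). (\<Sum>i<n. X (Y i) t - (LINT y|P. X y t)) * R t)
      \<in> borel_measurable (PiM {..<n} (\<lambda>_. P) \<Otimes>\<^sub>M lborel)" (is ?joint)
    and "(\<lambda>Y. norm2 (\<lambda>t. (\<Sum>i<n. X (Y i) t - (LINT y|P. X y t)) * R t))
      \<in> borel_measurable (PiM {..<n} (\<lambda>_. P))"
proof -
  have em: "(\<lambda>t. LINT y|P. X y t) \<in> borel_measurable borel"
  proof -
    have "(\<lambda>p. X (snd p) (fst p)) \<in> borel_measurable (lborel \<Otimes>\<^sub>M P)"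
      using measurable_compose[OF measurable_Pair[OF measurable_snd measurable_fst] X] by simp
    hence "(\<lambda>(t, y). X y t) \<in> borel_measurable (lborel \<Otimes>\<^sub>M P)" by (simp add: split_beta)
    from sigma_finite_measure.borel_measurable_lebesgue_integral[OF prob_space_imp_sigma_finite[OF P] this] show ?thesis by simp
  qed
  show joint: ?joint
  proof -
    have 1: "(\<lambda>p. X (fst p i) (snd p)) \<in> borel_measurable (PiM {..<n} (\<lambda>_. P) \<Otimes>\<^sub>M lborel)" if "i < n" for i
    proof -
      have a: "(\<lambda>p. fst p i) \<in> PiM {..<n} (\<lambda>_. P) \<Otimes>\<^sub>M (lborel :: real measure) \<rightarrow>\<^sub>M P"
        using that by (intro measurable_compose[OF measurable_fst measurable_component_singleton]) auto
      have b: "snd \<in> PiM {..<n} (\<lambda>_. P) \<Otimes>\<^sub>M lborel \<rightarrow>\<^sub>M (lborel :: real measure)" by simp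
      from measurable_compose[OF measurable_Pair[OF a b] X] show ?thesis by simp
    qed
    have 2: "(\<lambda>p. LINT y|P. X y (snd p)) \<in> borel_measurable (PiM {..<n} (\<lambda>_. P) \<Otimes>\<^sub>M lborel)"
      using measurable_compose[OF measurable_snd, of "\<lambda>t. LINT y|P. X y t" lborel borel "PiM {..<n} (\<lambda>_. P)"] em by simp
    have 3: "(\<lambda>p. R (snd p)) \<in> borel_measurable (PiM {..<n} (\<lambda>_. P) \<Otimes>\<^sub>M lborel)"
      using measurable_compose[OF measurable_snd, of R lborel borel "PiM {..<n} (\<lambda>_. P)"] by simp
    show ?thesis unfolding split_beta by (intro borel_measurable_times borel_measurable_sum borel_measurable_diff 1 2 3) auto
  qed
  have "(\<lambda>(Y, t). ennreal ((cmod ((\<Sum>i<n. X (Y i) t - (LINT y|P. X y t)) * R t))\<^sup>2))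
      \<in> borel_measurable (PiM {..<n} (\<lambda>_. P) \<Otimes>\<^sub>M lborel)"
    using joint unfolding split_beta by measurable
  from lborel.borel_measurable_nn_integral[OF this]
  show "(\<lambda>Y. norm2 (\<lambda>t. (\<Sum>i<n. X (Y i) t - (LINT y|P. X y t)) * R t)) \<in> borel_measurable (PiM {..<n} (\<lambda>_. P))"
    unfolding norm2_def .
qed

text \<open>Tonelli's theorem reduces the claim to each fixed \<open>t\<close>, where variances add
  up and the weight given by \<open>R t\<close> factors out.\<close>

lemma nn_integral_norm2_centered_sum_le:
  fixes X :: "'a \<Rightarrow> real \<Rightarrow> complex"
  assumes P: "prob_space P" and X: "(\<lambda>(y, t). X y t) \<in> borel_measurable (P \<Otimes>\<^sub>M lborel)"
    and int: "\<And>t. integrable P (\<lambda>y. X y t)"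
    and w: "\<And>t. (\<integral>\<^sup>+y. ennreal ((cmod (X y t))\<^sup>2) \<partial>P) \<le> w"
    and R [measurable]: "R \<in> borel_measurable borel"
  shows "(\<integral>\<^sup>+Y. norm2 (\<lambda>t. (\<Sum>i<n. X (Y i) t - (LINT y|P. X y t)) * R t) \<partial>PiM {..<n} (\<lambda>_. P)) \<le> of_nat n * w * norm2 R"
proof -
  interpret P: prob_space P by fact
  interpret Q: prob_space "PiM {..<n} (\<lambda>_. P)" by (intro prob_space_PiM P)
  interpret pair_sigma_finite "PiM {..<n} (\<lambda>_. P)" "lborel :: real measure" ..
  note Sm = centered_sum_measurable(1)[OF P X R, of n]
  have "(\<integral>\<^sup>+Y. norm2 (\<lambda>t. (\<Sum>i<n. X (Y i) t - (LINT y|P. X y t)) * R t) \<partial>PiM {..<n} (\<lambda>_. P))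
     = (\<integral>\<^sup>+t. (\<integral>\<^sup>+Y. ennreal ((cmod ((\<Sum>i<n. X (Y i) t - (LINT y|P. X y t)) * R t))\<^sup>2) \<partial>PiM {..<n} (\<lambda>_. P)) \<partial>lborel)"
    unfolding norm2_def
    by (rule Fubini'[symmetric]) (use Sm in \<open>simp add: split_beta\<close>)
  also have "\<dots> \<le> (\<integral>\<^sup>+t. of_nat n * w * ennreal ((cmod (R t))\<^sup>2) \<partial>lborel)"
  proof (rule nn_integral_mono)
    fix t
    define psi where "psi = (\<lambda>y. X y t - (LINT y|P. X y t))"
    have psi: "integrable P psi" "(LINT y|P. psi y) = 0"
      unfolding psi_def using int by (simp_all add: prob_space.prob_space[OF P])
    hence [measurable]: "psi \<in> borel_measurable P" by auto
    have "(\<integral>\<^sup>+Y. ennreal ((cmod ((\<Sum>i<n. X (Y i) t - (LINT y|P. X y t)) * R t))\<^sup>2) \<partial>PiM {..<n} (\<lambda>_. P))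
       = (\<integral>\<^sup>+Y. ennreal ((cmod (\<Sum>i<n. psi (Y i)))\<^sup>2) * ennreal ((cmod (R t))\<^sup>2) \<partial>PiM {..<n} (\<lambda>_. P))"
      by (simp add: psi_def norm_mult power_mult_distrib ennreal_mult)
    also have "\<dots> = (\<integral>\<^sup>+Y. ennreal ((cmod (\<Sum>i<n. psi (Y i)))\<^sup>2) \<partial>PiM {..<n} (\<lambda>_. P)) * ennreal ((cmod (R t))\<^sup>2)"
      by (rule nn_integral_multc) measurable
    also have "\<dots> \<le> of_nat n * w * ennreal ((cmod (R t))\<^sup>2)"
    proof (rule mult_right_mono)
      have "(\<integral>\<^sup>+Y. ennreal ((cmod (\<Sum>i<n. psi (Y i)))\<^sup>2) \<partial>PiM {..<n} (\<lambda>_. P))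
         \<le> of_nat n * (\<integral>\<^sup>+y. ennreal ((cmod (psi y))\<^sup>2) \<partial>P)"
        by (rule nn_integral_sum_square_le[OF P psi])
      also have "\<dots> \<le> of_nat n * w"
        using nn_integral_variance_le[OF P int, of t] w[of t]
        by (intro mult_left_mono) (auto simp: psi_def)
      finally show "(\<integral>\<^sup>+Y. ennreal ((cmod (\<Sum>i<n. psi (Y i)))\<^sup>2) \<partial>PiM {..<n} (\<lambda>_. P)) \<le> of_nat n * w" .
    qed simp
    finally show "(\<integral>\<^sup>+Y. ennreal ((cmod ((\<Sum>i<n. X (Y i) t - (LINT y|P. X y t)) * R t))\<^sup>2) \<partial>PiM {..<n} (\<lambda>_. P))
        \<le> of_nat n * w * ennreal ((cmod (R t))\<^sup>2)" .
  qed
  also have "\<dots> = of_nat n * w * norm2 R"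
    unfolding norm2_def by (rule nn_integral_cmult) measurable
  finally show ?thesis .
qed

section \<open>Summability of the deviation terms\<close>

text \<open>The leading factor \<open>n\<close> stands for the number of parameters in
  \<open>Kset\<close>; what remains is \<open>tail_rate\<close> up to a constant.\<close>

lemma powr_exp_root_bounded:
  obtains S where "0 < S" "\<And>n::nat. 1 \<le> n \<Longrightarrow> real n * real n powr (2/3) * exp (- (5/2) * real n powr (1/6)) \<le> S"
proof -
  have "(\<lambda>n::nat. real n * real n powr (2/3) * exp (- (5/2) * real n powr (1/6))) \<longlonglongrightarrow> 0"
    by real_asymp
  hence "Bseq (\<lambda>n::nat. real n * real n powr (2/3) * exp (- (5/2) * real n powr (1/6)))"
    by (intro convergent_imp_Bseq) (auto simp: convergent_def)
  then obtain S where S: "0 < S" "\<And>n::nat. norm (real n * real n powr (2/3) * exp (- (5/2) * real n powr (1/6))) \<le> S"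
    by (auto simp: Bseq_def)
  have "real n * real n powr (2/3) * exp (- (5/2) * real n powr (1/6)) \<le> S" for n :: nat
    using S(2)[of n] by (simp only: real_norm_def abs_le_iff)
  thus ?thesis using that[OF S(1)] by blast
qed

lemma summable_stretched_exp:
  fixes \<kappa> c0 p :: real
  assumes "0 < \<kappa>" "0 < c0" "0 < p"
  shows "summable (\<lambda>k::nat. (real k)\<^sup>2 * exp (- 6 * (\<kappa> * ((c0 * real k) powr p - 1))))"
proof (rule summable_comparison_test_ev)
  have "(\<lambda>k::nat. (real k) ^ 4 * exp (- 6 * (\<kappa> * ((c0 * real k) powr p - 1)))) \<longlonglongrightarrow> 0"
    using assms by real_asymp
  hence "eventually (\<lambda>k::nat. (real k) ^ 4 * exp (- 6 * (\<kappa> * ((c0 * real k) powr p - 1))) < 1) sequentially"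
    by (rule order_tendstoD) simp
  thus "eventually (\<lambda>k::nat. norm ((real k)\<^sup>2 * exp (- 6 * (\<kappa> * ((c0 * real k) powr p - 1)))) \<le> 1 / (real k)\<^sup>2) sequentially"
    using eventually_gt_at_top[of 0]
  proof eventually_elim
    case (elim k)
    hence "(real k)\<^sup>2 * ((real k)\<^sup>2 * exp (- 6 * (\<kappa> * ((c0 * real k) powr p - 1)))) \<le> 1"
      by (simp add: mult.assoc[symmetric] flip: power_add)
    thus ?case using elim(2) by (simp add: field_simps)
  qed
  show "summable (\<lambda>k::nat. 1 / (real k)\<^sup>2)"
    using inverse_power_summable[of 2, where 'a = real] by (simp add: inverse_eq_divide)
qed

section \<open>The two regimes of the deviation bound\<close>

context ridge_multiplier
begin

text \<open>The ratio of strong variance \<open>s * ridge_sq k\<close> to weak variance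
  \<open>2 * pi * B * k\<^sup>2\<close>. It is the value of \<open>mu * L\<close> when
  \<open>mu = L / (n * v)\<close>, and it grows at least like
  \<open>k powr (1 / \<gamma>)\<close>.\<close>

definition tail_x :: "real \<Rightarrow> real \<Rightarrow> nat \<Rightarrow> real" where
  "tail_x s B k = s * ridge_sq k / (2 * pi * B * (real k)\<^sup>2)"

text \<open>The right side of \<open>tail_bound\<close> divided by \<open>n\<close>, at threshold
  \<open>b = 10 * L\<close> and for the choice \<open>mu = L / (n * v)\<close>; it no longer
  contains \<open>n\<close>.\<close>

definition tail_term :: "real \<Rightarrow> real \<Rightarrow> nat \<Rightarrow> real" where
  "tail_term s B k = 2 * pi * B * (real k)\<^sup>2 / tail_x s B k * (2 + 20 * tail_x s B k) * exp (- 6 * tail_x s B k)"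

lemma tail_x_nonneg: "0 \<le> s \<Longrightarrow> 0 < B \<Longrightarrow> 0 \<le> tail_x s B k"
  unfolding tail_x_def using ridge_sq_nonneg[of k] by simp

lemma tail_term_nonneg: "0 \<le> s \<Longrightarrow> 0 < B \<Longrightarrow> 0 \<le> tail_term s B k"
  unfolding tail_term_def using tail_x_nonneg[of s B k] by simp

text \<open>By \<open>ridge_sq_lower\<close> the exponent \<open>tail_x\<close> exceeds a positive
  multiple of \<open>(cg * k) powr (1 / \<gamma>) - 1\<close>. Once it is at least 1, the rational
  prefactor is at most 22 and a stretched exponential remains.\<close>

lemma summable_tail_term:
  assumes s: "0 < s" and B: "0 < B"
  shows "summable (tail_term s B)"
proof (rule summable_comparison_test_ev)
  define \<kappa> where "\<kappa> = s / (2 * pi * B) * (cg\<^sup>2 / (2 * Cg\<^sup>2 * 4 powr \<gamma>))"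
  have \<kappa>: "0 < \<kappa>" using s B const_pos by (simp add: \<kappa>_def)
  let ?y = "\<lambda>k. \<kappa> * ((cg * real k) powr (1 / \<gamma>) - 1)"
  have lower: "?y k \<le> tail_x s B k" if k: "1 \<le> k" for k
  proof -
    have "s * (cg\<^sup>2 / (2 * Cg\<^sup>2 * 4 powr \<gamma>) * (real k)\<^sup>2 * ((cg * real k) powr (1 / \<gamma>) - 1)) \<le> s * ridge_sq k"
      using s by (intro mult_left_mono ridge_sq_lower[OF k]) auto
    hence "s * (cg\<^sup>2 / (2 * Cg\<^sup>2 * 4 powr \<gamma>) * (real k)\<^sup>2 * ((cg * real k) powr (1 / \<gamma>) - 1)) / (2 * pi * B * (real k)\<^sup>2)
       \<le> s * ridge_sq k / (2 * pi * B * (real k)\<^sup>2)"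
      using B by (intro divide_right_mono) auto
    thus ?thesis unfolding tail_x_def \<kappa>_def using k B const_pos by (simp add: mult_ac)
  qed
  have "filterlim (\<lambda>k::nat. ?y k) at_top sequentially"
    using \<kappa> const_pos by real_asymp
  hence "eventually (\<lambda>k::nat. 1 \<le> ?y k) sequentially" by (simp add: filterlim_at_top)
  thus "eventually (\<lambda>k. norm (tail_term s B k) \<le> 44 * pi * B * ((real k)\<^sup>2 * exp (- 6 * ?y k))) sequentially"
    using eventually_ge_at_top[of 1]
  proof eventually_elim
    case (elim k)
    define x where "x = tail_x s B k"
    have x: "1 \<le> x" "?y k \<le> x" using lower[OF elim(2)] elim(1) by (auto simp: x_def)
    have "tail_term s B k = 2 * pi * B * (real k)\<^sup>2 * ((2 + 20 * x) / x) * exp (- 6 * x)"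
      by (simp add: tail_term_def x_def)
    also have "\<dots> \<le> 2 * pi * B * (real k)\<^sup>2 * 22 * exp (- 6 * ?y k)"
    proof (intro mult_mono)
      show "(2 + 20 * x) / x \<le> 22" using x by (simp add: field_simps)
    qed (use x B in auto)
    finally show ?case using tail_term_nonneg[of s B k] s B by (simp add: mult_ac)
  qed
  show "summable (\<lambda>k. 44 * pi * B * ((real k)\<^sup>2 * exp (- 6 * ?y k)))"
    using \<kappa> const_pos by (intro summable_mult summable_stretched_exp) auto
qed

text \<open>The counterpart of \<open>tail_term\<close> for \<open>mu = 1 / (2 * M)\<close>, where
  \<open>mu * L = n powr (1/6) / 2\<close>. It is made uniform in \<open>k\<close> by
  \<open>ridge_sq k \<le> n\<close>.\<close>

definition tail_rate :: "real \<Rightarrow> nat \<Rightarrow> real" where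
  "tail_rate s n = 80 * s * real n powr (2/3) * exp (- (5/2) * real n powr (1/6))"

text \<open>The bound is uniform in \<open>n\<close>: the first terms form part of a convergent
  series, and the second are at most a multiple of \<open>n\<close> in number. The data of
  \<open>f\<close> enter only through \<open>s\<close> and \<open>B\<close>.\<close>

lemma sum_tail_bounded:
  assumes s: "0 < s" and B: "0 < B"
  obtains S where "0 < S" "\<And>n. 1 \<le> n \<Longrightarrow> finite (Kset c g r n)"
    "\<And>n. 1 \<le> n \<Longrightarrow> (\<Sum>k\<in>Kset c g r n. tail_term s B k + tail_rate s n) \<le> S"
proof -
  obtain CK where CK: "0 \<le> CK" "\<And>n. 1 \<le> n \<Longrightarrow> finite (Kset c g r n) \<and> real (card (Kset c g r n)) \<le> CK * real n"
    using Kset_card by blast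
  obtain S where S: "0 < S" "\<And>n::nat. 1 \<le> n \<Longrightarrow> real n * real n powr (2/3) * exp (- (5/2) * real n powr (1/6)) \<le> S"
    using powr_exp_root_bounded by blast
  let ?S = "suminf (tail_term s B) + CK * (80 * s * S) + 1"
  have "0 \<le> suminf (tail_term s B)"
    by (rule suminf_nonneg[OF summable_tail_term[OF s B]]) (use tail_term_nonneg s B in auto)
  hence "0 < ?S" using CK(1) s S(1) by (simp add: add_nonneg_pos)
  moreover have "(\<Sum>k\<in>Kset c g r n. tail_term s B k + tail_rate s n) \<le> ?S" if n: "1 \<le> n" for n
  proof -
    have "(\<Sum>k\<in>Kset c g r n. tail_term s B k) \<le> suminf (tail_term s B)"
      using CK(2)[OF n] tail_term_nonneg s B by (intro sum_le_suminf summable_tail_term) auto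
    moreover have "(\<Sum>k\<in>Kset c g r n. tail_rate s n) \<le> CK * (80 * s * S)"
    proof -
      have t0: "0 \<le> tail_rate s n" using s by (simp add: tail_rate_def)
      have "(\<Sum>k\<in>Kset c g r n. tail_rate s n) \<le> (CK * real n) * tail_rate s n"
        using CK(2)[OF n] t0 by (simp add: mult_right_mono)
      also have "\<dots> = CK * (80 * s * (real n * real n powr (2/3) * exp (- (5/2) * real n powr (1/6))))"
        by (simp add: tail_rate_def mult_ac)
      also have "\<dots> \<le> CK * (80 * s * S)"
        using CK(1) s S(2)[OF n] by (intro mult_left_mono) auto
      finally show ?thesis .
    qed
    ultimately show ?thesis by (simp add: sum.distrib)
  qed
  ultimately show ?thesis using CK(2) that[of ?S] by blast
qed

end

section \<open>Concentration of the truncated empirical Mellin transform\<close>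

definition trunc_kernel :: "real \<Rightarrow> real \<Rightarrow> real \<Rightarrow> real \<Rightarrow> complex" where
  "trunc_kernel c d y t = (if y powr (c - 1) \<le> d then mellin_kernel c y t else 0)"

definition tail_kernel :: "real \<Rightarrow> real \<Rightarrow> real \<Rightarrow> real \<Rightarrow> complex" where
  "tail_kernel c d y t = (if y powr (c - 1) \<le> d then 0 else mellin_kernel c y t)"

lemma kernel_split: "mellin_kernel c y t = trunc_kernel c d y t + tail_kernel c d y t"
  by (simp add: trunc_kernel_def tail_kernel_def)

lemma cmod_trunc_kernel: "0 \<le> d \<Longrightarrow> cmod (trunc_kernel c d y t) \<le> d"
  "cmod (trunc_kernel c d y t) \<le> y powr (c - 1)"
  by (simp_all add: trunc_kernel_def)

lemma cmod_tail_kernel: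
  "cmod (tail_kernel c d y t) \<le> y powr (c - 1)"
  by (simp add: tail_kernel_def)

lemma kernel_measurable:
  assumes [measurable]: "a \<in> borel_measurable Q" "b \<in> borel_measurable Q"
  shows "(\<lambda>x. mellin_kernel c (a x) (b x)) \<in> borel_measurable Q"
    and "(\<lambda>x. trunc_kernel c d (a x) (b x)) \<in> borel_measurable Q"
    and "(\<lambda>x. tail_kernel c d (a x) (b x)) \<in> borel_measurable Q"
proof -
  show [measurable]: "(\<lambda>x. mellin_kernel c (a x) (b x)) \<in> borel_measurable Q"
    unfolding mellin_kernel_def by measurable
  show "(\<lambda>x. trunc_kernel c d (a x) (b x)) \<in> borel_measurable Q"
    unfolding trunc_kernel_def by measurable
  show "(\<lambda>x. tail_kernel c d (a x) (b x)) \<in> borel_measurable Q"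
    unfolding tail_kernel_def by measurable
qed

locale deconvolution = ridge_multiplier +
  fixes f :: "real \<Rightarrow> real"
  assumes f_density: "pos_density f"
    and f_L2: "(\<lambda>x. complex_of_real (f x)) \<in> wL2 c"
    and fifth_moment: "moment_Y f g (5 * (c - 1)) < \<infinity>"
    and sup_finite: "wsup_norm c g < \<infinity>"
begin

abbreviation P :: "real measure" where "P \<equiv> law_Y f g"

definition m :: real where "m = enn2real (moment_Y f g (5 * (c - 1)))"

definition s :: real where "s = enn2real (sigma_c c f g)"

text \<open>A bound for the weighted density of \<open>Y\<close>. The moment of \<open>f\<close> it
  needs is written as \<open>s\<close> divided by the moment of \<open>g\<close>, so that apart from
  \<open>s\<close> nothing of \<open>f\<close> remains; the summand 1 makes it positive.\<close>

definition B :: real where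
  "B = enn2real (wsup_norm c g) * (s / enn2real (mom g (2 * (c - 1)))) + 1"

lemma P_prob: "prob_space P"
  by (rule prob_space_law_Y[OF f_density g_density])

sublocale P: prob_space P by (rule P_prob)

lemmas sets_P = sets_law_Y[OF f_density g_density]

lemma space_P: "space P = {0<..}"
  by (rule space_law_Y[OF f_density g_density])

lemma id_measurable_P: "(\<lambda>y. y) \<in> P \<rightarrow>\<^sub>M borel"
  unfolding measurable_cong_sets[OF sets_P refl] by (rule borel_measurable_imp_Rplus) simp

lemma borel_measurable_P: "h \<in> borel_measurable borel \<Longrightarrow> h \<in> borel_measurable P"
  unfolding measurable_cong_sets[OF sets_P refl] by (rule borel_measurable_imp_Rplus)

lemma fifth_moment_eq: "moment_Y f g (5 * (c - 1)) = ennreal m" and m_nonneg: "0 \<le> m"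
  using fifth_moment by (simp_all add: m_def)

lemma moment_finite: "0 \<le> j \<Longrightarrow> j \<le> 5 \<Longrightarrow> moment_Y f g (j * (c - 1)) < \<infinity>"
  "0 \<le> j \<Longrightarrow> j \<le> 5 \<Longrightarrow> mom f (j * (c - 1)) < \<infinity>"
  "0 \<le> j \<Longrightarrow> j \<le> 5 \<Longrightarrow> mom g (j * (c - 1)) < \<infinity>"
  using moments_finite[OF f_density g_density fifth_moment] by auto

lemma sigma_eq: "sigma_c c f g = ennreal s" and s_pos: "0 < s"
proof -
  have fin: "sigma_c c f g < \<infinity>" unfolding sigma_c_def using moment_finite(1)[of 2] by simp
  thus "sigma_c c f g = ennreal s" by (simp add: s_def)
  have "sigma_c c f g \<noteq> 0"
    unfolding sigma_c_def moment_Y_eq[OF f_density g_density]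
    using mom_nonzero[OF f_density] mom_nonzero[OF g_density] by simp
  thus "0 < s" using fin unfolding s_def by (simp add: enn2real_positive_iff less_top zero_less_iff_neq_zero)
qed

lemma second_moment: "(\<integral>\<^sup>+y. ennreal (y powr (2 * (c - 1))) \<partial>P) = ennreal s"
  using sigma_eq by (simp add: sigma_c_def moment_Y_def)

lemma B_pos: "0 < B"
  unfolding B_def using s_pos by (intro add_nonneg_pos mult_nonneg_nonneg divide_nonneg_nonneg) auto

lemma weighted_P_le:
  assumes h: "h \<in> borel_measurable Rplus"
  shows "(\<integral>\<^sup>+y. ennreal (y powr (2 * (c - 1))) * h y \<partial>P) \<le> ennreal B * (\<integral>\<^sup>+y. h y * ennreal (1 / y) \<partial>Rplus)"
proof -
  define mg where "mg = enn2real (mom g (2 * (c - 1)))"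
  define mf where "mf = enn2real (mom f (2 * (c - 1)))"
  have g2: "mom g (2 * (c - 1)) = ennreal mg" and f2: "mom f (2 * (c - 1)) = ennreal mf"
    using moment_finite(2,3)[of 2] by (simp_all add: mg_def mf_def)
  have mg: "0 < mg"
    using g2 mom_nonzero[OF g_density, of "2 * (c - 1)"] enn2real_nonneg[of "mom g (2 * (c - 1))"]
    by (auto simp: mg_def less_le)
  have mf: "0 \<le> mf" by (simp add: mf_def)
  have "ennreal s = ennreal (mf * mg)"
    using sigma_eq mf mg unfolding sigma_c_def moment_Y_eq[OF f_density g_density] g2 f2 by (simp add: ennreal_mult)
  hence "s = mf * mg" using s_pos mf mg by (subst (asm) ennreal_inj) auto
  hence mf_eq: "mf = s / mg" using mg by simp
  have "wsup_norm c g * mom f (2 * (c - 1)) = ennreal (enn2real (wsup_norm c g) * mf)"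
    unfolding f2 using sup_finite mf by (simp add: ennreal_mult)
  also have "\<dots> \<le> ennreal B" unfolding B_def mf_eq mg_def[symmetric] by (intro ennreal_leI) simp
  finally have "wsup_norm c g * mom f (2 * (c - 1)) * (\<integral>\<^sup>+y. h y * ennreal (1 / y) \<partial>Rplus)
      \<le> ennreal B * (\<integral>\<^sup>+y. h y * ennreal (1 / y) \<partial>Rplus)"
    by (rule mult_right_mono) simp
  with weighted_integral_law_Y_le[OF f_density g_density h, of c] show ?thesis by (rule order_trans)
qed

lemma kernel_measurable_P:
  "(\<lambda>y. mellin_kernel c y t) \<in> borel_measurable P" "(\<lambda>y. trunc_kernel c d y t) \<in> borel_measurable P"
  "(\<lambda>y. tail_kernel c d y t) \<in> borel_measurable P"
  by (intro kernel_measurable id_measurable_P measurable_const[of t borel]; simp)+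

lemma kernel_joint_measurable:
  assumes "sets N = sets borel"
  shows "(\<lambda>(y, t). mellin_kernel c y t) \<in> borel_measurable (P \<Otimes>\<^sub>M N)"
    "(\<lambda>(y, t). trunc_kernel c d y t) \<in> borel_measurable (P \<Otimes>\<^sub>M N)"
    "(\<lambda>(y, t). tail_kernel c d y t) \<in> borel_measurable (P \<Otimes>\<^sub>M N)"
proof -
  have a: "fst \<in> borel_measurable (P \<Otimes>\<^sub>M N)"
    using measurable_compose[OF measurable_fst[of P N] id_measurable_P] by simp
  have b: "snd \<in> borel_measurable (P \<Otimes>\<^sub>M N)"
    using measurable_snd[of P N] unfolding measurable_cong_sets[OF refl assms] .
  show "(\<lambda>(y, t). mellin_kernel c y t) \<in> borel_measurable (P \<Otimes>\<^sub>M N)"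
    "(\<lambda>(y, t). trunc_kernel c d y t) \<in> borel_measurable (P \<Otimes>\<^sub>M N)"
    "(\<lambda>(y, t). tail_kernel c d y t) \<in> borel_measurable (P \<Otimes>\<^sub>M N)"
    unfolding split_beta by (intro kernel_measurable a b)+
qed

lemma kernel_integrable: "integrable P (\<lambda>y. mellin_kernel c y t)"
  using integrable_mellin_kernel[OF f_density g_density] moment_finite(1)[of 1] by simp

lemma trunc_kernel_integrable: "integrable P (\<lambda>y. trunc_kernel c d y t)"
  by (rule Bochner_Integration.integrable_bound[OF kernel_integrable[of t] kernel_measurable_P(2)])
     (auto simp: cmod_trunc_kernel)

lemma tail_kernel_integrable: "integrable P (\<lambda>y. tail_kernel c d y t)"
  by (rule Bochner_Integration.integrable_bound[OF kernel_integrable[of t] kernel_measurable_P(3)])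
     (auto simp: cmod_tail_kernel)

definition mellin_Y :: "real \<Rightarrow> complex" where "mellin_Y t = mellin c f t * G t"

lemma kernel_expectation: "(LINT y|P. mellin_kernel c y t) = mellin_Y t"
  unfolding mellin_Y_def using expectation_mellin_kernel[OF f_density g_density] moment_finite(1)[of 1] by simp

lemma expectation_split: "mellin_Y t = (LINT y|P. trunc_kernel c d y t) + (LINT y|P. tail_kernel c d y t)"
  unfolding kernel_expectation[symmetric] kernel_split[of c _ t d]
  by (intro Bochner_Integration.integral_add trunc_kernel_integrable tail_kernel_integrable)

lemma kernel_square:
  "(\<integral>\<^sup>+y. ennreal ((cmod (mellin_kernel c y t))\<^sup>2) \<partial>P) = ennreal s"
proof -
  have "(y powr (c - 1))\<^sup>2 = y powr (2 * (c - 1))" for y :: real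
    by (simp add: power2_eq_square flip: powr_add)
  thus ?thesis using second_moment by simp
qed

lemma trunc_kernel_square: "(\<integral>\<^sup>+y. ennreal ((cmod (trunc_kernel c d y t))\<^sup>2) \<partial>P) \<le> ennreal s"
  unfolding kernel_square[of t, symmetric]
  by (intro nn_integral_mono ennreal_leI power_mono) (auto simp: cmod_trunc_kernel)

text \<open>Where \<open>z = y powr (c - 1)\<close> exceeds \<open>d\<close>, one has
  \<open>z\<^sup>2 \<le> z ^ 5 / d ^ 3\<close>.\<close>

lemma tail_kernel_square:
  assumes d: "0 < d"
  shows "(\<integral>\<^sup>+y. ennreal ((cmod (tail_kernel c d y t))\<^sup>2) \<partial>P) \<le> ennreal (m / d ^ 3)"
proof -
  have "(\<integral>\<^sup>+y. ennreal ((cmod (tail_kernel c d y t))\<^sup>2) \<partial>P) \<le> (\<integral>\<^sup>+y. ennreal (1 / d ^ 3) * ennreal (y powr (5 * (c - 1))) \<partial>P)"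
  proof (rule nn_integral_mono)
    fix y
    define z where "z = y powr (c - 1)"
    have z0: "0 \<le> z" by (simp add: z_def)
    have z5: "y powr (5 * (c - 1)) = z ^ 5"
    proof (cases "y = 0")
      case False
      hence "z ^ 5 = z powr 5" by (simp add: z_def powr_numeral)
      also have "\<dots> = y powr (5 * (c - 1))" unfolding z_def by (simp only: powr_powr mult.commute)
      finally show ?thesis by simp
    qed (simp add: z_def)
    have "(cmod (tail_kernel c d y t))\<^sup>2 \<le> 1 / d ^ 3 * y powr (5 * (c - 1))"
    proof (cases "z \<le> d")
      case False
      hence "d ^ 3 * z\<^sup>2 \<le> z ^ 3 * z\<^sup>2" using d by (intro mult_right_mono power_mono) auto
      also have "\<dots> = z ^ 5" by (simp flip: power_add)
      finally have "z\<^sup>2 \<le> 1 / d ^ 3 * z ^ 5" using d by (simp add: field_simps)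
      thus ?thesis using False unfolding z5 by (simp add: tail_kernel_def z_def[symmetric])
    qed (use d z0 in \<open>simp add: tail_kernel_def z_def[symmetric]\<close>)
    thus "ennreal ((cmod (tail_kernel c d y t))\<^sup>2) \<le> ennreal (1 / d ^ 3) * ennreal (y powr (5 * (c - 1)))"
      using d by (simp add: ennreal_mult[symmetric] ennreal_leI)
  qed
  also have "\<dots> = ennreal (1 / d ^ 3) * ennreal m"
    by (subst nn_integral_cmult) (auto intro!: borel_measurable_P simp: fifth_moment_eq[symmetric] moment_Y_def)
  also have "\<dots> = ennreal (m / d ^ 3)"
    using d m_nonneg by (simp add: ennreal_mult[symmetric])
  finally show ?thesis .
qed

text \<open>Absorbing the squared modulus of the multiplier into the measure turns the norm of
  \<open>h * R k\<close> into the norm of \<open>h\<close>. The measure is finite, so bounded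
  functions such as the truncated kernel belong to its \<open>L\<^sup>2\<close>.\<close>

definition ridge_measure :: "nat \<Rightarrow> real measure" where
  "ridge_measure k = density lborel (\<lambda>t. ennreal ((cmod (R k t))\<^sup>2))"

lemma sets_ridge_measure [measurable_cong, simp]: "sets (ridge_measure k) = sets borel" and space_ridge_measure [simp]: "space (ridge_measure k) = UNIV"
  by (simp_all add: ridge_measure_def)

lemma nn_integral_ridge_measure:
  "h \<in> borel_measurable borel \<Longrightarrow> (\<integral>\<^sup>+t. h t \<partial>ridge_measure k) = (\<integral>\<^sup>+t. ennreal ((cmod (R k t))\<^sup>2) * h t \<partial>lborel)"
  unfolding ridge_measure_def by (rule nn_integral_density) auto

lemma norm2_mult_R:
  "h \<in> borel_measurable borel \<Longrightarrow> norm2 (\<lambda>t. h t * R k t) = (\<integral>\<^sup>+t. ennreal ((cmod (h t))\<^sup>2) \<partial>ridge_measure k)"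
  by (simp add: nn_integral_ridge_measure norm2_def norm_mult power_mult_distrib ennreal_mult mult.commute)

lemma finite_measure_ridge_measure:
  assumes k: "1 \<le> k"
  shows "finite_measure (ridge_measure k)" "measure (ridge_measure k) UNIV = ridge_sq k"
proof -
  have "emeasure (ridge_measure k) UNIV = (\<integral>\<^sup>+t. 1 \<partial>ridge_measure k)" by simp
  also have "\<dots> = norm2 (R k)" by (subst nn_integral_ridge_measure) (auto simp: norm2_def)
  finally have e: "emeasure (ridge_measure k) UNIV = ennreal (ridge_sq k)" by (simp add: norm2_R[OF k])
  thus "finite_measure (ridge_measure k)" by (intro finite_measureI) simp
  show "measure (ridge_measure k) UNIV = ridge_sq k" using e ridge_sq_nonneg by (simp add: measure_def)
qed

definition trunc_centered :: "real \<Rightarrow> real \<Rightarrow> real \<Rightarrow> complex" where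
  "trunc_centered d y t = trunc_kernel c d y t - (LINT y|P. trunc_kernel c d y t)"

lemma mean_trunc_measurable: "(\<lambda>t. LINT y|P. trunc_kernel c d y t) \<in> borel_measurable borel"
proof -
  have "(\<lambda>(t, y). trunc_kernel c d y t) \<in> borel_measurable (borel \<Otimes>\<^sub>M P)"
    unfolding split_beta
    by (intro kernel_measurable measurable_compose[OF measurable_snd id_measurable_P] measurable_fst)
  from P.borel_measurable_lebesgue_integral[OF this] show ?thesis .
qed

lemma cmod_mean_trunc: "0 \<le> d \<Longrightarrow> cmod (LINT y|P. trunc_kernel c d y t) \<le> d"
  by (rule integral_norm_bound[THEN order_trans], rule P.integral_le_const)
     (auto intro!: integrable_norm trunc_kernel_integrable cmod_trunc_kernel)

text \<open>The inner product of \<open>h\<close> with the truncated kernel at \<open>y\<close> is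
  \<open>y powr (c - 1)\<close> times a Fourier transform at \<open>- ln y\<close>. Its variance is
  at most its second moment, which the bounded weighted density of \<open>Y\<close> compares with an
  integral over \<open>dy / y\<close>; in the variable \<open>ln y\<close> this is the squared norm
  of the transform, and Plancherel applies. A single factor \<open>k\<^sup>2\<close> is lost,
  through \<open>cmod_R_le\<close>.\<close>

lemma weak_variance_trunc:
  assumes k: "1 \<le> k" and d: "0 < d" and h [measurable]: "h \<in> borel_measurable borel" and b: "\<And>t. cmod (h t) \<le> C"
  shows "(LINT y|P. (Re (LINT t|ridge_measure k. h t * cnj (trunc_centered d y t)))\<^sup>2)
    \<le> 2 * pi * B * (real k)\<^sup>2 * (LINT t|ridge_measure k. (cmod (h t))\<^sup>2)"
proof -
  interpret N: finite_measure "ridge_measure k" by (rule finite_measure_ridge_measure(1)[OF k])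
  have C0: "0 \<le> C" using b[of 0] norm_ge_zero order_trans by blast
  have [measurable]: "h \<in> borel_measurable (ridge_measure k)"
    unfolding measurable_cong_sets[OF sets_ridge_measure refl] by (rule h)
  have ih: "integrable (ridge_measure k) h" by (rule N.integrable_const_bound[where B = C]) (auto simp: b)
  have ih2: "integrable (ridge_measure k) (\<lambda>t. (cmod (h t))\<^sup>2)"
    by (rule N.integrable_const_bound[where B = "C\<^sup>2"]) (auto intro!: power_mono b)
  define \<beta> where "\<beta> = (\<lambda>y. LINT t|ridge_measure k. h t * cnj (trunc_kernel c d y t))"
  have km: "(\<lambda>(t, y). cnj (trunc_kernel c d y t)) \<in> borel_measurable (ridge_measure k \<Otimes>\<^sub>M P)"
    unfolding split_beta
    by (intro borel_measurable_cnj kernel_measurable measurable_compose[OF measurable_snd id_measurable_P])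
       (use measurable_fst[of "ridge_measure k" P] in \<open>simp cong: measurable_cong_sets\<close>)
  have bm [measurable]: "\<beta> \<in> borel_measurable P"
  proof -
    have "(\<lambda>(y, t). h t * cnj (trunc_kernel c d y t)) \<in> borel_measurable (P \<Otimes>\<^sub>M ridge_measure k)"
      using kernel_joint_measurable(2)[OF sets_ridge_measure, of d k] by (simp add: split_beta) measurable
    from N.borel_measurable_lebesgue_integral[OF this] show ?thesis unfolding \<beta>_def .
  qed
  have sm: "(\<lambda>t. trunc_kernel c d y t) \<in> borel_measurable borel" for y
    by (intro kernel_measurable) auto
  have smN [measurable]: "(\<lambda>t. trunc_kernel c d y t) \<in> borel_measurable (ridge_measure k)"
      "(\<lambda>t. LINT y|P. trunc_kernel c d y t) \<in> borel_measurable (ridge_measure k)" for y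
    unfolding measurable_cong_sets[OF sets_ridge_measure refl] by (rule sm mean_trunc_measurable)+
  have ihk: "integrable (ridge_measure k) (\<lambda>t. h t * cnj (trunc_kernel c d y t))" for y
    by (rule integrable_mult_bounded(1)[OF ih, of _ d]) (use smN d in \<open>auto simp: cmod_trunc_kernel\<close>)
  have ihm: "integrable (ridge_measure k) (\<lambda>t. h t * cnj (LINT y|P. trunc_kernel c d y t))"
    by (rule integrable_mult_bounded(1)[OF ih, of _ d]) (use smN d in \<open>auto simp: cmod_mean_trunc\<close>)
  have ib: "integrable P \<beta>"
  proof (rule P.integrable_const_bound[where B = "C * d * ridge_sq k"])
    have "cmod (\<beta> y) \<le> C * d * ridge_sq k" for y
    proof -
      have "cmod (\<beta> y) \<le> (LINT t|ridge_measure k. cmod (h t * cnj (trunc_kernel c d y t)))"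
        unfolding \<beta>_def by (rule integral_norm_bound)
      also have "\<dots> \<le> (LINT t|ridge_measure k. C * d)"
        using ihk d C0 by (intro integral_mono integrable_norm) (auto simp: norm_mult intro!: mult_mono b cmod_trunc_kernel)
      also have "\<dots> = C * d * ridge_sq k" using finite_measure_ridge_measure(2)[OF k] by simp
      finally show ?thesis .
    qed
    thus "AE y in P. cmod (\<beta> y) \<le> C * d * ridge_sq k" by simp
  qed (rule bm)
  have Eb: "(LINT y|P. \<beta> y) = (LINT t|ridge_measure k. h t * cnj (LINT y|P. trunc_kernel c d y t))"
  proof -
    have "(LINT y|P. (LINT t|ridge_measure k. h t * cnj (trunc_kernel c d y t)) * 1) = (LINT t|ridge_measure k. h t * (LINT y|P. cnj (trunc_kernel c d y t) * 1))"
      by (rule Fubini_bounded_kernel[where C = d])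
         (use d in \<open>auto intro: N.sigma_finite_measure_axioms P.sigma_finite_measure_axioms ih km simp: cmod_trunc_kernel\<close>)
    thus ?thesis by (simp add: \<beta>_def)
  qed
  have eq: "(LINT t|ridge_measure k. h t * cnj (trunc_centered d y t)) = \<beta> y - (LINT y|P. \<beta> y)" for y
    unfolding Eb unfolding \<beta>_def trunc_centered_def complex_cnj_diff right_diff_distrib
    by (rule Bochner_Integration.integral_diff[OF ihk ihm])
  \<comment> \<open>One factor comes from the density of \<open>ridge_measure\<close>. In
    \<open>norm2 H\<close> it appears squared: one copy is estimated by \<open>k\<^sup>2\<close>,
    the other restores the measure.\<close>
  define H where "H = (\<lambda>t. h t * of_real ((cmod (R k t))\<^sup>2))"
  have H: "integrable lborel H"
    unfolding H_def by (rule integrable_mult_bounded(2)[where C = C]) (use norm2_R(1)[OF k] b in \<open>simp_all del: of_real_power\<close>)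
  hence [measurable]: "H \<in> borel_measurable borel" by auto
  have \<beta>_eq: "\<beta> y = (if y powr (c - 1) \<le> d then of_real (y powr (c - 1)) * fourier H (- ln y) else 0)" for y
  proof -
    have "\<beta> y = (LINT t|lborel. (cmod (R k t))\<^sup>2 *\<^sub>R (h t * cnj (trunc_kernel c d y t)))"
      unfolding \<beta>_def ridge_measure_def by (rule integral_density) (use sm in auto)
    also have "\<dots> = (LINT t|lborel. (if y powr (c - 1) \<le> d then of_real (y powr (c - 1)) else 0) * (H t * cis (t * (- ln y))))"
      by (intro Bochner_Integration.integral_cong refl)
         (auto simp: trunc_kernel_def mellin_kernel_def H_def scaleR_conv_of_real cis_cnj mult_ac)
    finally show ?thesis by (simp add: fourier_def)
  qed
  have fm: "(\<lambda>y. ennreal ((cmod (fourier H (- ln y)))\<^sup>2)) \<in> borel_measurable Rplus"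
    by (rule borel_measurable_imp_Rplus) measurable
  have "(\<integral>\<^sup>+y. ennreal ((Re (\<beta> y - (LINT y|P. \<beta> y)))\<^sup>2) \<partial>P) \<le> (\<integral>\<^sup>+y. ennreal ((cmod (\<beta> y - (LINT y|P. \<beta> y)))\<^sup>2) \<partial>P)"
    by (intro nn_integral_mono ennreal_leI) (metis abs_Re_le_cmod abs_le_square_iff abs_norm_cancel)
  also have "\<dots> \<le> (\<integral>\<^sup>+y. ennreal ((cmod (\<beta> y))\<^sup>2) \<partial>P)"
    by (rule nn_integral_variance_le[OF P_prob ib])
  also have "\<dots> \<le> (\<integral>\<^sup>+y. ennreal (y powr (2 * (c - 1))) * ennreal ((cmod (fourier H (- ln y)))\<^sup>2) \<partial>P)"
  proof (intro nn_integral_mono)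
    fix y :: real
    have "(y powr (c - 1))\<^sup>2 = y powr (2 * (c - 1))" by (simp add: power2_eq_square flip: powr_add)
    thus "ennreal ((cmod (\<beta> y))\<^sup>2) \<le> ennreal (y powr (2 * (c - 1))) * ennreal ((cmod (fourier H (- ln y)))\<^sup>2)"
      by (auto simp: \<beta>_eq norm_mult power_mult_distrib ennreal_mult)
  qed
  also have "\<dots> \<le> ennreal B * (\<integral>\<^sup>+y. ennreal ((cmod (fourier H (- ln y)))\<^sup>2) * ennreal (1 / y) \<partial>Rplus)"
    by (rule weighted_P_le[OF fm])
  also have "(\<integral>\<^sup>+y. ennreal ((cmod (fourier H (- ln y)))\<^sup>2) * ennreal (1 / y) \<partial>Rplus) = norm2 (fourier H)"
  proof -
    have m1: "(\<lambda>y. ennreal ((cmod (fourier H (- ln y)))\<^sup>2) * ennreal (1 / y)) \<in> borel_measurable Rplus"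
      by (rule borel_measurable_imp_Rplus) measurable
    have "(\<integral>\<^sup>+y. ennreal ((cmod (fourier H (- ln y)))\<^sup>2) * ennreal (1 / y) \<partial>Rplus)
      = (\<integral>\<^sup>+u. ennreal ((cmod (fourier H (- u)))\<^sup>2) \<partial>lborel)"
      unfolding nn_integral_Rplus_exp[OF m1]
      by (intro nn_integral_cong) (simp add: mult.assoc ennreal_mult[symmetric])
    also have "\<dots> = norm2 (fourier H)"
      unfolding norm2_def by (subst (2) nn_integral_real_affine[of _ "-1" 0]) auto
    finally show ?thesis .
  qed
  also have "norm2 (fourier H) \<le> ennreal (2 * pi) * norm2 H" by (rule norm2_fourier_le[OF H])
  also have "norm2 H \<le> ennreal ((real k)\<^sup>2) * ennreal (LINT t|ridge_measure k. (cmod (h t))\<^sup>2)"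
  proof -
    have "norm2 H \<le> (\<integral>\<^sup>+t. ennreal ((real k)\<^sup>2) * (ennreal ((cmod (R k t))\<^sup>2) * ennreal ((cmod (h t))\<^sup>2)) \<partial>lborel)"
      unfolding norm2_def
    proof (rule nn_integral_mono)
      fix t
      have "(cmod (R k t))\<^sup>2 \<le> (real k)\<^sup>2" by (intro power_mono cmod_R_le k) auto
      hence "(cmod (R k t))\<^sup>2 * ((cmod (R k t))\<^sup>2 * (cmod (h t))\<^sup>2) \<le> (real k)\<^sup>2 * ((cmod (R k t))\<^sup>2 * (cmod (h t))\<^sup>2)"
        by (intro mult_right_mono) auto
      moreover have "(cmod (H t))\<^sup>2 = (cmod (R k t))\<^sup>2 * ((cmod (R k t))\<^sup>2 * (cmod (h t))\<^sup>2)"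
        by (simp add: H_def norm_mult norm_power power2_eq_square mult_ac)
      ultimately show "ennreal ((cmod (H t))\<^sup>2) \<le> ennreal ((real k)\<^sup>2) * (ennreal ((cmod (R k t))\<^sup>2) * ennreal ((cmod (h t))\<^sup>2))"
        by (simp add: ennreal_mult[symmetric] ennreal_leI)
    qed
    also have "\<dots> = ennreal ((real k)\<^sup>2) * (\<integral>\<^sup>+t. ennreal ((cmod (h t))\<^sup>2) \<partial>ridge_measure k)"
      by (subst nn_integral_ridge_measure) (auto intro!: nn_integral_cmult)
    also have "(\<integral>\<^sup>+t. ennreal ((cmod (h t))\<^sup>2) \<partial>ridge_measure k) = ennreal (LINT t|ridge_measure k. (cmod (h t))\<^sup>2)"
      by (rule nn_integral_eq_integral[OF ih2]) simp
    finally show ?thesis .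
  qed
  finally have "(\<integral>\<^sup>+y. ennreal ((Re (\<beta> y - (LINT y|P. \<beta> y)))\<^sup>2) \<partial>P)
      \<le> ennreal B * (ennreal (2 * pi) * (ennreal ((real k)\<^sup>2) * ennreal (LINT t|ridge_measure k. (cmod (h t))\<^sup>2)))"
    by (simp add: mult_left_mono)
  also have "\<dots> = ennreal (2 * pi * B * (real k)\<^sup>2 * (LINT t|ridge_measure k. (cmod (h t))\<^sup>2))"
    using B_pos by (simp add: ennreal_mult[symmetric] Bochner_Integration.integral_nonneg mult_ac)
  finally have fin: "(\<integral>\<^sup>+y. ennreal ((Re (\<beta> y - (LINT y|P. \<beta> y)))\<^sup>2) \<partial>P)
      \<le> ennreal (2 * pi * B * (real k)\<^sup>2 * (LINT t|ridge_measure k. (cmod (h t))\<^sup>2))" .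
  have "integrable P (\<lambda>y. (Re (\<beta> y - (LINT y|P. \<beta> y)))\<^sup>2)"
    using fin by (intro integrableI_bounded) (auto intro: le_less_trans)
  hence "ennreal (LINT y|P. (Re (\<beta> y - (LINT y|P. \<beta> y)))\<^sup>2) \<le> ennreal (2 * pi * B * (real k)\<^sup>2 * (LINT t|ridge_measure k. (cmod (h t))\<^sup>2))"
    using fin by (subst nn_integral_eq_integral[symmetric]) auto
  thus ?thesis unfolding eq
    using B_pos by (subst (asm) ennreal_le_iff) (auto intro!: mult_nonneg_nonneg Bochner_Integration.integral_nonneg)
qed

lemma centered_trunc:
  assumes k: "1 \<le> k" and d: "0 < d"
  shows "centered_random_function P (ridge_measure k) (trunc_centered d) (2 * d) (2 * pi * B * (real k)\<^sup>2) (s * ridge_sq k) (2 * d * sqrt (ridge_sq k))"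
proof -
  interpret N: finite_measure "ridge_measure k" by (rule finite_measure_ridge_measure(1)[OF k])
  interpret PN: pair_sigma_finite P "ridge_measure k" ..
  have meas: "(\<lambda>(y, t). trunc_centered d y t) \<in> borel_measurable (P \<Otimes>\<^sub>M ridge_measure k)"
  proof -
    have a: "(\<lambda>p. trunc_kernel c d (fst p) (snd p)) \<in> borel_measurable (P \<Otimes>\<^sub>M ridge_measure k)"
      using kernel_joint_measurable(2)[OF sets_ridge_measure, of d k] by (simp add: split_beta)
    have "(\<lambda>t. LINT y|P. trunc_kernel c d y t) \<in> borel_measurable (ridge_measure k)"
      unfolding measurable_cong_sets[OF sets_ridge_measure refl] by (rule mean_trunc_measurable)
    from measurable_compose[OF measurable_snd[of P "ridge_measure k"] this] a
    show ?thesis unfolding trunc_centered_def split_beta by (intro borel_measurable_diff)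
  qed
  have bd: "cmod (trunc_centered d y t) \<le> 2 * d" for y t
    using norm_triangle_ineq4[of "trunc_kernel c d y t" "LINT y|P. trunc_kernel c d y t"]
      cmod_trunc_kernel(1)[of d c y t] cmod_mean_trunc[of d t] d unfolding trunc_centered_def by linarith
  have mN: "trunc_centered d y \<in> borel_measurable (ridge_measure k)" for y
    unfolding measurable_cong_sets[OF sets_ridge_measure refl] trunc_centered_def
    by (intro borel_measurable_diff kernel_measurable mean_trunc_measurable) auto
  have bd2: "(cmod (trunc_centered d y t))\<^sup>2 \<le> (2 * d)\<^sup>2" for y t by (intro power_mono bd) auto
  have sqi: "integrable (ridge_measure k) (\<lambda>t. (cmod (trunc_centered d y t))\<^sup>2)" for y
  proof (rule N.integrable_const_bound[where B = "(2 * d)\<^sup>2"])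
    show "AE t in ridge_measure k. norm ((cmod (trunc_centered d y t))\<^sup>2) \<le> (2 * d)\<^sup>2" using bd2 by (intro AE_I2) simp
  qed (use mN in measurable)
  have sup: "(LINT t|ridge_measure k. (cmod (trunc_centered d y t))\<^sup>2) \<le> (2 * d * sqrt (ridge_sq k))\<^sup>2" for y
  proof -
    have "(LINT t|ridge_measure k. (cmod (trunc_centered d y t))\<^sup>2) \<le> (LINT t|ridge_measure k. (2 * d)\<^sup>2)"
      using sqi by (rule integral_mono) (simp, rule bd2)
    also have "\<dots> = (2 * d * sqrt (ridge_sq k))\<^sup>2"
      using finite_measure_ridge_measure(2)[OF k] ridge_sq_nonneg[of k] by (simp add: power_mult_distrib)
    finally show ?thesis .
  qed
  have sm: "(\<lambda>y. LINT t|ridge_measure k. (cmod (trunc_centered d y t))\<^sup>2) \<in> borel_measurable P"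
  proof -
    have "(\<lambda>(y, t). (cmod (trunc_centered d y t))\<^sup>2) \<in> borel_measurable (P \<Otimes>\<^sub>M ridge_measure k)"
      using meas by (simp add: split_beta)
    from N.borel_measurable_lebesgue_integral[OF this] show ?thesis .
  qed
  have strong: "(LINT y|P. LINT t|ridge_measure k. (cmod (trunc_centered d y t))\<^sup>2) \<le> s * ridge_sq k"
  proof -
    have nn: "0 \<le> (LINT t|ridge_measure k. (cmod (trunc_centered d y t))\<^sup>2)" for y
      by (intro Bochner_Integration.integral_nonneg) simp
    have i: "integrable P (\<lambda>y. LINT t|ridge_measure k. (cmod (trunc_centered d y t))\<^sup>2)"
      by (rule P.integrable_const_bound[OF _ sm, where B = "(2 * d * sqrt (ridge_sq k))\<^sup>2"])
         (use sup nn in \<open>intro AE_I2, simp\<close>)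
    have "ennreal (LINT y|P. LINT t|ridge_measure k. (cmod (trunc_centered d y t))\<^sup>2)
        = (\<integral>\<^sup>+y. ennreal (LINT t|ridge_measure k. (cmod (trunc_centered d y t))\<^sup>2) \<partial>P)"
      by (rule nn_integral_eq_integral[OF i, symmetric]) (simp add: nn)
    also have "\<dots> = (\<integral>\<^sup>+y. (\<integral>\<^sup>+t. ennreal ((cmod (trunc_centered d y t))\<^sup>2) \<partial>ridge_measure k) \<partial>P)"
      by (simp add: nn_integral_eq_integral[OF sqi])
    also have "\<dots> = (\<integral>\<^sup>+t. (\<integral>\<^sup>+y. ennreal ((cmod (trunc_centered d y t))\<^sup>2) \<partial>P) \<partial>ridge_measure k)"
      by (rule PN.Fubini'[symmetric]) (use meas in \<open>simp add: split_beta\<close>)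
    also have "\<dots> \<le> (\<integral>\<^sup>+t. ennreal s \<partial>ridge_measure k)"
      by (intro nn_integral_mono) (unfold trunc_centered_def, rule order_trans[OF nn_integral_variance_le[OF P_prob trunc_kernel_integrable] trunc_kernel_square])
    also have "\<dots> = ennreal (s * ridge_sq k)"
      using finite_measure_ridge_measure(2)[OF k] s_pos ridge_sq_nonneg[of k]
      by (simp add: N.emeasure_eq_measure ennreal_mult)
    finally show ?thesis using s_pos ridge_sq_nonneg[of k] by simp
  qed
  show ?thesis
  proof (unfold_locales)
    show "(\<lambda>(y, t). trunc_centered d y t) \<in> borel_measurable (P \<Otimes>\<^sub>M ridge_measure k)" by (rule meas)
    show "cmod (trunc_centered d y t) \<le> 2 * d" for y t by (rule bd)
    show "(LINT y|P. trunc_centered d y t) = 0" for t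
      unfolding trunc_centered_def using trunc_kernel_integrable by (simp add: P.prob_space)
    show "(LINT y|P. (Re (LINT t|ridge_measure k. h t * cnj (trunc_centered d y t)))\<^sup>2) \<le> 2 * pi * B * (real k)\<^sup>2 * (LINT t|ridge_measure k. (cmod (h t))\<^sup>2)"
      if "h \<in> borel_measurable (ridge_measure k)" "\<And>t. cmod (h t) \<le> C" for h C
      using that unfolding measurable_cong_sets[OF sets_ridge_measure refl] by (intro weak_variance_trunc[OF k d])
    show "(LINT y|P. LINT t|ridge_measure k. (cmod (trunc_centered d y t))\<^sup>2) \<le> s * ridge_sq k" by (rule strong)
    show "(LINT t|ridge_measure k. (cmod (trunc_centered d y t))\<^sup>2) \<le> (2 * d * sqrt (ridge_sq k))\<^sup>2" for y by (rule sup)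
    show "0 < 2 * d * sqrt (ridge_sq k)" using d ridge_sq_pos[OF k] by simp
    show "0 \<le> 2 * pi * B * (real k)\<^sup>2" using B_pos by simp
  qed
qed

text \<open>The factor \<open>sqrt s / 2\<close> gives the norm bound
  \<open>2 * level n * sqrt (ridge_sq k)\<close> the form \<open>sqrt a * n powr (1/3)\<close> with
  \<open>a = s * ridge_sq k\<close>, which is at most \<open>L = sqrt (n * a)\<close>.\<close>

definition level :: "nat \<Rightarrow> real" where
  "level n = sqrt s * real n powr (1/3) / 2"

lemma level_pos: "1 \<le> n \<Longrightarrow> 0 < level n"
  using s_pos by (simp add: level_def)

text \<open>Formed with the sum over the sample, not the mean; the factor
  \<open>1 / n\<^sup>2\<close> enters in \<open>stochastic_bias_bound\<close>.\<close>

definition trunc_err :: "nat \<Rightarrow> nat \<Rightarrow> (nat \<Rightarrow> real) \<Rightarrow> ennreal" where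
  "trunc_err n k Y = norm2 (\<lambda>t. (\<Sum>i<n. trunc_kernel c (level n) (Y i) t - (LINT y|P. trunc_kernel c (level n) y t)) * R k t)"

text \<open>The parameter \<open>mu\<close> of the exponential bound is \<open>min (L / (n v)) (1 / (2 M))\<close>; the first value
  produces \<open>tail_term\<close> and the second one \<open>tail_rate\<close>.\<close>

lemma trunc_err_tail:
  assumes n: "1 \<le> n" and k: "k \<in> Kset c g r n"
  shows "(\<integral>\<^sup>+Y. (trunc_err n k Y - ennreal (100 * real n * s * ridge_sq k)) \<partial>sample_law f g n)
    \<le> ennreal (real n * (tail_term s B k + tail_rate s n))"
proof -
  have k1: "1 \<le> k" and kn: "ridge_sq k \<le> real n" using k by (simp_all add: Kset_iff)
  define d where "d = level n"
  define v where "v = 2 * pi * B * (real k)\<^sup>2"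
  define a where "a = s * ridge_sq k"
  define M where "M = 2 * d * sqrt (ridge_sq k)"
  interpret C: centered_random_function P "ridge_measure k" "trunc_centered d" "2 * d" v a M
    unfolding v_def a_def M_def d_def by (rule centered_trunc[OF k1 level_pos[OF n]])
  \<comment> \<open>The root of the bound on the expected squared norm of the sum, so the hypothesis
    of \<open>tail_bound\<close> holds with equality.\<close>
  define L where "L = sqrt (real n * a)"
  have a: "0 < a" using s_pos ridge_sq_pos[OF k1] by (simp add: a_def)
  have v: "0 < v" using B_pos k1 by (simp add: v_def)
  have L: "0 < L" and L2: "L\<^sup>2 = real n * a" using a n by (simp_all add: L_def)
  have M_eq: "M = sqrt a * real n powr (1/3)"
    by (simp add: M_def d_def level_def a_def real_sqrt_mult)
  have sqn: "sqrt (real n) = real n powr (1/2)" using n by (simp add: powr_half_sqrt)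
  have M_le_L: "M \<le> L"
  proof -
    have "real n powr (1/3) \<le> real n powr (1/2)" using n by (intro powr_mono) auto
    thus ?thesis using a by (simp add: M_eq L_def real_sqrt_mult sqn mult.commute mult_left_mono)
  qed
  have LM: "L / (2 * M) = real n powr (1/6) / 2"
  proof -
    have "real n powr (1/2) = real n powr (1/3) * real n powr (1/6)" by (simp flip: powr_add)
    thus ?thesis using a n by (simp add: M_eq L_def real_sqrt_mult sqn field_simps)
  qed
  define mu where "mu = min (L / (real n * v)) (1 / (2 * M))"
  have mu: "0 < mu" using L v n C.M_pos by (simp add: mu_def)
  have mu1: "2 * mu * M \<le> 1"
  proof -
    have "mu \<le> 1 / (2 * M)" by (simp add: mu_def)
    thus ?thesis using C.M_pos by (simp add: field_simps)
  qed
  have mu2: "real n * v * mu \<le> L"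
  proof -
    have "mu \<le> L / (real n * v)" by (simp add: mu_def)
    thus ?thesis using v n by (simp add: field_simps)
  qed
  define x where "x = mu * L"
  have x: "0 < x" using mu L by (simp add: x_def)
  have eq: "ennreal (C.sq (\<lambda>t. \<Sum>i<n. trunc_centered d (Y i) t) - (10 * L)\<^sup>2) = trunc_err n k Y - ennreal (100 * real n * s * ridge_sq k)" for Y
  proof -
    have mb: "(\<lambda>t. \<Sum>i<n. trunc_centered d (Y i) t) \<in> borel_measurable borel"
      unfolding trunc_centered_def
      by (intro borel_measurable_sum borel_measurable_diff kernel_measurable mean_trunc_measurable) auto
    have mb': "(\<lambda>t. \<Sum>i<n. trunc_centered d (Y i) t) \<in> borel_measurable (ridge_measure k)"
      using mb unfolding measurable_cong_sets[OF sets_ridge_measure refl] .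
    have "cmod (\<Sum>i<n. trunc_centered d (Y i) t) \<le> real n * (2 * d)" for t
      using sum_norm_bound[of "{..<n}" "\<lambda>i. trunc_centered d (Y i) t" "2 * d"] C.bounded by simp
    from C.integrable_sq[OF mb' this]
    have "ennreal (C.sq (\<lambda>t. \<Sum>i<n. trunc_centered d (Y i) t)) = (\<integral>\<^sup>+t. ennreal ((cmod (\<Sum>i<n. trunc_centered d (Y i) t))\<^sup>2) \<partial>ridge_measure k)"
      by (subst nn_integral_eq_integral) auto
    also have "\<dots> = trunc_err n k Y"
      unfolding norm2_mult_R[OF mb, symmetric] by (simp add: trunc_err_def trunc_centered_def d_def)
    finally have "ennreal (C.sq (\<lambda>t. \<Sum>i<n. trunc_centered d (Y i) t)) = trunc_err n k Y" .
    moreover have "(10 * L)\<^sup>2 = 100 * real n * s * ridge_sq k" by (simp add: power_mult_distrib L2 a_def)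
    moreover have "ennreal (C.sq (\<lambda>t. \<Sum>i<n. trunc_centered d (Y i) t) - (10 * L)\<^sup>2)
        = ennreal (C.sq (\<lambda>t. \<Sum>i<n. trunc_centered d (Y i) t)) - ennreal ((10 * L)\<^sup>2)"
      by (rule ennreal_minus[symmetric]) simp
    ultimately show ?thesis by (simp only:)
  qed
  have "(\<integral>\<^sup>+Y. (trunc_err n k Y - ennreal (100 * real n * s * ridge_sq k)) \<partial>sample_law f g n)
      \<le> ennreal ((2 / mu\<^sup>2 + 2 * (10 * L) / mu) * exp (2 * mu * L + 2 * real n * mu\<^sup>2 * v - mu * (10 * L)))"
    unfolding eq[symmetric] sample_law_def
    using L L2 by (intro C.tail_bound[OF L M_le_L mu mu1]) auto
  \<comment> \<open>The threshold is \<open>b = 10 * L\<close>. With \<open>x = mu * L\<close> and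
    \<open>n * v * mu \<le> L\<close> the exponent is at most
    \<open>2 * x + 2 * x - 10 * x\<close>.\<close>
  also have "\<dots> \<le> ennreal ((2 + 20 * x) / mu\<^sup>2 * exp (- 6 * x))"
  proof (intro ennreal_leI mult_mono)
    show "2 / mu\<^sup>2 + 2 * (10 * L) / mu \<le> (2 + 20 * x) / mu\<^sup>2"
      using mu by (simp add: x_def field_simps power2_eq_square)
    have "mu * (real n * v * mu) \<le> mu * L" using mu mu2 by (intro mult_left_mono) auto
    hence "2 * real n * mu\<^sup>2 * v \<le> 2 * x" by (simp add: x_def power2_eq_square mult_ac)
    moreover have "mu * (10 * L) = 10 * x" "2 * mu * L = 2 * x" by (simp_all add: x_def)
    ultimately show "exp (2 * mu * L + 2 * real n * mu\<^sup>2 * v - mu * (10 * L)) \<le> exp (- 6 * x)"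
      unfolding exp_le_cancel_iff by linarith
  qed (use x mu in auto)
  also have "\<dots> \<le> ennreal (real n * (tail_term s B k + tail_rate s n))"
  proof (rule ennreal_leI)
    have t1: "0 \<le> tail_term s B k" using s_pos B_pos by (intro tail_term_nonneg) auto
    have t2: "0 \<le> tail_rate s n" using s_pos by (simp add: tail_rate_def)
    consider "mu = L / (real n * v)" | "mu = 1 / (2 * M)" unfolding mu_def by linarith
    thus "(2 + 20 * x) / mu\<^sup>2 * exp (- 6 * x) \<le> real n * (tail_term s B k + tail_rate s n)"
    proof cases
      \<comment> \<open>Here the weak variance limits \<open>mu\<close>; \<open>x\<close> becomes
        \<open>a / v\<close>, and \<open>1 / mu\<^sup>2\<close> becomes
        \<open>n * v / x\<close>.\<close>
      case 1
      have "x = L\<^sup>2 / (real n * v)" by (simp add: x_def 1 power2_eq_square)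
      also have "\<dots> = a / v" using n by (simp add: L2)
      finally have xav: "x = a / v" .
      have xt: "x = tail_x s B k" unfolding xav by (simp add: tail_x_def a_def v_def)
      have "1 / mu\<^sup>2 = (real n * v)\<^sup>2 / L\<^sup>2" by (simp add: 1 power_divide)
      also have "\<dots> = real n * (v / x)"
        using a v n unfolding L2 xav by (simp add: power2_eq_square)
      finally have m2: "1 / mu\<^sup>2 = real n * (v / x)" .
      have "(2 + 20 * x) / mu\<^sup>2 * exp (- 6 * x) = (2 + 20 * x) * (1 / mu\<^sup>2) * exp (- 6 * x)" by simp
      also have "\<dots> = real n * tail_term s B k"
        unfolding m2 tail_term_def xt[symmetric] v_def by simp
      finally show ?thesis using t2 by (simp add: distrib_left)
    next
      \<comment> \<open>Here the norm bound \<open>M\<close> limits \<open>mu\<close>. The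
        polynomial factor costs one \<open>exp x\<close> out of six.\<close>
      case 2
      have x6: "x = real n powr (1/6) / 2" using LM by (simp add: x_def 2)
      have "2 + 20 * x \<le> 20 * exp x" using exp_ge_add_one_self[of x] by linarith
      hence "(2 + 20 * x) * exp (- 6 * x) \<le> 20 * exp x * exp (- 6 * x)"
        by (rule mult_right_mono) simp
      also have "\<dots> = 20 * exp (- 5 * x)" by (simp flip: exp_add)
      finally have e: "(2 + 20 * x) * exp (- 6 * x) \<le> 20 * exp (- 5 * x)" .
      have "1 / mu\<^sup>2 = 4 * M\<^sup>2" by (simp add: 2 power_divide power_mult_distrib)
      also have "\<dots> = 4 * (a * real n powr (2/3))"
        using a by (simp add: M_eq power_mult_distrib) (simp add: power2_eq_square flip: powr_add)
      also have "\<dots> \<le> 4 * (s * real n * real n powr (2/3))"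
        using kn s_pos unfolding a_def by (intro mult_left_mono mult_right_mono) auto
      finally have m2: "1 / mu\<^sup>2 \<le> 4 * (s * real n * real n powr (2/3))" .
      have "(2 + 20 * x) / mu\<^sup>2 * exp (- 6 * x) = (1 / mu\<^sup>2) * ((2 + 20 * x) * exp (- 6 * x))" by simp
      also have "\<dots> \<le> 4 * (s * real n * real n powr (2/3)) * (20 * exp (- 5 * x))"
        using x mu s_pos by (intro mult_mono[OF m2 e]) auto
      also have "\<dots> = real n * tail_rate s n" by (simp add: tail_rate_def x6)
      also have "\<dots> \<le> real n * (tail_term s B k + tail_rate s n)" using t1 by (intro mult_left_mono) auto
      finally show ?thesis .
    qed
  qed
  finally show ?thesis .
qed

end

section \<open>The oracle inequality\<close>

lemma cmod_add_square_le: "(cmod (x + y))\<^sup>2 \<le> 2 * (cmod x)\<^sup>2 + 2 * (cmod y)\<^sup>2"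
proof -
  have "(cmod (x + y))\<^sup>2 \<le> (cmod x + cmod y)\<^sup>2" by (intro power_mono norm_triangle_ineq) auto
  also have "\<dots> \<le> 2 * (cmod x)\<^sup>2 + 2 * (cmod y)\<^sup>2"
    using zero_le_power2[of "cmod x - cmod y"] by (simp add: power2_diff power2_sum)
  finally show ?thesis .
qed

lemma norm2_mono: "(\<And>t. cmod (H t) \<le> cmod (K t)) \<Longrightarrow> norm2 H \<le> norm2 K"
  unfolding norm2_def by (intro nn_integral_mono ennreal_leI power_mono) auto

lemma norm2_add_le:
  assumes [measurable]: "H \<in> borel_measurable borel" "K \<in> borel_measurable borel"
  shows "norm2 (\<lambda>t. H t + K t) \<le> 2 * norm2 H + 2 * norm2 K"
proof -
  have "norm2 (\<lambda>t. H t + K t) \<le> (\<integral>\<^sup>+t. 2 * ennreal ((cmod (H t))\<^sup>2) + 2 * ennreal ((cmod (K t))\<^sup>2) \<partial>lborel)"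
    unfolding norm2_def
  proof (rule nn_integral_mono)
    fix t
    have "ennreal ((cmod (H t + K t))\<^sup>2) \<le> ennreal (2 * (cmod (H t))\<^sup>2 + 2 * (cmod (K t))\<^sup>2)"
      by (intro ennreal_leI cmod_add_square_le)
    thus "ennreal ((cmod (H t + K t))\<^sup>2) \<le> 2 * ennreal ((cmod (H t))\<^sup>2) + 2 * ennreal ((cmod (K t))\<^sup>2)"
      by (simp add: ennreal_mult)
  qed
  also have "\<dots> = 2 * norm2 H + 2 * norm2 K"
    unfolding norm2_def by (simp add: nn_integral_add nn_integral_cmult)
  finally show ?thesis .
qed

lemma norm2_scale:
  assumes [measurable]: "H \<in> borel_measurable borel"
  shows "norm2 (\<lambda>t. of_real a * H t) = ennreal (a\<^sup>2) * norm2 H"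
  unfolding norm2_def by (subst nn_integral_cmult[symmetric]) (auto simp: norm_mult power_mult_distrib ennreal_mult)

lemma wnorm2_add3_le:
  assumes [measurable]: "a \<in> borel_measurable Rplus" "b \<in> borel_measurable Rplus" "d \<in> borel_measurable Rplus"
  shows "wnorm2 c (\<lambda>x. a x + b x + d x) \<le> 3 * (wnorm2 c a + wnorm2 c b + wnorm2 c d)"
proof -
  let ?w = "\<lambda>h x. (cmod (h x))\<^sup>2 * x powr (2 * c - 1)"
  have "wnorm2 c (\<lambda>x. a x + b x + d x) \<le> (\<integral>\<^sup>+x. 3 * (ennreal (?w a x) + ennreal (?w b x) + ennreal (?w d x)) \<partial>Rplus)"
    unfolding wnorm2_def
  proof (rule nn_integral_mono)
    fix x
    have "(cmod (a x + b x + d x))\<^sup>2 \<le> (cmod (a x) + cmod (b x) + cmod (d x))\<^sup>2"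
      by (intro power_mono norm_triangle_le add_right_mono norm_triangle_ineq) auto
    also have "\<dots> \<le> 3 * ((cmod (a x))\<^sup>2 + (cmod (b x))\<^sup>2 + (cmod (d x))\<^sup>2)"
      using zero_le_power2[of "cmod (a x) - cmod (b x)"] zero_le_power2[of "cmod (a x) - cmod (d x)"]
        zero_le_power2[of "cmod (b x) - cmod (d x)"]
      by (simp add: power2_eq_square algebra_simps)
    finally have "(cmod (a x + b x + d x))\<^sup>2 * x powr (2 * c - 1)
        \<le> 3 * ((cmod (a x))\<^sup>2 + (cmod (b x))\<^sup>2 + (cmod (d x))\<^sup>2) * x powr (2 * c - 1)"
      by (rule mult_right_mono) simp
    hence "ennreal ((cmod (a x + b x + d x))\<^sup>2 * x powr (2 * c - 1)) \<le> ennreal (3 * (?w a x + ?w b x + ?w d x))"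
      by (intro ennreal_leI) (simp add: algebra_simps)
    thus "ennreal ((cmod (a x + b x + d x))\<^sup>2 * x powr (2 * c - 1)) \<le> 3 * (ennreal (?w a x) + ennreal (?w b x) + ennreal (?w d x))"
      by (simp add: ennreal_mult)
  qed
  also have "\<dots> = 3 * (wnorm2 c a + wnorm2 c b + wnorm2 c d)"
    unfolding wnorm2_def by (simp add: nn_integral_add nn_integral_cmult)
  finally show ?thesis .
qed

lemma wnorm2_minus_commute: "wnorm2 c (\<lambda>x. a x - b x) = wnorm2 c (\<lambda>x. b x - a x)"
  unfolding wnorm2_def by (simp add: norm_minus_commute)

lemma mellin_inv_diff:
  assumes H: "integrable lborel H" and K: "integrable lborel K" and x: "0 < x"
  shows "mellin_inv c H x - mellin_inv c K x = mellin_inv c (\<lambda>t. H t - K t) x"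
proof -
  have i: "integrable lborel (\<lambda>t. F t * cis (t * (- ln x)))" if "integrable lborel F" for F
    by (rule integrable_mult_bounded(1)[OF that, of _ 1]) auto
  have "fourier (\<lambda>t. H t - K t) (- ln x) = fourier H (- ln x) - fourier K (- ln x)"
    unfolding fourier_def left_diff_distrib by (rule Bochner_Integration.integral_diff[OF i[OF H] i[OF K]])
  thus ?thesis by (simp add: mellin_inv_eq_fourier[OF x] diff_divide_distrib right_diff_distrib)
qed

lemma ennreal_le_diff_add: "(a::ennreal) \<le> (a - b) + b"
proof (cases "b \<le> a")
  case True
  thus ?thesis by (simp add: diff_add_cancel_ennreal)
next
  case False
  hence "a \<le> b" by simp
  thus ?thesis by (rule order_trans) simp
qed

lemma ennreal_diff_leI: "(a::ennreal) \<le> b + d \<Longrightarrow> b < \<infinity> \<Longrightarrow> a - b \<le> d"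
  by (auto simp: ennreal_minus_le_iff)

section \<open>Decomposition of the loss and of \<open>Ahat\<close>\<close>

context deconvolution
begin

definition tail_err :: "nat \<Rightarrow> nat \<Rightarrow> (nat \<Rightarrow> real) \<Rightarrow> ennreal" where
  "tail_err n k Y = norm2 (\<lambda>t. (\<Sum>i<n. tail_kernel c (level n) (Y i) t - (LINT y|P. tail_kernel c (level n) y t)) * R k t)"

definition stoch_err :: "nat \<Rightarrow> nat \<Rightarrow> (nat \<Rightarrow> real) \<Rightarrow> ennreal" where
  "stoch_err n k Y = norm2 (\<lambda>t. (\<Sum>i<n. mellin_kernel c (Y i) t - (LINT y|P. mellin_kernel c y t)) * R k t)"

definition bias :: "nat \<Rightarrow> ennreal" where
  "bias k = norm2 (\<lambda>t. indicator (Gset c g (real k)) t * mellin c f t)"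

lemma f_measurable: "f \<in> borel_measurable Rplus"
  by (rule pos_density_measurable[OF f_density])

lemma mellin_f_measurable [measurable]: "mellin c f \<in> borel_measurable borel"
  by (rule borel_measurable_mellin[OF f_measurable])

lemma mellin_Y_measurable [measurable]: "mellin_Y \<in> borel_measurable borel"
  unfolding mellin_Y_def by measurable

lemma mean_tail_measurable: "(\<lambda>t. LINT y|P. tail_kernel c d y t) \<in> borel_measurable borel"
proof -
  have "(\<lambda>t. LINT y|P. tail_kernel c d y t) = (\<lambda>t. mellin_Y t - (LINT y|P. trunc_kernel c d y t))"
    by (simp add: fun_eq_iff expectation_split[of _ d])
  thus ?thesis using mean_trunc_measurable by simp
qed

definition kernel_sum :: "nat \<Rightarrow> (nat \<Rightarrow> real) \<Rightarrow> real \<Rightarrow> complex" where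
  "kernel_sum n Y t = (\<Sum>i<n. mellin_kernel c (Y i) t - mellin_Y t)"

lemma kernel_sum_measurable [measurable]: "kernel_sum n Y \<in> borel_measurable borel"
  unfolding kernel_sum_def by (intro borel_measurable_sum borel_measurable_diff kernel_measurable) auto

lemma stoch_err_eq: "stoch_err n k Y = norm2 (\<lambda>t. kernel_sum n Y t * R k t)"
  by (simp add: stoch_err_def kernel_sum_def kernel_expectation)

lemma stoch_err_le: "stoch_err n k Y \<le> 2 * trunc_err n k Y + 2 * tail_err n k Y"
proof -
  have "stoch_err n k Y = norm2 (\<lambda>t. (\<Sum>i<n. trunc_kernel c (level n) (Y i) t - (LINT y|P. trunc_kernel c (level n) y t)) * R k t
     + (\<Sum>i<n. tail_kernel c (level n) (Y i) t - (LINT y|P. tail_kernel c (level n) y t)) * R k t)"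
    unfolding stoch_err_eq kernel_sum_def unfolding kernel_split[of c _ _ "level n"] expectation_split[of _ "level n"]
    by (simp only: add_diff_add sum.distrib distrib_right)
  also have "\<dots> \<le> 2 * trunc_err n k Y + 2 * tail_err n k Y"
    unfolding trunc_err_def tail_err_def
    by (intro norm2_add_le borel_measurable_times borel_measurable_sum borel_measurable_diff kernel_measurable
        mean_trunc_measurable mean_tail_measurable R_measurable) auto
  finally show ?thesis .
qed

text \<open>All tail errors are dominated by the one at the largest parameter. Each is of order 1/n
  after normalisation, so summing them over \<open>Kset\<close> would be too expensive.\<close>

lemma tail_err_mono: "1 \<le> k \<Longrightarrow> k \<le> k' \<Longrightarrow> tail_err n k Y \<le> tail_err n k' Y"
  unfolding tail_err_def by (intro norm2_mono) (simp add: norm_mult mult_left_mono cmod_R_mono)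

lemma emp_eq:
  assumes n: "1 \<le> n" and Y: "\<And>i. i < n \<Longrightarrow> 0 < Y i"
  shows "emp_mellin c n Y t = of_real (1 / real n) * kernel_sum n Y t + mellin_Y t"
proof -
  have "(\<Sum>i<n. of_real (Y i) powr Complex (c - 1) t) = (\<Sum>i<n. mellin_kernel c (Y i) t)"
    by (intro sum.cong refl) (simp add: mellin_kernel_def powr_Complex Y)
  also have "\<dots> = kernel_sum n Y t + of_nat n * mellin_Y t" by (simp add: kernel_sum_def sum_subtractf)
  finally show ?thesis using n by (simp add: emp_mellin_def field_simps)
qed

text \<open>For a fixed sample the empirical transform is bounded by the mean of the
  \<open>Y i powr (c - 1)\<close>, so the integrability of the multiplier carries over.\<close>

lemma emp_R_integrable:
  assumes Y: "\<And>i. i < n \<Longrightarrow> 0 < Y i" and k: "1 \<le> k"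
  shows "integrable lborel (\<lambda>t. emp_mellin c n Y t * R k t)"
    and "norm2 (\<lambda>t. emp_mellin c n Y t * R k t) < \<infinity>"
proof -
  have eq: "emp_mellin c n Y = (\<lambda>t. (\<Sum>i<n. mellin_kernel c (Y i) t) / of_nat n)"
    unfolding emp_mellin_def by (intro ext arg_cong2[where f = "(/)"] sum.cong refl) (simp add: mellin_kernel_def powr_Complex Y)
  have [measurable]: "emp_mellin c n Y \<in> borel_measurable borel"
    unfolding eq by (intro borel_measurable_divide borel_measurable_sum kernel_measurable) auto
  define C where "C = (\<Sum>i<n. Y i powr (c - 1)) / real n"
  have b: "cmod (emp_mellin c n Y t) \<le> C" for t
    unfolding eq C_def norm_divide by (auto intro!: divide_right_mono sum_norm_le)
  have C0: "0 \<le> C" using b[of 0] norm_ge_zero order_trans by blast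
  show i: "integrable lborel (\<lambda>t. emp_mellin c n Y t * R k t)"
    by (rule integrable_mult_bounded(2)[OF R_integrable[OF k] _ b]) simp
  have "norm2 (\<lambda>t. emp_mellin c n Y t * R k t) \<le> norm2 (\<lambda>t. of_real C * R k t)"
    using b C0 by (intro norm2_mono) (auto simp: norm_mult intro: mult_right_mono)
  also have "\<dots> < \<infinity>" by (simp add: norm2_scale norm2_R[OF k] ennreal_mult_less_top)
  finally show "norm2 (\<lambda>t. emp_mellin c n Y t * R k t) < \<infinity>" .
qed

lemma fhat_eq: "fhat c g r n Y (real k) = mellin_inv c (\<lambda>t. emp_mellin c n Y t * R k t)"
  by (simp add: fun_eq_iff fhat_def mellin_inv_def mult.assoc)

lemma fhat_measurable:
  assumes "\<And>i. i < n \<Longrightarrow> 0 < Y i" "1 \<le> k"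
  shows "fhat c g r n Y (real k) \<in> borel_measurable Rplus"
  unfolding fhat_eq using emp_R_integrable(1)[OF assms] by (intro borel_measurable_mellin_inv) auto

text \<open>By Plancherel's theorem each difference is the norm of a sum of a stochastic part, dominated by
  \<open>stoch_err\<close>, and a deterministic part, supported on \<open>Gset\<close>. The factor 1/3 comes from \<open>2 / (2 * pi)\<close>.\<close>

lemma stochastic_bias_bound:
  assumes n: "1 \<le> n" and Q [measurable]: "Q \<in> borel_measurable borel" "Q' \<in> borel_measurable borel"
    and QR: "\<And>t. cmod (Q t) \<le> cmod (R k' t)" and Q': "\<And>t. cmod (Q' t) \<le> indicator (Gset c g (real k)) t"
  shows "ennreal (1 / (2 * pi)) * norm2 (\<lambda>t. of_real (1 / real n) * kernel_sum n Y t * Q t + mellin c f t * Q' t)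
    \<le> ennreal (1 / 3) * (ennreal (1 / (real n)\<^sup>2) * stoch_err n k' Y + bias k)"
proof -
  have "norm2 (\<lambda>t. of_real (1 / real n) * kernel_sum n Y t * Q t + mellin c f t * Q' t)
     \<le> 2 * norm2 (\<lambda>t. of_real (1 / real n) * kernel_sum n Y t * Q t) + 2 * norm2 (\<lambda>t. mellin c f t * Q' t)"
    by (rule norm2_add_le) measurable
  also have "\<dots> \<le> 2 * (ennreal (1 / (real n)\<^sup>2) * stoch_err n k' Y) + 2 * bias k"
  proof (intro add_mono mult_left_mono)
    have "norm2 (\<lambda>t. of_real (1 / real n) * kernel_sum n Y t * Q t) \<le> norm2 (\<lambda>t. of_real (1 / real n) * (kernel_sum n Y t * R k' t))"
      by (intro norm2_mono) (simp add: norm_mult norm_divide mult_left_mono QR divide_right_mono)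
    also have "\<dots> = ennreal (1 / (real n)\<^sup>2) * stoch_err n k' Y"
      unfolding stoch_err_eq by (subst norm2_scale) (auto simp: power_divide)
    finally show "norm2 (\<lambda>t. of_real (1 / real n) * kernel_sum n Y t * Q t) \<le> ennreal (1 / (real n)\<^sup>2) * stoch_err n k' Y" .
    show "norm2 (\<lambda>t. mellin c f t * Q' t) \<le> bias k"
      unfolding bias_def
    proof (rule norm2_mono)
      fix t
      have "cmod (mellin c f t * Q' t) \<le> cmod (mellin c f t) * indicator (Gset c g (real k)) t"
        unfolding norm_mult by (intro mult_left_mono Q') auto
      also have "\<dots> = cmod (indicator (Gset c g (real k)) t * mellin c f t)" by (simp add: indicator_def)
      finally show "cmod (mellin c f t * Q' t) \<le> cmod (indicator (Gset c g (real k)) t * mellin c f t)" .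
    qed
  qed auto
  also have "\<dots> = 2 * (ennreal (1 / (real n)\<^sup>2) * stoch_err n k' Y + bias k)" by (simp add: distrib_left)
  finally have "ennreal (1 / (2 * pi)) * norm2 (\<lambda>t. of_real (1 / real n) * kernel_sum n Y t * Q t + mellin c f t * Q' t)
      \<le> ennreal (1 / 6) * (2 * (ennreal (1 / (real n)\<^sup>2) * stoch_err n k' Y + bias k))"
    using pi_gt3 by (intro mult_mono ennreal_leI) (auto simp: field_simps)
  also have "\<dots> = (ennreal (1 / 6) * ennreal 2) * (ennreal (1 / (real n)\<^sup>2) * stoch_err n k' Y + bias k)"
    by (simp add: mult.assoc)
  also have "ennreal (1 / 6) * ennreal 2 = ennreal (1 / 3)" by (simp flip: ennreal_mult del: ennreal_numeral)
  finally show ?thesis .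
qed

text \<open>The minimum makes the difference vanish for \<open>k' \<le> k\<close>. For larger
  \<open>k'\<close> its deterministic part lives on \<open>Gset\<close> of the smaller index
  \<open>k\<close>, and its stochastic part is dominated by the one at \<open>k'\<close>.\<close>

lemma fhat_diff_bound:
  assumes n: "1 \<le> n" and Y: "\<And>i. i < n \<Longrightarrow> 0 < Y i" and k: "1 \<le> k" "1 \<le> k'"
  shows "wnorm2 c (\<lambda>x. fhat c g r n Y (real k') x - fhat c g r n Y (real (min k' k)) x)
    \<le> ennreal (1 / 3) * (ennreal (1 / (real n)\<^sup>2) * stoch_err n k' Y + bias k)"
proof -
  let ?l = "min k' k"
  have l: "1 \<le> ?l" "?l \<le> k'" using k by simp_all
  let ?H = "\<lambda>t. emp_mellin c n Y t * R k' t - emp_mellin c n Y t * R ?l t"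
  have i: "integrable lborel (\<lambda>t. emp_mellin c n Y t * R k' t)" "integrable lborel (\<lambda>t. emp_mellin c n Y t * R ?l t)"
    using emp_R_integrable(1)[OF Y k(2)] emp_R_integrable(1)[OF Y l(1)] by auto
  have "wnorm2 c (\<lambda>x. fhat c g r n Y (real k') x - fhat c g r n Y (real ?l) x) = wnorm2 c (mellin_inv c ?H)"
    unfolding wnorm2_def fhat_eq using mellin_inv_diff[OF i] l k by (intro nn_integral_cong) simp
  also have "\<dots> \<le> ennreal (1 / (2 * pi)) * norm2 ?H"
    using i l k by (intro wnorm2_mellin_inv_le) auto
  also have "?H = (\<lambda>t. of_real (1 / real n) * kernel_sum n Y t * (R k' t - R ?l t) + mellin c f t * (G t * (R k' t - R ?l t)))"
    by (simp add: fun_eq_iff emp_eq[OF n Y] mellin_Y_def algebra_simps)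
  also have "ennreal (1 / (2 * pi)) * norm2 \<dots> \<le> ennreal (1 / 3) * (ennreal (1 / (real n)\<^sup>2) * stoch_err n k' Y + bias k)"
  proof (rule stochastic_bias_bound[OF n])
    show "cmod (G t * (R k' t - R ?l t)) \<le> indicator (Gset c g (real k)) t" for t
    proof (cases "k \<le> k'")
      case True
      thus ?thesis using cmod_G_R_diff[of k k' t] k by (simp add: min_def)
    qed (simp add: min_def)
    show "cmod (R k' t - R ?l t) \<le> cmod (R k' t)" for t by (rule cmod_R_diff[OF l])
  qed measurable
  finally show ?thesis .
qed

lemma fhat_f_bound:
  assumes n: "1 \<le> n" and Y: "\<And>i. i < n \<Longrightarrow> 0 < Y i" and k: "1 \<le> k"
  shows "wnorm2 c (\<lambda>x. fhat c g r n Y (real k) x - of_real (f x))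
    \<le> ennreal (1 / 3) * (ennreal (1 / (real n)\<^sup>2) * stoch_err n k Y + bias k)"
proof -
  let ?H = "\<lambda>t. emp_mellin c n Y t * R k t"
  have "wnorm2 c (\<lambda>x. fhat c g r n Y (real k) x - of_real (f x)) \<le> ennreal (1 / (2 * pi)) * norm2 (\<lambda>t. ?H t - mellin c f t)"
    unfolding fhat_eq
  proof (rule wnorm2_mellin_inv_diff_le)
    show "integrable lborel ?H" "norm2 ?H < \<infinity>" using emp_R_integrable[OF Y k] by auto
    show "f \<in> borel_measurable Rplus" by (rule f_measurable)
    show "0 \<le> f x" if "0 < x" for x using f_density that by (simp add: pos_density_def)
    show "integrable lborel (\<lambda>u. exp (c * u) * f (exp u))"
      using moment_finite(2)[of 1] by (intro integrable_exp_mult[OF f_density]) simp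
    show "wnorm2 c (\<lambda>x. of_real (f x)) < \<infinity>" using f_L2 by (simp add: wL2_def)
  qed
  also have "(\<lambda>t. ?H t - mellin c f t) = (\<lambda>t. of_real (1 / real n) * kernel_sum n Y t * R k t + mellin c f t * (G t * R k t - 1))"
    by (simp add: fun_eq_iff emp_eq[OF n Y] mellin_Y_def algebra_simps)
  also have "ennreal (1 / (2 * pi)) * norm2 \<dots> \<le> ennreal (1 / 3) * (ennreal (1 / (real n)\<^sup>2) * stoch_err n k Y + bias k)"
    by (rule stochastic_bias_bound[OF n]) (auto intro: cmod_G_R_minus_1)
  finally show ?thesis .
qed

text \<open>What bounds \<open>Ahat\<close> besides \<open>bias\<close>: the truncation remainder,
  the excess of the truncated error over its threshold, and the error of estimating
  \<open>s\<close>. The first term needs only the largest parameter; the supremum in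
  \<open>Ahat\<close> turns the second into a sum. The factor 2/3 is 1/3 from Plancherel times 2
  from \<open>stoch_err_le\<close>.\<close>

definition rest :: "nat \<Rightarrow> (nat \<Rightarrow> real) \<Rightarrow> ennreal" where
  "rest n Y = ennreal (2 / 3 / (real n)\<^sup>2) * tail_err n (Max (Kset c g r n)) Y
    + (\<Sum>k\<in>Kset c g r n. ennreal (2 / 3 / (real n)\<^sup>2) * (trunc_err n k Y - ennreal (100 * real n * s * ridge_sq k)))
    + ennreal (72 / s * (sigma_hat c n Y - s)\<^sup>2)"

lemma Vhat_eq:
  assumes n: "1 \<le> n" and k: "1 \<le> k"
  shows "Vhat c g r n Y k = ennreal (2 * sigma_hat c n Y * ridge_sq k / real n)"
proof -
  have "0 \<le> sigma_hat c n Y" by (auto simp: sigma_hat_def intro!: divide_nonneg_nonneg sum_nonneg)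
  thus ?thesis
    using n ridge_sq_nonneg[of k]
    by (simp add: Vhat_def norm2_R[OF k] ennreal_mult[symmetric] ennreal_of_nat_eq_real_of_nat divide_ennreal
        flip: ennreal_numeral)
qed

text \<open>The penalty absorbs the threshold of the truncated error: that threshold contributes
  \<open>200/3 * s * w\<close> with \<open>w = ridge_sq k' / n\<close>, and
  \<open>200/3 \<le> 72 \<le> chi1\<close>. The mismatch between \<open>s\<close> and
  \<open>2 * sigma_hat\<close> goes into \<open>rest\<close>.\<close>

lemma Ahat_le:
  assumes n: "1 \<le> n" and Y: "\<And>i. i < n \<Longrightarrow> 0 < Y i" and k: "1 \<le> k" and chi1: "72 \<le> chi1"
    and fin: "finite (Kset c g r n)"
  shows "Ahat c g r chi1 n Y k \<le> bias k + rest n Y"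
  unfolding Ahat_def
proof (rule SUP_least, rule ennreal_diff_leI)
  fix k' assume k': "k' \<in> Kset c g r n"
  hence k1: "1 \<le> k'" and kn: "ridge_sq k' \<le> real n" by (simp_all add: Kset_iff)
  show "ennreal chi1 * Vhat c g r n Y k' < \<infinity>" by (simp add: Vhat_eq[OF n k1] ennreal_mult_less_top)
  let ?q = "ennreal (2 / 3 / (real n)\<^sup>2)" and ?b = "ennreal (100 * real n * s * ridge_sq k')"
  let ?S = "ennreal (72 / s * (sigma_hat c n Y - s)\<^sup>2)"
  have sh: "0 \<le> sigma_hat c n Y" by (auto simp: sigma_hat_def intro!: divide_nonneg_nonneg sum_nonneg)
  have "wnorm2 c (\<lambda>x. fhat c g r n Y (real k') x - fhat c g r n Y (real (min k' k)) x)
      \<le> ennreal (1 / 3) * (ennreal (1 / (real n)\<^sup>2) * stoch_err n k' Y + bias k)"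
    by (rule fhat_diff_bound[OF n Y k k1])
  also have "\<dots> \<le> ennreal (1 / 3) * (ennreal (1 / (real n)\<^sup>2) * (2 * ((trunc_err n k' Y - ?b) + ?b) + 2 * tail_err n (Max (Kset c g r n)) Y) + bias k)"
  proof (intro mult_left_mono add_mono order_refl)
    have "stoch_err n k' Y \<le> 2 * trunc_err n k' Y + 2 * tail_err n k' Y" by (rule stoch_err_le)
    also have "\<dots> \<le> 2 * ((trunc_err n k' Y - ?b) + ?b) + 2 * tail_err n (Max (Kset c g r n)) Y"
      using Max_ge[OF fin k'] by (intro add_mono mult_left_mono ennreal_le_diff_add tail_err_mono[OF k1]) auto
    finally show "stoch_err n k' Y \<le> 2 * ((trunc_err n k' Y - ?b) + ?b) + 2 * tail_err n (Max (Kset c g r n)) Y" .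
  qed auto
  also have "\<dots> = ?q * (trunc_err n k' Y - ?b) + ?q * ?b + ?q * tail_err n (Max (Kset c g r n)) Y + ennreal (1 / 3) * bias k"
  proof -
    have "ennreal (1 / 3) * (ennreal (1 / (real n)\<^sup>2) * (ennreal 2 * z)) = ?q * z" for z
      unfolding mult.assoc[symmetric] by (subst ennreal_mult[symmetric], simp, simp, subst ennreal_mult[symmetric]) auto
    thus ?thesis by (simp add: distrib_left add.assoc)
  qed
  \<comment> \<open>From \<open>s * (s - 2 * sigma_hat) = (sigma_hat - s)\<^sup>2 -
    sigma_hat\<^sup>2\<close> the shortfall of the estimated penalty is quadratic in the estimation
    error. Membership in \<open>Kset\<close> gives \<open>w \<le> 1\<close>.\<close>
  also have "?q * ?b \<le> ?S + ennreal chi1 * Vhat c g r n Y k'"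
  proof -
    define w where "w = ridge_sq k' / real n"
    have w: "0 \<le> w" "w \<le> 1" using kn ridge_sq_nonneg[of k'] n by (simp_all add: w_def)
    have "?q * ?b = ennreal (200 / 3 * s * w)"
      using s_pos ridge_sq_nonneg[of k'] n by (simp add: ennreal_mult[symmetric] w_def power2_eq_square)
    also have "\<dots> \<le> ennreal (72 / s * (sigma_hat c n Y - s)\<^sup>2 + chi1 * (2 * sigma_hat c n Y * w))"
    proof (rule ennreal_leI)
      have "72 * (2 * sigma_hat c n Y * w) \<le> chi1 * (2 * sigma_hat c n Y * w)"
        using chi1 sh w by (intro mult_right_mono) auto
      moreover have "72 * ((s - 2 * sigma_hat c n Y) * w) \<le> 72 * ((sigma_hat c n Y - s)\<^sup>2 / s)"
      proof -
        have "s * (s - 2 * sigma_hat c n Y) = (sigma_hat c n Y - s)\<^sup>2 - (sigma_hat c n Y)\<^sup>2"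
          by (simp add: power2_eq_square algebra_simps)
        also have "\<dots> \<le> (sigma_hat c n Y - s)\<^sup>2" by simp
        finally have "s - 2 * sigma_hat c n Y \<le> (sigma_hat c n Y - s)\<^sup>2 / s"
          using s_pos by (simp add: field_simps)
        hence "(s - 2 * sigma_hat c n Y) * w \<le> (sigma_hat c n Y - s)\<^sup>2 / s * w"
          using w by (intro mult_right_mono) auto
        also have "\<dots> \<le> (sigma_hat c n Y - s)\<^sup>2 / s" using w s_pos by (intro mult_left_le) auto
        finally show ?thesis by (intro mult_left_mono) auto
      qed
      moreover have "200 / 3 * s * w \<le> 72 * s * w" using s_pos w by (intro mult_right_mono) auto
      ultimately show "200 / 3 * s * w \<le> 72 / s * (sigma_hat c n Y - s)\<^sup>2 + chi1 * (2 * sigma_hat c n Y * w)"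
        by (simp add: algebra_simps)
    qed
    also have "\<dots> = ?S + ennreal chi1 * Vhat c g r n Y k'"
    proof -
      have v: "Vhat c g r n Y k' = ennreal (2 * sigma_hat c n Y * w)" by (simp add: Vhat_eq[OF n k1] w_def)
      have "ennreal (a + chi1 * z) = ennreal a + ennreal chi1 * ennreal z" if "0 \<le> a" "0 \<le> z" for a z
        using chi1 that by (simp add: ennreal_mult)
      thus ?thesis unfolding v using s_pos sh w by simp
    qed
    finally show ?thesis .
  qed
  also have "?q * (trunc_err n k' Y - ?b) \<le> (\<Sum>k\<in>Kset c g r n. ?q * (trunc_err n k Y - ennreal (100 * real n * s * ridge_sq k)))"
    by (rule member_le_sum[OF k']) (use fin in auto)
  also have "ennreal (1 / 3) * bias k \<le> bias k"
    using mult_right_mono[of "ennreal (1/3)" 1 "bias k"] by (simp add: ennreal_le_1)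
  finally show "wnorm2 c (\<lambda>x. fhat c g r n Y (real k') x - fhat c g r n Y (real (min k' k)) x)
      \<le> ennreal chi1 * Vhat c g r n Y k' + (bias k + rest n Y)"
    unfolding rest_def by (simp add: add_ac add_mono)
qed

end

section \<open>Expectations of the error terms\<close>

context deconvolution
begin

lemma Z_measurable:
  "trunc_err n k \<in> borel_measurable (PiM {..<n} (\<lambda>_. P))"
  "tail_err n k \<in> borel_measurable (PiM {..<n} (\<lambda>_. P))"
  "stoch_err n k \<in> borel_measurable (PiM {..<n} (\<lambda>_. P))"
  unfolding trunc_err_def tail_err_def stoch_err_def
  by (intro centered_sum_measurable(2) P_prob kernel_joint_measurable R_measurable; simp)+

lemma sigma_hat_measurable: "sigma_hat c n \<in> borel_measurable (PiM {..<n} (\<lambda>_. P))"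
proof -
  have "(\<lambda>y. y powr (2 * (c - 1))) \<in> borel_measurable P" by (rule borel_measurable_P) measurable
  hence "(\<lambda>Y. Y i powr (2 * (c - 1))) \<in> borel_measurable (PiM {..<n} (\<lambda>_. P))" if "i < n" for i
    using that measurable_compose[OF measurable_component_singleton[of i "{..<n}" "\<lambda>_. P"]] by simp
  thus ?thesis unfolding sigma_hat_def by (intro borel_measurable_divide borel_measurable_sum) auto
qed

lemma sigma_hat_nonneg: "0 \<le> sigma_hat c n Y"
  by (auto simp: sigma_hat_def intro!: divide_nonneg_nonneg sum_nonneg)

lemma stoch_err_expectation:
  assumes k: "1 \<le> k"
  shows "(\<integral>\<^sup>+Y. stoch_err n k Y \<partial>sample_law f g n) \<le> ennreal (real n * s * ridge_sq k)"
proof -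
  have "(\<integral>\<^sup>+Y. stoch_err n k Y \<partial>sample_law f g n) \<le> of_nat n * ennreal s * norm2 (R k)"
    unfolding stoch_err_def sample_law_def
    by (rule nn_integral_norm2_centered_sum_le[OF P_prob kernel_joint_measurable(1) kernel_integrable])
       (simp_all only: kernel_square sets_lborel order_refl R_measurable)
  thus ?thesis
    using s_pos ridge_sq_nonneg[of k]
    by (simp add: norm2_R[OF k] ennreal_of_nat_eq_real_of_nat ennreal_mult[symmetric])
qed

text \<open>The cube of \<open>level n\<close> is \<open>s * sqrt s * n / 8\<close>, which cancels
  the factor \<open>n\<close> of the variance of a sum; the factor \<open>n\<close> on the right is
  the bound on \<open>ridge_sq k\<close>.\<close>

lemma tail_err_expectation:
  assumes n: "1 \<le> n" and k: "k \<in> Kset c g r n"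
  shows "(\<integral>\<^sup>+Y. tail_err n k Y \<partial>sample_law f g n) \<le> ennreal (8 * m / (s * sqrt s) * real n)"
proof -
  have k1: "1 \<le> k" and kn: "ridge_sq k \<le> real n" using k by (simp_all add: Kset_iff)
  have d: "0 < level n" by (rule level_pos[OF n])
  have d3: "level n ^ 3 = s * sqrt s * real n / 8"
  proof -
    have "(real n powr (1/3)) ^ 3 = real n" using n by (simp add: powr_powr flip: powr_numeral)
    moreover have "sqrt s ^ 3 = s * sqrt s" using s_pos by (simp add: power3_eq_cube)
    ultimately show ?thesis by (simp add: level_def power_divide power_mult_distrib)
  qed
  have "(\<integral>\<^sup>+Y. tail_err n k Y \<partial>sample_law f g n) \<le> of_nat n * ennreal (m / level n ^ 3) * norm2 (R k)"
    unfolding tail_err_def sample_law_def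
    by (rule nn_integral_norm2_centered_sum_le[OF P_prob kernel_joint_measurable(3) tail_kernel_integrable tail_kernel_square[OF d]])
       (simp_all only: sets_lborel R_measurable)
  also have "\<dots> = ennreal (real n * (m / level n ^ 3) * ridge_sq k)"
    using m_nonneg d ridge_sq_nonneg[of k]
    by (simp add: norm2_R[OF k1] ennreal_of_nat_eq_real_of_nat ennreal_mult[symmetric])
  also have "\<dots> \<le> ennreal (8 * m / (s * sqrt s) * real n)"
  proof (rule ennreal_leI)
    have "real n * (m / level n ^ 3) = 8 * m / (s * sqrt s)"
      unfolding d3 using n s_pos by (simp add: field_simps)
    thus "real n * (m / level n ^ 3) * ridge_sq k \<le> 8 * m / (s * sqrt s) * real n"
      using kn m_nonneg s_pos by (simp only:) (intro mult_left_mono, auto)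
  qed
  finally show ?thesis .
qed

lemma sigma_hat_expectation:
  assumes n: "1 \<le> n"
  shows "(\<integral>\<^sup>+Y. ennreal (sigma_hat c n Y) \<partial>sample_law f g n) = ennreal s"
proof -
  have m: "(\<lambda>y. ennreal (y powr (2 * (c - 1)))) \<in> borel_measurable P" by (rule borel_measurable_P) measurable
  have "(\<integral>\<^sup>+Y. ennreal (sigma_hat c n Y) \<partial>sample_law f g n)
     = (\<integral>\<^sup>+Y. ennreal (1 / real n) * (\<Sum>i<n. ennreal (Y i powr (2 * (c - 1)))) \<partial>PiM {..<n} (\<lambda>_. P))"
    unfolding sample_law_def
    by (intro nn_integral_cong) (simp add: sigma_hat_def sum_ennreal ennreal_mult[symmetric] sum_nonneg)
  also have "\<dots> = ennreal (1 / real n) * (\<integral>\<^sup>+Y. (\<Sum>i<n. ennreal (Y i powr (2 * (c - 1)))) \<partial>PiM {..<n} (\<lambda>_. P))"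
    using m by (intro nn_integral_cmult borel_measurable_sum measurable_compose[OF measurable_component_singleton]) auto
  also have "\<dots> = ennreal (1 / real n) * (of_nat n * ennreal s)"
    by (subst nn_integral_sum_PiM[OF P_prob m]) (simp only: second_moment)
  also have "\<dots> = ennreal s"
    using n s_pos by (simp add: ennreal_of_nat_eq_real_of_nat ennreal_mult[symmetric])
  finally show ?thesis .
qed

text \<open>The summands of \<open>sigma_hat\<close> are squares, so their variance involves a
  fourth moment; \<open>1 + m\<close> bounds it, since a fourth power is at most 1 plus the
  fifth.\<close>

lemma sigma_hat_variance:
  assumes n: "1 \<le> n"
  shows "(\<integral>\<^sup>+Y. ennreal ((sigma_hat c n Y - s)\<^sup>2) \<partial>sample_law f g n) \<le> ennreal ((1 + m) / real n)"
proof -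
  define X where "X = (\<lambda>y::real. complex_of_real (y powr (2 * (c - 1))))"
  have Xm: "X \<in> borel_measurable P" unfolding X_def by (rule borel_measurable_P) measurable
  have X: "integrable P X"
  proof (rule integrableI_bounded[OF Xm])
    have "cmod (X y) = y powr (2 * (c - 1))" for y by (simp add: X_def)
    hence "(\<integral>\<^sup>+y. ennreal (cmod (X y)) \<partial>P) = ennreal s" by (simp only: second_moment)
    thus "(\<integral>\<^sup>+y. ennreal (cmod (X y)) \<partial>P) < \<infinity>" by simp
  qed
  have EX: "(LINT y|P. X y) = of_real s"
  proof -
    have i: "integrable P (\<lambda>y. y powr (2 * (c - 1)))"
      using X unfolding X_def by (subst (asm) complex_of_real_integrable_eq)
    have "ennreal (LINT y|P. y powr (2 * (c - 1))) = ennreal s"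
      unfolding second_moment[symmetric] by (rule nn_integral_eq_integral[OF i, symmetric]) simp
    hence "(LINT y|P. y powr (2 * (c - 1))) = s"
      using s_pos by (subst (asm) ennreal_inj) (auto intro: Bochner_Integration.integral_nonneg)
    thus ?thesis by (simp add: X_def)
  qed
  define psi where "psi = (\<lambda>y. X y - (LINT y|P. X y))"
  have psi: "integrable P psi" "(LINT y|P. psi y) = 0"
    unfolding psi_def using X by (simp_all add: P.prob_space)
  hence pm: "psi \<in> borel_measurable P" by auto
  have fourth: "(\<integral>\<^sup>+y. ennreal ((cmod (X y))\<^sup>2) \<partial>P) \<le> ennreal (1 + m)"
  proof -
    have "(\<integral>\<^sup>+y. ennreal ((cmod (X y))\<^sup>2) \<partial>P) \<le> (\<integral>\<^sup>+y. 1 + ennreal (y powr (5 * (c - 1))) \<partial>P)"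
    proof (rule nn_integral_mono)
      fix y assume "y \<in> space P"
      hence y: "0 < y" by (simp add: space_P)
      have "(cmod (X y))\<^sup>2 = y powr (4 * (c - 1))"
        by (simp add: X_def power2_eq_square flip: powr_add)
      also have "\<dots> \<le> 1 + y powr (5 * (c - 1))" by (rule powr_le_1_plus[OF y]) auto
      finally have "ennreal ((cmod (X y))\<^sup>2) \<le> ennreal (1 + y powr (5 * (c - 1)))" by (rule ennreal_leI)
      thus "ennreal ((cmod (X y))\<^sup>2) \<le> 1 + ennreal (y powr (5 * (c - 1)))" by simp
    qed
    also have "\<dots> = 1 + moment_Y f g (5 * (c - 1))"
      unfolding moment_Y_def
      by (subst nn_integral_add) (auto intro!: borel_measurable_P simp: P.emeasure_space_1)
    also have "\<dots> = ennreal (1 + m)" unfolding fifth_moment_eq using m_nonneg by simp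
    finally show ?thesis .
  qed
  have eq: "ennreal ((sigma_hat c n Y - s)\<^sup>2) = ennreal (1 / (real n)\<^sup>2) * ennreal ((cmod (\<Sum>i<n. psi (Y i)))\<^sup>2)" for Y
  proof -
    have "psi y = of_real (y powr (2 * (c - 1)) - s)" for y
      unfolding psi_def EX unfolding X_def by simp
    hence "(\<Sum>i<n. psi (Y i)) = of_real (real n * (sigma_hat c n Y - s))"
      using n by (simp add: sum_subtractf sigma_hat_def right_diff_distrib)
    hence "(cmod (\<Sum>i<n. psi (Y i)))\<^sup>2 = (real n)\<^sup>2 * (sigma_hat c n Y - s)\<^sup>2"
      by (simp only: norm_of_real power2_abs power_mult_distrib)
    thus ?thesis using n by (simp add: ennreal_mult[symmetric])
  qed
  have "(\<integral>\<^sup>+Y. ennreal ((sigma_hat c n Y - s)\<^sup>2) \<partial>sample_law f g n)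
     = ennreal (1 / (real n)\<^sup>2) * (\<integral>\<^sup>+Y. ennreal ((cmod (\<Sum>i<n. psi (Y i)))\<^sup>2) \<partial>PiM {..<n} (\<lambda>_. P))"
  proof -
    have "(\<lambda>Y. psi (Y i)) \<in> borel_measurable (PiM {..<n} (\<lambda>_. P))" if "i < n" for i
      using that measurable_compose[OF measurable_component_singleton[of i "{..<n}" "\<lambda>_. P"] pm] by simp
    hence [measurable]: "(\<lambda>Y. \<Sum>i<n. psi (Y i)) \<in> borel_measurable (PiM {..<n} (\<lambda>_. P))"
      by (intro borel_measurable_sum) auto
    show ?thesis unfolding eq sample_law_def by (rule nn_integral_cmult) measurable
  qed
  also have "\<dots> \<le> ennreal (1 / (real n)\<^sup>2) * (of_nat n * ennreal (1 + m))"
  proof (intro mult_left_mono order_trans[OF nn_integral_sum_square_le[OF P_prob psi]])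
    show "(\<integral>\<^sup>+y. ennreal ((cmod (psi y))\<^sup>2) \<partial>P) \<le> ennreal (1 + m)"
      unfolding psi_def using nn_integral_variance_le[OF P_prob X] fourth by (rule order_trans)
  qed auto
  also have "\<dots> = ennreal ((1 + m) / real n)"
    using n m_nonneg by (simp add: ennreal_of_nat_eq_real_of_nat ennreal_mult[symmetric] power2_eq_square del: ennreal_plus)
  finally show ?thesis .
qed

definition rest_const :: "real \<Rightarrow> real" where
  "rest_const S = 16 / 3 * m / (s * sqrt s) + 2 / 3 * S + 72 * (1 + m) / s"

lemma rest_expectation:
  assumes n: "1 \<le> n" and ne: "Kset c g r n \<noteq> {}" and fin: "finite (Kset c g r n)"
    and S: "(\<Sum>k\<in>Kset c g r n. tail_term s B k + tail_rate s n) \<le> S"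
  shows "(\<integral>\<^sup>+Y. rest n Y \<partial>sample_law f g n) \<le> ennreal (rest_const S / real n)"
proof -
  let ?K = "Kset c g r n" and ?q = "2 / 3 / (real n)\<^sup>2"
  let ?E = "\<lambda>h. \<integral>\<^sup>+Y. h Y \<partial>PiM {..<n} (\<lambda>_. P)"
  note [measurable] = Z_measurable[where n = n] sigma_hat_measurable[of n]
  have t0: "0 \<le> tail_term s B k + tail_rate s n" for k
    using s_pos B_pos tail_term_nonneg[of s B k] by (simp add: tail_rate_def)
  have S0: "0 \<le> S" using S t0 by (meson order_trans sum_nonneg)
  have "(\<integral>\<^sup>+Y. rest n Y \<partial>sample_law f g n)
     = ennreal ?q * ?E (tail_err n (Max ?K))
       + (\<Sum>k\<in>?K. ennreal ?q * ?E (\<lambda>Y. trunc_err n k Y - ennreal (100 * real n * s * ridge_sq k)))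
       + ennreal (72 / s) * ?E (\<lambda>Y. ennreal ((sigma_hat c n Y - s)\<^sup>2))"
  proof -
    have eq3: "ennreal (72 / s * z\<^sup>2) = ennreal (72 / s) * ennreal (z\<^sup>2)" for z
      using s_pos by (intro ennreal_mult) auto
    define q1 q2 where "q1 = ennreal ?q" and "q2 = ennreal (72 / s)"
    show ?thesis
      unfolding rest_def sample_law_def eq3 q1_def[symmetric] q2_def[symmetric]
      by (simp add: nn_integral_add nn_integral_sum nn_integral_cmult)
  qed
  also have "\<dots> \<le> ennreal ?q * ennreal (8 * m / (s * sqrt s) * real n)
       + (\<Sum>k\<in>?K. ennreal ?q * ennreal (real n * (tail_term s B k + tail_rate s n)))
       + ennreal (72 / s) * ennreal ((1 + m) / real n)"
    using tail_err_expectation[OF n Max_in[OF fin ne]] trunc_err_tail[OF n] sigma_hat_variance[OF n]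
    unfolding sample_law_def by (intro add_mono mult_left_mono sum_mono) auto
  also have "\<dots> = ennreal (?q * (8 * m / (s * sqrt s) * real n)
       + (\<Sum>k\<in>?K. ?q * (real n * (tail_term s B k + tail_rate s n))) + 72 / s * ((1 + m) / real n))"
    using s_pos m_nonneg t0
    by (simp add: ennreal_mult[symmetric] sum_ennreal ennreal_plus[symmetric] sum_nonneg del: ennreal_plus)
  also have "\<dots> \<le> ennreal (rest_const S / real n)"
  proof (rule ennreal_leI)
    have "(\<Sum>k\<in>?K. ?q * (real n * (tail_term s B k + tail_rate s n)))
        = 2 / 3 / real n * (\<Sum>k\<in>?K. tail_term s B k + tail_rate s n)"
      using n by (simp add: sum_distrib_left power2_eq_square)
    also have "\<dots> \<le> 2 / 3 / real n * S" using S by (intro mult_left_mono) auto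
    finally have "(\<Sum>k\<in>?K. ?q * (real n * (tail_term s B k + tail_rate s n))) \<le> 2 / 3 / real n * S" .
    moreover have "?q * (8 * m / (s * sqrt s) * real n) = 16 / 3 * m / (s * sqrt s) / real n"
      using n by (simp add: power2_eq_square)
    moreover have "72 / s * ((1 + m) / real n) = 72 * (1 + m) / s / real n"
      "2 / 3 / real n * S = 2 / 3 * S / real n" by simp_all
    ultimately show "?q * (8 * m / (s * sqrt s) * real n)
       + (\<Sum>k\<in>?K. ?q * (real n * (tail_term s B k + tail_rate s n))) + 72 / s * ((1 + m) / real n)
       \<le> rest_const S / real n"
      unfolding rest_const_def add_divide_distrib[of _ _ "real n"] by linarith
  qed
  finally show ?thesis .
qed

section \<open>The comparison of Goldenshluger and Lepski\<close>

lemma V_eq: "1 \<le> n \<Longrightarrow> 1 \<le> k \<Longrightarrow> V c f g r n k = ennreal (s * ridge_sq k / real n)"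
  using s_pos ridge_sq_nonneg[of k]
  by (simp add: V_def sigma_eq norm2_R ennreal_mult[symmetric] ennreal_of_nat_eq_real_of_nat divide_ennreal)

text \<open>Inserting the estimators at \<open>min kh k\<close> and at \<open>k\<close> splits the
  loss into three parts. By definition of \<open>Ahat\<close> the first is at most
  \<open>Ahat k\<close> plus a penalty at \<open>kh\<close>, the second at most
  \<open>Ahat kh\<close> plus a penalty at \<open>k\<close>. The factor 6 is 3 from the three parts
  times 2 from minimality; the third part adds one more \<open>bias\<close>, hence 7.\<close>

lemma loss_pointwise:
  assumes n: "1 \<le> n" and k: "k \<in> Kset c g r n" and chi: "72 \<le> chi1" "chi1 \<le> chi2"
    and Y: "\<And>i. i < n \<Longrightarrow> 0 < Y i" and fin: "finite (Kset c g r n)"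
    and kh: "is_arg_min (\<lambda>k. Ahat c g r chi1 n Y k + ennreal chi2 * Vhat c g r n Y k) (\<lambda>k. k \<in> Kset c g r n) kh"
  shows "wnorm2 c (\<lambda>x. fhat c g r n Y (real kh) x - of_real (f x))
    \<le> 7 * bias k + 6 * rest n Y + ennreal (6 * chi2) * Vhat c g r n Y k + ennreal (1 / (real n)\<^sup>2) * stoch_err n k Y"
proof -
  let ?A = "Ahat c g r chi1 n Y" and ?V = "Vhat c g r n Y" and ?f = "\<lambda>k. fhat c g r n Y (real k)"
  have k1: "1 \<le> k" and khK: "kh \<in> Kset c g r n" and kh1: "1 \<le> kh"
    using k kh by (simp_all add: Kset_iff is_arg_min_def)
  have argmin: "?A kh + ennreal chi2 * ?V kh \<le> ?A k + ennreal chi2 * ?V k"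
    using kh k by (auto simp: is_arg_min_def not_less)
  have A_ge: "wnorm2 c (\<lambda>x. ?f k' x - ?f (min k' l) x) \<le> ?A l + ennreal chi1 * ?V k'"
    if "k' \<in> Kset c g r n" for k' l
  proof -
    have "wnorm2 c (\<lambda>x. ?f k' x - ?f (min k' l) x) - ennreal chi1 * ?V k' \<le> ?A l"
      unfolding Ahat_def using that by (rule SUP_upper)
    hence "(wnorm2 c (\<lambda>x. ?f k' x - ?f (min k' l) x) - ennreal chi1 * ?V k') + ennreal chi1 * ?V k' \<le> ?A l + ennreal chi1 * ?V k'"
      by (rule add_right_mono)
    with ennreal_le_diff_add show ?thesis by (rule order_trans)
  qed
  have chiV: "ennreal chi1 * v \<le> ennreal chi2 * v" for v
    using chi by (intro mult_right_mono ennreal_leI) auto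
  have fm: "?f l \<in> borel_measurable Rplus" if "1 \<le> l" for l by (rule fhat_measurable[OF Y that])
  have fm': "(\<lambda>x. complex_of_real (f x)) \<in> borel_measurable Rplus" using f_measurable by measurable
  have "wnorm2 c (\<lambda>x. ?f kh x - of_real (f x))
     = wnorm2 c (\<lambda>x. (?f kh x - ?f (min kh k) x) + (?f (min kh k) x - ?f k x) + (?f k x - of_real (f x)))"
    by simp
  also have "\<dots> \<le> 3 * (wnorm2 c (\<lambda>x. ?f kh x - ?f (min kh k) x) + wnorm2 c (\<lambda>x. ?f (min kh k) x - ?f k x)
      + wnorm2 c (\<lambda>x. ?f k x - of_real (f x)))"
    using fm[OF kh1] fm[OF k1] fm[of "min kh k"] kh1 k1 fm' by (intro wnorm2_add3_le borel_measurable_diff) auto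
  also have "wnorm2 c (\<lambda>x. ?f (min kh k) x - ?f k x) = wnorm2 c (\<lambda>x. ?f k x - ?f (min k kh) x)"
    by (subst wnorm2_minus_commute) (simp add: min.commute)
  also have "3 * (wnorm2 c (\<lambda>x. ?f kh x - ?f (min kh k) x) + wnorm2 c (\<lambda>x. ?f k x - ?f (min k kh) x)
      + wnorm2 c (\<lambda>x. ?f k x - of_real (f x)))
     \<le> 3 * ((?A k + ennreal chi2 * ?V kh) + (?A kh + ennreal chi2 * ?V k) + ennreal (1 / 3) * (ennreal (1 / (real n)\<^sup>2) * stoch_err n k Y + bias k))"
  proof (intro mult_left_mono add_mono)
    show "wnorm2 c (\<lambda>x. ?f kh x - ?f (min kh k) x) \<le> ?A k + ennreal chi2 * ?V kh"
      using A_ge[OF khK] add_left_mono[OF chiV] by (rule order_trans)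
    show "wnorm2 c (\<lambda>x. ?f k x - ?f (min k kh) x) \<le> ?A kh + ennreal chi2 * ?V k"
      using A_ge[OF k] add_left_mono[OF chiV] by (rule order_trans)
    show "wnorm2 c (\<lambda>x. ?f k x - of_real (f x)) \<le> ennreal (1 / 3) * (ennreal (1 / (real n)\<^sup>2) * stoch_err n k Y + bias k)"
      by (rule fhat_f_bound[OF n Y k1])
  qed auto
  \<comment> \<open>Exchanging the two penalties forms the criterion at \<open>kh\<close>, so that
    minimality applies.\<close>
  also have "(?A k + ennreal chi2 * ?V kh) + (?A kh + ennreal chi2 * ?V k)
      = (?A kh + ennreal chi2 * ?V kh) + (?A k + ennreal chi2 * ?V k)" by (simp add: add_ac)
  also have "3 * ((?A kh + ennreal chi2 * ?V kh) + (?A k + ennreal chi2 * ?V k) + ennreal (1 / 3) * (ennreal (1 / (real n)\<^sup>2) * stoch_err n k Y + bias k))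
      \<le> 3 * ((?A k + ennreal chi2 * ?V k) + (?A k + ennreal chi2 * ?V k) + ennreal (1 / 3) * (ennreal (1 / (real n)\<^sup>2) * stoch_err n k Y + bias k))"
    by (intro mult_left_mono add_mono[OF add_mono[OF argmin order_refl] order_refl]) simp
  also have "\<dots> \<le> 3 * (((bias k + rest n Y) + ennreal chi2 * ?V k) + ((bias k + rest n Y) + ennreal chi2 * ?V k)
      + ennreal (1 / 3) * (ennreal (1 / (real n)\<^sup>2) * stoch_err n k Y + bias k))"
    using Ahat_le[OF n Y k1 chi(1) fin] by (intro mult_left_mono add_mono) auto
  also have "\<dots> = 7 * bias k + 6 * rest n Y + ennreal (6 * chi2) * ?V k + ennreal (1 / (real n)\<^sup>2) * stoch_err n k Y"
  proof -
    have three: "3 * (ennreal (1 / 3) * z) = z" for z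
    proof -
      have "3 * ennreal (1 / 3) = 1" by (simp add: ennreal_mult[symmetric] flip: ennreal_numeral)
      thus ?thesis by (simp flip: mult.assoc)
    qed
    have six: "ennreal (6 * chi2) * z = 6 * (ennreal chi2 * z)" for z
      using chi by (simp add: ennreal_mult mult.assoc)
    have double: "6 * z = 3 * z + 3 * z" for z :: ennreal
    proof -
      have "(3 + 3) * z = 3 * z + 3 * z" by (rule distrib_right)
      thus ?thesis by simp
    qed
    have gen: "3 * ((b + q + v) + (b + q + v) + w) = 6 * b + 6 * q + 6 * v + 3 * w" for b q v w :: ennreal
      unfolding double by (simp only: distrib_left add_ac)
    have "7 * b = 6 * b + b" for b :: ennreal
    proof -
      have "(6 + 1) * b = 6 * b + b" by (simp only: distrib_right mult_1_left)
      thus ?thesis by simp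
    qed
    thus ?thesis unfolding gen three six by (simp only: add_ac)
  qed
  finally show ?thesis .
qed

text \<open>The expectation of \<open>Vhat\<close> is twice \<open>V\<close>, so the coefficient 6
  of the penalty becomes 12, and the stochastic error at \<open>k\<close> adds one more
  \<open>V\<close>. The absolute value keeps the constant positive for every real
  \<open>chi2\<close>.\<close>

lemma oracle_bound:
  assumes n: "1 \<le> n" and k: "k \<in> Kset c g r n" and chi: "72 \<le> chi1" "chi1 \<le> chi2"
    and kh: "khat_choice c g r chi1 chi2 n khat" and fin: "finite (Kset c g r n)"
    and S: "(\<Sum>k\<in>Kset c g r n. tail_term s B k + tail_rate s n) \<le> S"
  shows "(\<integral>\<^sup>+Y. wnorm2 c (\<lambda>x. fhat c g r n Y (real (khat Y)) x - complex_of_real (f x)) \<partial>sample_law f g n)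
    \<le> ennreal (12 * \<bar>chi2\<bar> + 7) * (bias k + V c f g r n k) + ennreal (6 * rest_const S / real n)"
proof -
  have k1: "1 \<le> k" using k by (simp add: Kset_iff)
  interpret Q: prob_space "PiM {..<n} (\<lambda>_. P)" by (intro prob_space_PiM P_prob)
  let ?E = "\<lambda>h. \<integral>\<^sup>+Y. h Y \<partial>PiM {..<n} (\<lambda>_. P)"
  note [measurable] = Z_measurable[where n = n] sigma_hat_measurable[of n]
  have Vm: "Vhat c g r n Y k = ennreal (2 * ridge_sq k / real n) * ennreal (sigma_hat c n Y)" for Y
    using ridge_sq_nonneg[of k] sigma_hat_nonneg[of n Y] by (simp add: Vhat_eq[OF n k1] ennreal_mult[symmetric] mult_ac)
  have rm: "rest n \<in> borel_measurable (PiM {..<n} (\<lambda>_. P))" unfolding rest_def by measurable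
  note [measurable] = rm
  have "(\<integral>\<^sup>+Y. wnorm2 c (\<lambda>x. fhat c g r n Y (real (khat Y)) x - complex_of_real (f x)) \<partial>sample_law f g n)
     \<le> ?E (\<lambda>Y. 7 * bias k + 6 * rest n Y + ennreal (6 * chi2) * Vhat c g r n Y k + ennreal (1 / (real n)\<^sup>2) * stoch_err n k Y)"
    unfolding sample_law_def
  proof (rule nn_integral_mono)
    fix Y assume "Y \<in> space (PiM {..<n} (\<lambda>_. P))"
    hence Y: "Y \<in> space (PiM {..<n} (\<lambda>_. Rplus))" by (simp add: space_PiM space_P)
    hence pos: "0 < Y i" if "i < n" for i using that by (auto simp: space_PiM)
    show "wnorm2 c (\<lambda>x. fhat c g r n Y (real (khat Y)) x - complex_of_real (f x))
      \<le> 7 * bias k + 6 * rest n Y + ennreal (6 * chi2) * Vhat c g r n Y k + ennreal (1 / (real n)\<^sup>2) * stoch_err n k Y"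
      using kh Y pos by (intro loss_pointwise[OF n k chi _ fin]) (auto simp: khat_choice_def)
  qed
  also have "\<dots> = 7 * bias k + 6 * ?E (rest n) + ennreal (6 * chi2) * (ennreal (2 * ridge_sq k / real n) * ?E (\<lambda>Y. ennreal (sigma_hat c n Y)))
      + ennreal (1 / (real n)\<^sup>2) * ?E (stoch_err n k)"
    unfolding Vm by (simp add: nn_integral_add nn_integral_cmult Q.emeasure_space_1)
  also have "\<dots> \<le> 7 * bias k + 6 * ennreal (rest_const S / real n) + ennreal (6 * chi2) * (ennreal (2 * ridge_sq k / real n) * ennreal s)
      + ennreal (1 / (real n)\<^sup>2) * ennreal (real n * s * ridge_sq k)"
    using rest_expectation[OF n _ fin S] k sigma_hat_expectation[OF n] stoch_err_expectation[OF k1]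
    unfolding sample_law_def by (intro add_mono mult_left_mono) auto
  also have "\<dots> = 7 * bias k + ennreal (12 * chi2 + 1) * V c f g r n k + ennreal (6 * rest_const S / real n)"
  proof -
    have S0: "0 \<le> S"
    proof -
      have "0 \<le> tail_term s B k + tail_rate s n" for k
        using s_pos B_pos tail_term_nonneg[of s B k] by (simp add: tail_rate_def)
      thus ?thesis using S by (meson order_trans sum_nonneg)
    qed
    have "0 \<le> rest_const S" using S0 s_pos m_nonneg by (simp add: rest_const_def)
    hence 1: "6 * ennreal (rest_const S / real n) = ennreal (6 * rest_const S / real n)"
      by (simp flip: ennreal_numeral ennreal_mult)
    define w where "w = s * ridge_sq k / real n"
    have w: "0 \<le> w" using s_pos ridge_sq_nonneg[of k] by (simp add: w_def)
    have 2: "ennreal (6 * chi2) * (ennreal (2 * ridge_sq k / real n) * ennreal s) = ennreal (12 * chi2 * w)"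
      using chi s_pos ridge_sq_nonneg[of k] by (simp add: ennreal_mult[symmetric] w_def mult_ac)
    have 3: "ennreal (1 / (real n)\<^sup>2) * ennreal (real n * s * ridge_sq k) = ennreal w"
      using n s_pos ridge_sq_nonneg[of k] by (simp add: ennreal_mult[symmetric] w_def power2_eq_square)
    have 4: "ennreal (12 * chi2 + 1) * V c f g r n k = ennreal (12 * chi2 * w) + ennreal w"
      unfolding V_eq[OF n k1] w_def[symmetric] using chi w
      by (simp add: ennreal_mult[symmetric] ennreal_plus[symmetric] distrib_right del: ennreal_plus)
    show ?thesis unfolding 1 2 3 4 by (simp only: add_ac)
  qed
  also have "\<dots> \<le> ennreal (12 * \<bar>chi2\<bar> + 7) * bias k + ennreal (12 * \<bar>chi2\<bar> + 7) * V c f g r n k + ennreal (6 * rest_const S / real n)"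
  proof (intro add_mono mult_right_mono order_refl)
    show "7 \<le> ennreal (12 * \<bar>chi2\<bar> + 7)" using ennreal_leI[of 7 "12 * \<bar>chi2\<bar> + 7"] by simp
    show "ennreal (12 * chi2 + 1) \<le> ennreal (12 * \<bar>chi2\<bar> + 7)" by (intro ennreal_leI) simp
  qed auto
  finally show ?thesis by (simp add: distrib_left)
qed

end

definition oracle_hyps ::
    "real \<Rightarrow> (real \<Rightarrow> real) \<Rightarrow> (real \<Rightarrow> real) \<Rightarrow> real \<Rightarrow> real \<Rightarrow> real \<Rightarrow> real \<Rightarrow> real \<Rightarrow> real \<Rightarrow> bool" where
  "oracle_hyps c f g cg Cg \<gamma> r chi1 chi2 \<longleftrightarrow>
      pos_density f \<and> pos_density g \<and> (\<lambda>x. complex_of_real (f x)) \<in> wL2 c \<and>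
      moment_Y f g (5 * (c - 1)) < \<infinity> \<and> wsup_norm c g < \<infinity> \<and> 0 < cg \<and> 0 < Cg \<and> 0 < \<gamma> \<and>
      (\<forall>t. cg * (1 + t\<^sup>2) powr (- \<gamma> / 2) \<le> cmod (mellin c g t) \<and>
           cmod (mellin c g t) \<le> Cg * (1 + t\<^sup>2) powr (- \<gamma> / 2)) \<and>
      max 0 (1 / \<gamma> - 1) < r \<and> 72 \<le> chi1 \<and> chi1 \<le> chi2"

text \<open>\<open>C\<close> is quantified before \<open>f\<close>, the tuning constants, the sample
  size and the selection rule: it may depend on \<open>f\<close> only through the three numbers
  \<open>M\<close>, \<open>\<sigma>\<close> and \<open>b\<close>.\<close>

definition oracle_constant ::
    "real \<Rightarrow> ennreal \<Rightarrow> ennreal \<Rightarrow> ennreal \<Rightarrow> (real \<Rightarrow> real) \<Rightarrow> real \<Rightarrow> real \<Rightarrow> bool" where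
  "oracle_constant c M \<sigma> b g r C \<longleftrightarrow> (\<forall>f cg Cg \<gamma> chi1 chi2 n khat.
      oracle_hyps c f g cg Cg \<gamma> r chi1 chi2 \<longrightarrow>
      M = moment_Y f g (5 * (c - 1)) \<longrightarrow> \<sigma> = sigma_c c f g \<longrightarrow> b = wsup_norm c g \<longrightarrow>
      1 \<le> n \<and> Kset c g r n \<noteq> {} \<and> khat_choice c g r chi1 chi2 n khat \<longrightarrow>
        (\<integral>\<^sup>+Y. wnorm2 c (\<lambda>x. fhat c g r n Y (real (khat Y)) x - complex_of_real (f x)) \<partial>sample_law f g n)
        \<le> ennreal (12 * \<bar>chi2\<bar> + 7) *
            (INF k \<in> Kset c g r n. norm2 (\<lambda>t. indicator (Gset c g (real k)) t * mellin c f t) + V c f g r n k)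
          + ennreal (C / real n))"

text \<open>If no admissible data share the given values, any \<open>C\<close> will do. Otherwise
  one witness supplies \<open>cg\<close>, \<open>Cg\<close> and \<open>\<gamma>\<close>, and the
  constant built from them serves every other \<open>f\<close> with the same values.\<close>

lemma oracle_constant_exists: "\<exists>C>0. oracle_constant c M \<sigma> b g r C"
proof (cases "\<exists>f cg Cg \<gamma> chi1 chi2. oracle_hyps c f g cg Cg \<gamma> r chi1 chi2
    \<and> M = moment_Y f g (5 * (c - 1)) \<and> \<sigma> = sigma_c c f g \<and> b = wsup_norm c g")
  case True
  then obtain f0 cg Cg \<gamma> chi1' chi2' where H0: "oracle_hyps c f0 g cg Cg \<gamma> r chi1' chi2'"
    "M = moment_Y f0 g (5 * (c - 1))" "\<sigma> = sigma_c c f0 g" "b = wsup_norm c g" by blast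
  interpret ridge_multiplier c g cg Cg \<gamma> r
    using H0(1) by unfold_locales (auto simp: oracle_hyps_def)
  \<comment> \<open>The bounds on the transform concern \<open>g\<close> alone, so each
    \<open>f\<close> is placed in the locale with the constants of the witness in place of its
    own.\<close>
  have dec: "deconvolution c g cg Cg \<gamma> r f" if "oracle_hyps c f g cg' Cg' \<gamma>' r chi1 chi2" for f cg' Cg' \<gamma>' chi1 chi2
    using that by unfold_locales (auto simp: oracle_hyps_def)
  define s where "s = enn2real \<sigma>"
  define B where "B = enn2real b * (s / enn2real (mom g (2 * (c - 1)))) + 1"
  interpret D0: deconvolution c g cg Cg \<gamma> r f0 by (rule dec[OF H0(1)])
  have s0: "D0.s = s" and B0: "D0.B = B" using H0 by (simp_all add: D0.s_def D0.B_def s_def B_def)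
  obtain S where S: "0 < S" "\<And>n. 1 \<le> n \<Longrightarrow> finite (Kset c g r n)"
    "\<And>n. 1 \<le> n \<Longrightarrow> (\<Sum>k\<in>Kset c g r n. tail_term s B k + tail_rate s n) \<le> S"
    using sum_tail_bounded[OF D0.s_pos D0.B_pos] unfolding s0 B0 by blast
  define C where "C = 6 * (16 / 3 * enn2real M / (s * sqrt s) + 2 / 3 * S + 72 * (1 + enn2real M) / s)"
  have "0 < s" using D0.s_pos s0 by simp
  hence "0 < C" using S(1) unfolding C_def
    by (intro mult_pos_pos add_pos_nonneg add_nonneg_pos divide_nonneg_nonneg mult_nonneg_nonneg) auto
  moreover have "oracle_constant c M \<sigma> b g r C"
    unfolding oracle_constant_def
  proof (intro allI impI, elim conjE)
    fix f cg' Cg' \<gamma>' chi1 chi2 n khat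
    assume hyps: "oracle_hyps c f g cg' Cg' \<gamma>' r chi1 chi2"
      and data: "M = moment_Y f g (5 * (c - 1))" "\<sigma> = sigma_c c f g" "b = wsup_norm c g"
    assume n: "1 \<le> n" and ne: "Kset c g r n \<noteq> {}" and kh: "khat_choice c g r chi1 chi2 n khat"
    interpret D: deconvolution c g cg Cg \<gamma> r f by (rule dec[OF hyps])
    have eqs: "D.s = s" "D.B = B" "D.m = enn2real M"
      using data by (simp_all add: D.s_def D.B_def D.m_def s_def B_def)
    have C_eq: "6 * D.rest_const S = C" by (simp add: D.rest_const_def eqs C_def)
    let ?F = "\<lambda>k. norm2 (\<lambda>t. indicator (Gset c g (real k)) t * mellin c f t) + V c f g r n k"
    \<comment> \<open>\<open>Kset\<close> is finite and nonempty, so the infimum is attained and a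
      bound at a single \<open>k\<close> is enough.\<close>
    have "(INF k \<in> Kset c g r n. ?F k) \<in> ?F ` Kset c g r n"
      using S(2)[OF n] ne by (subst cInf_eq_Min) (auto intro!: Min_in)
    then obtain k where k: "k \<in> Kset c g r n" and inf: "(INF k \<in> Kset c g r n. ?F k) = ?F k" by auto
    show "(\<integral>\<^sup>+Y. wnorm2 c (\<lambda>x. fhat c g r n Y (real (khat Y)) x - complex_of_real (f x)) \<partial>sample_law f g n)
        \<le> ennreal (12 * \<bar>chi2\<bar> + 7) * (INF k \<in> Kset c g r n. ?F k) + ennreal (C / real n)"
      unfolding inf unfolding C_eq[symmetric] D.bias_def[symmetric]
      by (rule D.oracle_bound[OF n k _ _ kh S(2)[OF n]]) (use hyps S(3)[OF n] in \<open>simp_all add: eqs oracle_hyps_def\<close>)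
  qed
  ultimately show ?thesis by blast
next
  case False
  hence "oracle_constant c M \<sigma> b g r 1" unfolding oracle_constant_def by blast
  thus ?thesis by (intro exI[of _ 1]) simp
qed

theorem theorem3:
  shows "\<exists>(C1 :: real \<Rightarrow> real \<Rightarrow> real)
      (C2 :: real \<Rightarrow> ennreal \<Rightarrow> ennreal \<Rightarrow> ennreal \<Rightarrow> (real \<Rightarrow> real) \<Rightarrow> real \<Rightarrow> real).
    (\<forall>chi1 chi2. 0 < C1 chi1 chi2) \<and> (\<forall>c m s b g r. 0 < C2 c m s b g r) \<and>
    (\<forall>(c::real) (f :: real \<Rightarrow> real) (g :: real \<Rightarrow> real) (cg::real) (Cg::real) (\<gamma>::real)
      (r::real) (chi1::real) (chi2::real).
      pos_density f \<and> pos_density g \<and>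
      (\<lambda>x. complex_of_real (f x)) \<in> wL2 c \<and>
      moment_Y f g (5 * (c - 1)) < \<infinity> \<and>
      wsup_norm c g < \<infinity> \<and>
      0 < cg \<and> 0 < Cg \<and> 0 < \<gamma> \<and>
      (\<forall>t. cg * (1 + t\<^sup>2) powr (- \<gamma> / 2) \<le> cmod (mellin c g t) \<and>
           cmod (mellin c g t) \<le> Cg * (1 + t\<^sup>2) powr (- \<gamma> / 2)) \<and>
      max 0 (1 / \<gamma> - 1) < r \<and> 72 \<le> chi1 \<and> chi1 \<le> chi2
      \<longrightarrow>
      (\<forall>(n::nat) (khat :: (nat \<Rightarrow> real) \<Rightarrow> nat).
        1 \<le> n \<and> Kset c g r n \<noteq> {} \<and> khat_choice c g r chi1 chi2 n khat \<longrightarrow>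
        (\<integral>\<^sup>+Y. wnorm2 c (\<lambda>x. fhat c g r n Y (real (khat Y)) x - complex_of_real (f x))
            \<partial>sample_law f g n)
        \<le> ennreal (C1 chi1 chi2) *
            (INF k \<in> Kset c g r n.
              norm2 (\<lambda>t. indicator (Gset c g (real k)) t * mellin c f t) + V c f g r n k)
          + ennreal (C2 c (moment_Y f g (5 * (c - 1))) (sigma_c c f g) (wsup_norm c g) g r / real n)))"
proof -
  \<comment> \<open>Choosing by \<open>SOME\<close> from these arguments alone guarantees that the
    constant depends on nothing else.\<close>
  define C2 where "C2 = (\<lambda>c M \<sigma> b g r. SOME C. C > 0 \<and> oracle_constant c M \<sigma> b g r C)"
  have C2: "C2 c M \<sigma> b g r > 0 \<and> oracle_constant c M \<sigma> b g r (C2 c M \<sigma> b g r)" for c M \<sigma> b g r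
    unfolding C2_def by (rule someI_ex) (rule oracle_constant_exists)
  show ?thesis
  proof (rule exI[of _ "\<lambda>chi1 chi2. 12 * \<bar>chi2\<bar> + 7"], rule exI[of _ C2], intro conjI allI impI)
    show "0 < 12 * \<bar>chi2\<bar> + 7" for chi2 :: real by simp
    show "0 < C2 c M \<sigma> b g r" for c M \<sigma> b g r using C2 by blast
  qed (use C2 in \<open>unfold oracle_constant_def oracle_hyps_def, blast\<close>)
qed

end
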